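(* Let $\mathbb{X}$ be a Euclidean space, $f:\mathbb{X}\to\mathbb{R}$ and $G:\mathbb{X}\to\mathbb{S}^n$ twice continuously differentiable, and consider the nonlinear semidefinite program $\min_{x}f(x)+\delta_{\mathbb{S}^n_+}(G(x))$ (equivalently $\min f(x)$ s.t. $G(x)\in\mathbb{S}^n_+$). Let $\bar x\in\mathbb{X}$ be a stationary point and $\overline{Y}\in\mathcal{M}(\bar x)$. Then the following are equivalent: (i) the strong variational sufficient condition for local optimality holds with respect to $(\bar x,\overline{Y})$; (ii) the strong second order sufficient condition holds at $(\bar x,\overline{Y})$: $$\langle L_{xx}''(\bar x,\overline{Y})d,d\rangle-\varUpsilon_{G(\bar x)}\big(\overline{Y},G'(\bar x)d\big)>0\quad\text{for all } d\in\mathbb{X}\setminus\{0\}\text{ with } G'(\bar x)d\in{\rm aff}\,\mathcal{C}_{\mathbb{S}^n_+}(G(\bar x),\overline{Y});$$ (iii) there exist $\rho_0>0$ and $\underline{\eta}>0$ such that for every $\rho\ge\rho_0$ and every $W\in\partial_B\Pi_{\mathbb{S}^n_-}(G(\bar x)+\rho^{-1}\overline{Y})$, $$\langle d,\mathcal{A}_\rho(\overline{Y},W)d\rangle\ge\underline{\eta}\|d\|^2\quad\text{for all } d\in\mathbb{X},$$ where $\mathcal{A}_\rho(\overline{Y},W)=L_{xx}''(\bar x,\overline{Y})+\rho\,G'(\bar x)^*WG'(\bar x)$.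
   Context: $\mathbb{S}^n$ is the space of real symmetric $n\times n$ matrices with the Frobenius inner product, $\mathbb{S}^n_\pm$ the cones of positive/negative semidefinite matrices, $\delta_C$ the indicator function of $C$, $\Pi_{\mathbb{S}^n_-}$ the metric projection onto $\mathbb{S}^n_-$, and $G'(\bar x)^*$ the adjoint of $G'(\bar x)$. $L(x,Y)=f(x)+\langle Y,G(x)\rangle$. $\mathcal{M}(\bar x)=\{Y\in\mathbb{S}^n\mid L_x'(\bar x,Y)=0,\ G(\bar x)\in\mathbb{S}^n_+,\ Y\in\mathbb{S}^n_-,\ \langle G(\bar x),Y\rangle=0\}$; $\bar x$ is stationary if this set is nonempty. Let $A=G(\bar x)+\overline{Y}=P\Lambda(A)P^T$ with $P=[P_\alpha\ P_\beta\ P_\gamma]$ orthogonal and $\alpha,\beta,\gamma$ the index sets of positive, zero, negative eigenvalues of $A$. Then ${\rm aff}\,\mathcal{C}_{\mathbb{S}^n_+}(G(\bar x),\overline{Y})=\{H\in\mathbb{S}^n\mid P_\beta^THP_\gamma=0,\ P_\gamma^THP_\gamma=0\}$ (the affine hull of the critical cone $\mathcal{T}_{\mathbb{S}^n_+}(G(\bar x))\cap\overline{Y}^\perp$). The $\sigma$-term is $\varUpsilon_{G(\bar x)}(\overline{Y},H)=2\langle\overline{Y},HG(\bar x)^\dagger H\rangle$, $G(\bar x)^\dagger$ the Moore–Penrose pseudo-inverse. $\partial_B\Pi_{\mathbb{S}^n_-}(Z)$ is the B(ouligand)-subdifferential: the set of limits of Jacobians $\Pi_{\mathbb{S}^n_-}'(Z^k)$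 along sequences $Z^k\to Z$ of points where $\Pi_{\mathbb{S}^n_-}$ is differentiable. Strong variational sufficiency: set $\phi(x,U)=f(x)+\delta_{\mathbb{S}^n_+}(G(x)+U)$ and $\phi_r(x,U)=\phi(x,U)+\frac r2\|U\|^2$. $\phi_r$ is variationally strongly convex with respect to $((\bar x,0),(0,\overline{Y}))\in{\rm gph}\,\partial\phi_r$ if there exist open convex neighborhoods $\mathcal{W}$ of $(\bar x,0)$ and $\mathcal{Z}$ of $(0,\overline{Y})$ and a proper closed strongly convex function $\psi\le\phi_r$ on $\mathcal{W}$ with $(\mathcal{W}\times\mathcal{Z})\cap{\rm gph}\,\partial\psi=(\mathcal{W}\times\mathcal{Z})\cap{\rm gph}\,\partial\phi_r$ and $\psi=\phi_r$ at points of this common set; $\partial$ denotes the limiting (Mordukhovich) subdifferential. The strong variational sufficient condition holds with respect to $(\bar x,\overline{Y})$ if such an $r>0$ exists. *)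

theory Defs
  imports "HOL-Analysis.Analysis"
begin

text \<open>On real^'n^'n the library inner product is the Frobenius inner product
  sum_ij A_ij B_ij, and norm is the Frobenius norm.\<close>

definition Sym :: "(real^'n^'n) set" where
  "Sym = {M. transpose M = M}"

definition psd :: "(real^'n^'n) set" where
  "psd = {M. transpose M = M \<and> (\<forall>v. v \<bullet> (M *v v) \<ge> 0)}"

definition nsd :: "(real^'n^'n) set" where
  "nsd = {M. transpose M = M \<and> (\<forall>v. v \<bullet> (M *v v) \<le> 0)}"

definition proj_nsd :: "real^'n^'n \<Rightarrow> real^'n^'n" where
  "proj_nsd Z = closest_point nsd Z"

definition pinv :: "real^'n^'n \<Rightarrow> real^'n^'n" where
  "pinv M = (THE X. M ** X ** M = M \<and> X ** M ** X = X \<and>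
                    transpose (M ** X) = M ** X \<and> transpose (X ** M) = X ** M)"

definition C2 :: "('a::euclidean_space \<Rightarrow> 'b::euclidean_space) \<Rightarrow> bool" where
  "C2 F \<longleftrightarrow> (\<exists>(F' :: 'a \<Rightarrow> ('a \<Rightarrow>\<^sub>L 'b)) (F'' :: 'a \<Rightarrow> ('a \<Rightarrow>\<^sub>L ('a \<Rightarrow>\<^sub>L 'b))).
      (\<forall>x. (F has_derivative blinfun_apply (F' x)) (at x)) \<and>
      (\<forall>x. (F' has_derivative blinfun_apply (F'' x)) (at x)) \<and>
      continuous_on UNIV F'')"

definition hess :: "('a::euclidean_space \<Rightarrow> 'b::real_normed_vector) \<Rightarrow> 'a \<Rightarrow> 'a \<Rightarrow> 'a \<Rightarrow> 'b" where
  "hess F x d e = frechet_derivative (\<lambda>z. frechet_derivative F (at z) d) (at x) e"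

definition Lag :: "('a \<Rightarrow> real) \<Rightarrow> ('a \<Rightarrow> real^'n^'n) \<Rightarrow> 'a \<Rightarrow> real^'n^'n \<Rightarrow> real" where
  "Lag f G x Y = f x + Y \<bullet> G x"

definition multipliers :: "('a::euclidean_space \<Rightarrow> real) \<Rightarrow> ('a \<Rightarrow> real^'n^'n) \<Rightarrow> 'a \<Rightarrow> (real^'n^'n) set" where
  "multipliers f G xb = {Y. Y \<in> Sym \<and>
      frechet_derivative (\<lambda>x. Lag f G x Y) (at xb) = (\<lambda>d. 0) \<and>
      G xb \<in> psd \<and> Y \<in> nsd \<and> G xb \<bullet> Y = 0}"

definition stationary :: "('a::euclidean_space \<Rightarrow> real) \<Rightarrow> ('a \<Rightarrow> real^'n^'n) \<Rightarrow> 'a \<Rightarrow> bool" where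
  "stationary f G xb \<longleftrightarrow> multipliers f G xb \<noteq> {}"

definition Lxx :: "('a::euclidean_space \<Rightarrow> real) \<Rightarrow> ('a \<Rightarrow> real^'n^'n) \<Rightarrow> 'a \<Rightarrow> real^'n^'n \<Rightarrow> 'a \<Rightarrow> 'a" where
  "Lxx f G x Y d = (\<Sum>b\<in>Basis. hess (\<lambda>z. Lag f G z Y) x d b *\<^sub>R b)"

definition tangent_cone :: "(real^'n^'n) set \<Rightarrow> real^'n^'n \<Rightarrow> (real^'n^'n) set" where
  "tangent_cone C X = {H. \<exists>(t :: nat \<Rightarrow> real) Hk. (\<forall>k. t k > 0 \<and> X + t k *\<^sub>R Hk k \<in> C) \<and>
       t \<longlonglongrightarrow> 0 \<and> Hk \<longlonglongrightarrow> H}"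

definition critical_cone :: "real^'n^'n \<Rightarrow> real^'n^'n \<Rightarrow> (real^'n^'n) set" where
  "critical_cone X Y = tangent_cone psd X \<inter> {H. Y \<bullet> H = 0}"

definition Upsilon :: "real^'n^'n \<Rightarrow> real^'n^'n \<Rightarrow> real^'n^'n \<Rightarrow> real" where
  "Upsilon X Y H = 2 * (Y \<bullet> (H ** pinv X ** H))"

definition B_subdiff_proj_nsd :: "real^'n^'n \<Rightarrow> (real^'n^'n \<Rightarrow> real^'n^'n) set" where
  "B_subdiff_proj_nsd Z = {W. \<exists>(Zk :: nat \<Rightarrow> real^'n^'n) Wk.
      (\<forall>k. Zk k \<in> Sym \<and> (proj_nsd has_derivative Wk k) (at (Zk k) within Sym)) \<and>
      Zk \<longlonglongrightarrow> Z \<and> (\<forall>H\<in>Sym. (\<lambda>k. Wk k H) \<longlonglongrightarrow> W H)}"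

definition ind :: "'v set \<Rightarrow> 'v \<Rightarrow> ereal" where
  "ind C x = (if x \<in> C then 0 else \<infinity>)"

definition regular_subgrad :: "'v set \<Rightarrow> ('v::real_inner \<Rightarrow> ereal) \<Rightarrow> 'v \<Rightarrow> 'v set" where
  "regular_subgrad E \<phi> z = {v. v \<in> E \<and> z \<in> E \<and> \<bar>\<phi> z\<bar> \<noteq> \<infinity> \<and>
      (\<forall>\<epsilon>>0. \<exists>\<delta>>0. \<forall>z'\<in>E. norm (z' - z) < \<delta> \<longrightarrow>
          \<phi> z + ereal (v \<bullet> (z' - z) - \<epsilon> * norm (z' - z)) \<le> \<phi> z')}"

definition lim_subgrad :: "'v set \<Rightarrow> ('v::real_inner \<Rightarrow> ereal) \<Rightarrow> 'v \<Rightarrow> 'v set" where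
  "lim_subgrad E \<phi> z = {v. z \<in> E \<and> \<bar>\<phi> z\<bar> \<noteq> \<infinity> \<and>
      (\<exists>(zk :: nat \<Rightarrow> 'v) vk. (\<forall>k. vk k \<in> regular_subgrad E \<phi> (zk k)) \<and>
         zk \<longlonglongrightarrow> z \<and> (\<lambda>k. \<phi> (zk k)) \<longlonglongrightarrow> \<phi> z \<and> vk \<longlonglongrightarrow> v)}"

definition proper_on :: "'v set \<Rightarrow> ('v \<Rightarrow> ereal) \<Rightarrow> bool" where
  "proper_on E \<psi> \<longleftrightarrow> (\<forall>x\<in>E. \<psi> x \<noteq> -\<infinity>) \<and> (\<exists>x\<in>E. \<psi> x \<noteq> \<infinity>)"

definition closed_fun_on :: "'v set \<Rightarrow> ('v::topological_space \<Rightarrow> ereal) \<Rightarrow> bool" where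
  "closed_fun_on E \<psi> \<longleftrightarrow> closed {(x, t::real). x \<in> E \<and> \<psi> x \<le> ereal t}"

definition strongly_convex_on :: "'v set \<Rightarrow> ('v::real_normed_vector \<Rightarrow> ereal) \<Rightarrow> bool" where
  "strongly_convex_on E \<psi> \<longleftrightarrow> (\<exists>\<mu>>0. \<forall>x\<in>E. \<forall>y\<in>E. \<forall>t::real. 0 \<le> t \<and> t \<le> 1 \<longrightarrow>
      \<psi> (t *\<^sub>R x + (1 - t) *\<^sub>R y) \<le>
        ereal t * \<psi> x + ereal (1 - t) * \<psi> y - ereal (\<mu> / 2 * t * (1 - t) * (norm (x - y))\<^sup>2))"

text \<open>Variational strong convexity of phi (on subspace E) w.r.t. (zb,vb) in gph of the
  limiting subdifferential. Relatively open convex neighbourhoods in E are written as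
  W \<inter> E with W open convex in the ambient space (subgradients automatically lie in E).\<close>
definition var_strongly_convex :: "'v set \<Rightarrow> ('v::real_inner \<Rightarrow> ereal) \<Rightarrow> 'v \<Rightarrow> 'v \<Rightarrow> bool" where
  "var_strongly_convex E \<phi> zb vb \<longleftrightarrow> vb \<in> lim_subgrad E \<phi> zb \<and>
     (\<exists>W Z \<psi>. open W \<and> convex W \<and> zb \<in> W \<and> open Z \<and> convex Z \<and> vb \<in> Z \<and>
        proper_on E \<psi> \<and> closed_fun_on E \<psi> \<and> strongly_convex_on E \<psi> \<and>
        (\<forall>z\<in>W \<inter> E. \<psi> z \<le> \<phi> z) \<and>
        {(z, v). z \<in> W \<inter> E \<and> v \<in> Z \<and> v \<in> lim_subgrad E \<psi> z} =
          {(z, v). z \<in> W \<inter> E \<and> v \<in> Z \<and> v \<in> lim_subgrad E \<phi> z} \<and>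
        (\<forall>z v. z \<in> W \<inter> E \<and> v \<in> Z \<and> v \<in> lim_subgrad E \<phi> z \<longrightarrow> \<psi> z = \<phi> z))"

definition phi_r :: "('a \<Rightarrow> real) \<Rightarrow> ('a \<Rightarrow> real^'n^'n) \<Rightarrow> real \<Rightarrow> 'a \<times> (real^'n^'n) \<Rightarrow> ereal" where
  "phi_r f G r z = ereal (f (fst z)) + ind psd (G (fst z) + snd z) + ereal (r / 2 * (norm (snd z))\<^sup>2)"

definition strong_var_suff :: "('a::euclidean_space \<Rightarrow> real) \<Rightarrow> ('a \<Rightarrow> real^'n^'n) \<Rightarrow> 'a \<Rightarrow> real^'n^'n \<Rightarrow> bool" where
  "strong_var_suff f G xb Yb \<longleftrightarrow> (\<exists>r>0.
      var_strongly_convex (UNIV \<times> Sym) (phi_r f G r) (xb, 0) (0, Yb))"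

end

theory Submission
  imports Defs
begin

text \<open>
  Everything is reduced to one local estimate. For \<open>X'\<close>, \<open>X''\<close> positive semidefinite and \<open>Y'\<close>
  negative semidefinite with \<open>\<langle>X', Y'\<rangle> = 0\<close>, near the reference pair \<open>(X, Y)\<close>, and \<open>H\<close> small,
  \<open>- \<langle>Y', X''\<rangle> + r/2 |X'' - X' - H|\<^sup>2\<close> is at least
  \<open>- \<Upsilon>(Y, H)/2 + r/2 pen(H) - O(1/r) |H|\<^sup>2 - o(|H|\<^sup>2)\<close>, uniformly, where \<open>pen\<close> vanishes exactly on the
  affine hull of the critical cone. It follows by testing weak duality with the explicit elements
  \<open>(I + S) Y' (I + S)\<^sup>T\<close> of the negative semidefinite cone, \<open>S\<close> linear in \<open>H\<close>, so that no
  eigendecomposition of \<open>X'\<close>, \<open>Y'\<close> is needed. By Finsler's lemma the second order condition makes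
  \<open>L\<^sub>x\<^sub>x/2\<close> plus this bound uniformly positive definite for all large \<open>r\<close>.

  Applied to the Moreau decompositions of nearby matrices, the estimate bounds every element of
  the B-subdifferential of the projection from below, whence (iii); conversely one particular
  limiting Jacobian recovers (ii). Applied to the constraint, it yields quadratic growth of \<open>\<phi>\<^sub>r\<close> at
  all nearby points of the graph of its subdifferential, and the supremum of the resulting
  quadratics is the strongly convex function required in (i); conversely (i) gives such a growth, which is
  tested along feasible arcs \<open>(I + tK) A (I + tK)\<^sup>T\<close>.
\<close>

subsection \<open>Matrices and the Frobenius inner product\<close>

text \<open>The obstacle is that pairs \<open>(X', Y')\<close> near \<open>(X, Y)\<close> may have
  other ranks and eigenbases, and that zero eigenvalues of \<open>X + Y\<close> can move to either
  side; an expansion of spectral data is not uniform there. A congruence avoids this: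
  \<open>(I + S) Y' (I + S)^T\<close> stays negative semidefinite for free, and
  \<open>X' Y' = 0\<close> cancels its part linear in \<open>S\<close> when it is paired with
  \<open>X'\<close>. With \<open>S\<close> linear in \<open>H\<close> the bound is therefore
  quadratic in \<open>H\<close> to leading order and continuous in \<open>X'\<close>,
  \<open>Y'\<close>; compactness makes it uniform, so \<open>S\<close> has to be good at the
  reference pair only. There it is found blockwise by maximising concave quadratics: the block
  between positive and negative eigenvalues returns the sigma-term, the blocks in \<open>pen\<close>
  return a multiple of \<open>r\<close>, and the price \<open>|S Y + Y S^T|^2 / (2 r)\<close> leaves
  the error of order \<open>1 / r\<close>. The complementary pairs come from two sources: a matrix
  \<open>A\<close> gives \<open>A - proj_nsd A\<close> and \<open>\<rho> proj_nsd A\<close>, and a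
  regular subgradient \<open>(p, s)\<close> of the perturbed objective at \<open>(x, U)\<close>
  gives \<open>G x + U\<close> and \<open>s - r U\<close>.\<close>

lemma inner_matrix_eq: "(A::real^'n^'m) \<bullet> B = (\<Sum>i\<in>UNIV. \<Sum>j\<in>UNIV. A$i$j * B$i$j)"
  by (simp add: inner_vec_def)

lemma norm_matrix_sq: "(norm (A::real^'n^'m))\<^sup>2 = (\<Sum>i\<in>UNIV. \<Sum>j\<in>UNIV. (A$i$j)\<^sup>2)"
  unfolding power2_norm_eq_inner inner_matrix_eq by (simp add: power2_eq_square)

lemma inner_transpose [simp]: "transpose (A::real^'n^'m) \<bullet> transpose B = A \<bullet> B"
  unfolding inner_matrix_eq transpose_def by (simp, rule sum.swap)

lemma norm_transpose [simp]: "norm (transpose (A::real^'n^'m)) = norm A"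
  by (simp add: norm_eq_sqrt_inner)

lemma transpose_add: "transpose (A + B) = transpose A + transpose (B::real^'n^'m)"
  and transpose_diff: "transpose (A - B) = transpose A - transpose (B::real^'n^'m)"
  and transpose_zero [simp]: "transpose (0::real^'n^'m) = 0"
  by (simp_all add: transpose_def vec_eq_iff)

lemma inner_mult_left: "((A::real^'k^'m) ** (B::real^'n^'k)) \<bullet> C = B \<bullet> (transpose A ** C)"
proof -
  have "(A ** B) \<bullet> C = (\<Sum>i\<in>UNIV. \<Sum>j\<in>UNIV. \<Sum>k\<in>UNIV. A$i$k * B$k$j * C$i$j)"
    by (simp add: inner_matrix_eq matrix_matrix_mult_def sum_distrib_right)
  also have "\<dots> = (\<Sum>k\<in>UNIV. \<Sum>j\<in>UNIV. \<Sum>i\<in>UNIV. A$i$k * B$k$j * C$i$j)"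
    by (subst (2) sum.swap, subst sum.swap, rule sum.cong[OF refl], rule sum.swap)
  also have "\<dots> = B \<bullet> (transpose A ** C)"
    by (simp add: inner_matrix_eq matrix_matrix_mult_def transpose_def sum_distrib_left algebra_simps)
  finally show ?thesis .
qed

lemma inner_mult_right: "((A::real^'k^'m) ** (B::real^'n^'k)) \<bullet> C = A \<bullet> (C ** transpose B)"
proof -
  have "(A ** B) \<bullet> C = (transpose B ** transpose A) \<bullet> transpose C"
    by (metis inner_transpose matrix_transpose_mul)
  also have "\<dots> = transpose A \<bullet> transpose (C ** transpose B)"
    by (simp add: inner_mult_left matrix_transpose_mul del: inner_transpose)
  finally show ?thesis by simp
qed

lemma norm_matrix_mult_le: "norm ((A::real^'k^'m) ** (B::real^'n^'k)) \<le> norm A * norm B"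
proof (rule power2_le_imp_le)
  have "(norm (A ** B))\<^sup>2 = (\<Sum>i\<in>UNIV. \<Sum>j\<in>UNIV. (A$i \<bullet> transpose B$j)\<^sup>2)"
    by (simp add: norm_matrix_sq matrix_matrix_mult_def transpose_def inner_vec_def)
  also have "\<dots> \<le> (\<Sum>i\<in>UNIV. \<Sum>j\<in>UNIV. (norm (A$i))\<^sup>2 * (norm (transpose B$j))\<^sup>2)"
    by (intro sum_mono) (metis Cauchy_Schwarz_ineq power2_norm_eq_inner)
  also have "\<dots> = (norm A)\<^sup>2 * (norm (transpose B))\<^sup>2"
    unfolding power2_norm_eq_inner inner_vec_def[of A A] inner_vec_def[of "transpose B" "transpose B"]
    by (simp add: sum_product)
  finally show "(norm (A ** B))\<^sup>2 \<le> (norm A * norm B)\<^sup>2" by (simp add: power_mult_distrib)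
qed simp

lemma matrix_add_rdistrib: "(B + C) ** A = B ** A + C ** (A::real^'n^'k)"
  by (simp add: matrix_matrix_mult_def vec_eq_iff sum.distrib distrib_right)

lemma matrix_scaleR_left: "(c *\<^sub>R A) ** B = c *\<^sub>R (A ** (B::real^'n^'k))"
  and matrix_scaleR_right: "A ** (c *\<^sub>R B) = c *\<^sub>R (A ** (B::real^'n^'k))"
  by (simp_all add: matrix_matrix_mult_def vec_eq_iff sum_distrib_left algebra_simps)

lemma bounded_bilinear_matrix_mult:
  "bounded_bilinear (\<lambda>(A::real^'k^'m) (B::real^'n^'k). A ** B)"
  by (rule bounded_bilinear.intro)
    (auto simp: matrix_add_rdistrib matrix_add_ldistrib matrix_scaleR_left matrix_scaleR_right
      intro!: exI[of _ 1] norm_matrix_mult_le)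

lemmas continuous_on_matrix_mult [continuous_intros] =
  bounded_bilinear.continuous_on[OF bounded_bilinear_matrix_mult]
lemmas has_derivative_matrix_mult [derivative_intros] =
  bounded_bilinear.FDERIV[OF bounded_bilinear_matrix_mult]
lemmas matrix_diff_rdistrib = bounded_bilinear.diff_left[OF bounded_bilinear_matrix_mult]
lemmas matrix_mul_lzero [simp] = bounded_bilinear.zero_left[OF bounded_bilinear_matrix_mult]
lemmas matrix_mul_rzero [simp] = bounded_bilinear.zero_right[OF bounded_bilinear_matrix_mult]

lemma bounded_linear_transpose: "bounded_linear (transpose :: real^'n^'m \<Rightarrow> real^'m^'n)"
  by (rule bounded_linear_intro[where K=1]) (auto simp: transpose_add transpose_scalar)

lemmas continuous_on_transpose [continuous_intros] = bounded_linear.continuous_on[OF bounded_linear_transpose]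
lemmas has_derivative_transpose [derivative_intros] = bounded_linear.has_derivative[OF bounded_linear_transpose]

lemma inner_matrix_vector_transpose: "x \<bullet> ((A::real^'n^'m) *v y) = (transpose A *v x) \<bullet> y"
  by (metis dot_lmul_matrix transpose_matrix_vector inner_commute)

lemma Sym_inner: "M \<in> Sym \<Longrightarrow> x \<bullet> (M *v y) = (M *v x) \<bullet> y"
  by (simp add: inner_matrix_vector_transpose Sym_def)

lemma subspace_Sym: "subspace (Sym :: (real^'n^'n) set)"
  by (auto simp: subspace_def Sym_def transpose_add transpose_scalar)

lemma closed_Sym: "closed (Sym :: (real^'n^'n) set)"
  unfolding Sym_def by (intro closed_Collect_eq continuous_intros)

lemma continuous_on_matrix_vector [continuous_intros]:
  "continuous_on S (\<lambda>M::real^'n^'m. M *v v)"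
  unfolding matrix_vector_mult_def
  by (intro continuous_on_vec_lambda continuous_intros)

lemma
  shows closed_psd: "closed (psd :: (real^'n^'n) set)"
    and closed_nsd: "closed (nsd :: (real^'n^'n) set)"
  unfolding psd_def nsd_def
  by (intro closed_Collect_conj closed_Collect_all closed_Collect_eq closed_Collect_le continuous_intros)+

lemma psd_subset_Sym: "M \<in> psd \<Longrightarrow> M \<in> Sym" and nsd_subset_Sym: "M \<in> nsd \<Longrightarrow> M \<in> Sym"
  by (auto simp: psd_def nsd_def Sym_def)

lemma psd_congruence: "M \<in> psd \<Longrightarrow> A ** M ** transpose A \<in> psd"
  and nsd_congruence: "M \<in> nsd \<Longrightarrow> A ** M ** transpose A \<in> nsd"
proof -
  have *: "transpose (A ** M ** transpose A) = A ** M ** transpose A" if "transpose M = M"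
    by (simp add: matrix_transpose_mul that matrix_mul_assoc)
  have "v \<bullet> ((A ** M ** transpose A) *v v) = (transpose A *v v) \<bullet> (M *v (transpose A *v v))" for v
    by (simp add: inner_matrix_vector_transpose[of v A] flip: matrix_vector_mul_assoc del: transpose_matrix_vector)
  with * show "M \<in> psd \<Longrightarrow> A ** M ** transpose A \<in> psd" "M \<in> nsd \<Longrightarrow> A ** M ** transpose A \<in> nsd"
    by (auto simp: psd_def nsd_def)
qed

lemma psd_scaleR: "c \<ge> 0 \<Longrightarrow> M \<in> psd \<Longrightarrow> c *\<^sub>R M \<in> psd"
  and nsd_scaleR: "c \<ge> 0 \<Longrightarrow> M \<in> nsd \<Longrightarrow> c *\<^sub>R M \<in> nsd"
  and psd_add: "M \<in> psd \<Longrightarrow> N \<in> psd \<Longrightarrow> M + N \<in> psd"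
  and nsd_add: "M \<in> nsd \<Longrightarrow> N \<in> nsd \<Longrightarrow> M + N \<in> nsd"
  by (auto simp: psd_def nsd_def transpose_scalar transpose_add matrix_vector_mult_add_rdistrib
      inner_add_right scaleR_matrix_vector_assoc[symmetric] mult_nonneg_nonpos add_nonpos_nonpos)

lemma zero_in_nsd [simp]: "0 \<in> nsd"
  by (simp add: nsd_def)

lemma convex_nsd: "convex (nsd :: (real^'n^'n) set)"
  by (auto simp: convex_def intro!: nsd_add nsd_scaleR)

section \<open>Eigenvectors of symmetric matrices\<close>

lemma quadratic_nonneg_imp_linear_zero:
  fixes a c :: real
  assumes "\<And>s. 0 \<le> a * s\<^sup>2 + 2 * s * c"
  shows "c = 0"
proof (rule ccontr)
  assume "c \<noteq> 0"
  \<comment> \<open>\<open>a\<close> may be zero or negative; the larger coefficient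
    \<open>b\<close> is positive, and \<open>- c / b\<close> minimises the quadratic with leading
    coefficient \<open>b\<close>.\<close>
  define b where "b = \<bar>a\<bar> + 1"
  have "b > 0" "a \<le> b" by (auto simp: b_def)
  have "0 \<le> a * (- c / b)\<^sup>2 + 2 * (- c / b) * c" by (rule assms)
  also have "\<dots> \<le> b * (- c / b)\<^sup>2 + 2 * (- c / b) * c"
    using \<open>a \<le> b\<close> by (intro add_right_mono mult_right_mono) auto
  also have "\<dots> = - (c\<^sup>2 / b)" using \<open>b > 0\<close> by (simp add: field_simps power2_eq_square)
  also have "\<dots> < 0" using \<open>b > 0\<close> \<open>c \<noteq> 0\<close> by simp
  finally show False by simp
qed

text \<open>A maximiser of the Rayleigh quotient on the unit sphere of \<open>S\<close> is an
  eigenvector: its residual \<open>u\<close> lies in \<open>S\<close> by invariance, so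
  \<open>v + s u\<close> may be tested for every \<open>s\<close>, and the first order term of that
  test is the squared norm of \<open>u\<close>.\<close>

lemma symmetric_eigenvector_in_subspace:
  fixes A :: "real^'n^'n"
  assumes A: "A \<in> Sym" and S: "subspace S" "S \<noteq> {0}" and inv: "\<And>x. x \<in> S \<Longrightarrow> A *v x \<in> S"
  obtains v l where "v \<in> S" "norm v = 1" "A *v v = l *\<^sub>R v"
proof -
  let ?K = "S \<inter> sphere 0 1"
  obtain w where w: "w \<in> S" "w \<noteq> 0" using S subspace_0 by blast
  then have "w /\<^sub>R norm w \<in> ?K" using S by (simp add: subspace_scale)
  then have "?K \<noteq> {}" by blast
  moreover have "compact ?K"
    by (intro closed_Int_compact closed_subspace S compact_sphere)
  moreover have "continuous_on ?K (\<lambda>x. x \<bullet> (A *v x))"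
    by (intro continuous_intros linear_continuous_on) (simp add: linear_linear)
  ultimately obtain v where v: "v \<in> ?K" and max: "\<And>x. x \<in> ?K \<Longrightarrow> x \<bullet> (A *v x) \<le> v \<bullet> (A *v v)"
    using continuous_attains_sup[of ?K "\<lambda>x. x \<bullet> (A *v x)"] by blast
  define l where "l = v \<bullet> (A *v v)"
  have vS: "v \<in> S" and vv: "v \<bullet> v = 1" using v by (auto simp: norm_eq_1)
  have le: "x \<bullet> (A *v x) \<le> l * (x \<bullet> x)" if "x \<in> S" for x
  proof (cases "x = 0")
    case False
    have "x /\<^sub>R norm x \<in> ?K" using S that False by (simp add: subspace_scale)
    from max[OF this] have "(x \<bullet> (A *v x)) / (norm x)\<^sup>2 \<le> l"
      by (simp add: l_def matrix_vector_mult_scaleR divide_inverse power2_eq_square algebra_simps)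
    then show ?thesis using False by (simp add: divide_le_eq power2_norm_eq_inner)
  qed simp
  define u where "u = l *\<^sub>R v - A *v v"
  have uS: "u \<in> S" unfolding u_def using S inv vS by (intro subspace_diff subspace_scale) auto
  have "u \<bullet> u = 0"
  proof (rule quadratic_nonneg_imp_linear_zero)
    fix s :: real
    have "v + s *\<^sub>R u \<in> S" using S vS uS by (intro subspace_add subspace_scale) auto
    from le[OF this] have "0 \<le> l * ((v + s *\<^sub>R u) \<bullet> (v + s *\<^sub>R u)) - (v + s *\<^sub>R u) \<bullet> (A *v (v + s *\<^sub>R u))"
      by simp
    also have "(v + s *\<^sub>R u) \<bullet> (A *v (v + s *\<^sub>R u)) = l + 2 * s * ((A *v v) \<bullet> u) + s\<^sup>2 * (u \<bullet> (A *v u))"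
      using Sym_inner[OF A, of v u] by (simp add: l_def algebra_simps inner_add_left inner_add_right
          power2_eq_square inner_commute[of u "A *v v"])
    also have "(v + s *\<^sub>R u) \<bullet> (v + s *\<^sub>R u) = 1 + 2 * s * (v \<bullet> u) + s\<^sup>2 * (u \<bullet> u)"
      using vv by (simp add: algebra_simps inner_add_left inner_add_right power2_eq_square inner_commute[of u v])
    also have "l * (1 + 2 * s * (v \<bullet> u) + s\<^sup>2 * (u \<bullet> u)) - (l + 2 * s * ((A *v v) \<bullet> u) + s\<^sup>2 * (u \<bullet> (A *v u)))
       = (l * (u \<bullet> u) - u \<bullet> (A *v u)) * s\<^sup>2 + 2 * s * (l * (v \<bullet> u) - (A *v v) \<bullet> u)"
      by (simp add: algebra_simps)
    also have "l * (v \<bullet> u) - (A *v v) \<bullet> u = u \<bullet> u"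
      by (simp add: u_def inner_diff_left)
    finally show "0 \<le> (l * (u \<bullet> u) - u \<bullet> (A *v u)) * s\<^sup>2 + 2 * s * (u \<bullet> u)" .
  qed
  then have "A *v v = l *\<^sub>R v" by (simp add: u_def)
  with vS vv show ?thesis by (intro that) (auto simp: norm_eq_1)
qed

text \<open>An orthonormal set of eigenvectors of maximal cardinality is a basis: otherwise its
  orthogonal complement is nonzero, is invariant because \<open>A\<close> is symmetric, and supplies
  one more eigenvector.\<close>

lemma symmetric_orthonormal_eigenvectors:
  fixes A :: "real^'n^'n"
  assumes A: "A \<in> Sym"
  obtains v :: "'n \<Rightarrow> real^'n" and l where
    "\<And>i j. v i \<bullet> v j = (if i = j then 1 else 0)" "\<And>i. A *v v i = l i *\<^sub>R v i"
proof -
  define good where "good B \<longleftrightarrow> pairwise orthogonal B \<and> (\<forall>v\<in>B. norm v = 1 \<and> (\<exists>l. A *v v = l *\<^sub>R v))"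
    for B :: "(real^'n) set"
  have indep: "independent B" if "good B" for B
    using that by (intro pairwise_orthogonal_independent) (auto simp: good_def)
  have bound: "card B \<le> CARD('n)" if "good B" for B
    using independent_bound[OF indep[OF that]] by simp
  have "good {}" by (simp add: good_def)
  then obtain B where B: "good B" and Bmax: "\<And>C. good C \<Longrightarrow> card C \<le> card B"
    using ex_has_greatest_nat[of good "{}" card "Suc CARD('n)"] bound by (auto simp: less_Suc_eq_le)
  have finB: "finite B" using independent_bound[OF indep[OF B]] by simp
  have "card B = CARD('n)"
  proof (rule ccontr)
    assume ne: "card B \<noteq> CARD('n)"
    let ?S = "{y. \<forall>x\<in>B. orthogonal x y}"
    have nz: "?S \<noteq> {0}"
    proof
      assume S0: "?S = {0}"
      have "dim B < DIM(real^'n)"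
        using ne bound[OF B] by (simp add: dim_eq_card_independent[OF indep[OF B]])
      then obtain y where "y \<noteq> 0" "\<And>x. x \<in> span B \<Longrightarrow> orthogonal y x"
        using orthogonal_to_subspace_exists by blast
      then have "y \<in> ?S" by (auto simp: span_base orthogonal_commute)
      with S0 \<open>y \<noteq> 0\<close> show False by auto
    qed
    have inv: "A *v y \<in> ?S" if "y \<in> ?S" for y
      using that B by (force simp: orthogonal_def Sym_inner[OF A] good_def)
    obtain v l where v: "v \<in> ?S" "norm v = 1" "A *v v = l *\<^sub>R v"
      by (rule symmetric_eigenvector_in_subspace[OF A subspace_orthogonal_to_vectors nz inv])
    have "v \<notin> B" using v by (auto simp: orthogonal_def norm_eq_1)
    moreover have "good (insert v B)"
      using B v by (auto simp: good_def pairwise_insert orthogonal_commute)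
    ultimately show False using Bmax[of "insert v B"] finB by simp
  qed
  then obtain v where v: "bij_betw v (UNIV::'n set) B"
    using finite_same_card_bij[OF finite_class.finite_UNIV finB] by metis
  have "\<forall>i. \<exists>l. A *v v i = l *\<^sub>R v i" using B v by (auto simp: good_def bij_betw_def)
  then obtain l where "\<And>i. A *v v i = l i *\<^sub>R v i" by metis
  moreover have "v i \<bullet> v j = (if i = j then 1 else 0)" for i j
    using B v by (auto simp: good_def bij_betw_def pairwise_def orthogonal_def norm_eq_1 inj_eq)
  ultimately show ?thesis by (intro that)
qed

subsection \<open>Spectral decomposition and projection onto the cone\<close>

text \<open>For orthogonal \<open>P\<close> this leads from eigencoordinates to the ambient basis,
  and \<open>conj_by (transpose P)\<close> leads back.\<close>

definition conj_by :: "real^'n^'n \<Rightarrow> real^'n^'n \<Rightarrow> real^'n^'n" where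
  "conj_by P M = P ** M ** transpose P"

definition diag_mat :: "('n \<Rightarrow> real) \<Rightarrow> real^'n^'n" where
  "diag_mat l = (\<chi> i j. if i = j then l i else 0)"

lemma bounded_linear_conj_by: "bounded_linear (conj_by P)"
  unfolding conj_by_def
  by (intro bounded_bilinear.bounded_linear_left[OF bounded_bilinear_matrix_mult, THEN bounded_linear_compose]
      bounded_bilinear.bounded_linear_right[OF bounded_bilinear_matrix_mult])

lemmas conj_by_add = linear_add[OF bounded_linear.linear[OF bounded_linear_conj_by]]
  and conj_by_diff = linear_diff[OF bounded_linear.linear[OF bounded_linear_conj_by]]
  and conj_by_zero [simp] = linear_0[OF bounded_linear.linear[OF bounded_linear_conj_by]]
  and conj_by_scaleR = linear_cmul[OF bounded_linear.linear[OF bounded_linear_conj_by]]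

lemma transpose_conj_by: "transpose (conj_by P M) = conj_by P (transpose M)"
  by (simp add: conj_by_def matrix_transpose_mul matrix_mul_assoc)

lemma
  assumes "orthogonal_matrix (P::real^'n^'n)"
  shows conj_by_mult: "conj_by P A ** conj_by P B = conj_by P (A ** B)"
    and conj_by_inverse: "conj_by (transpose P) (conj_by P A) = A"
    and conj_by_inverse': "conj_by P (conj_by (transpose P) A) = A"
proof -
  have 1: "transpose P ** P = mat 1" "P ** transpose P = mat 1"
    using assms by (auto simp: orthogonal_matrix_def)
  have *: "A ** transpose P ** P = A" "A ** P ** transpose P = A" for A :: "real^'n^'n"
    by (simp_all add: 1 flip: matrix_mul_assoc)
  show "conj_by P A ** conj_by P B = conj_by P (A ** B)"
    "conj_by (transpose P) (conj_by P A) = A" "conj_by P (conj_by (transpose P) A) = A"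
    by (simp_all add: conj_by_def matrix_mul_assoc * 1)
qed

lemma inner_conj_by_swap: "conj_by P A \<bullet> B = A \<bullet> conj_by (transpose P) B"
  by (simp add: conj_by_def inner_mult_right[of "P ** A"] inner_mult_left[of P A] matrix_mul_assoc)

lemma inner_conj_by:
  assumes "orthogonal_matrix (P::real^'n^'n)"
  shows "conj_by P A \<bullet> conj_by P B = A \<bullet> B"
  by (simp add: inner_conj_by_swap conj_by_inverse[OF assms])

lemma norm_conj_by:
  assumes "orthogonal_matrix (P::real^'n^'n)"
  shows "norm (conj_by P A) = norm A"
  by (simp add: norm_eq_sqrt_inner inner_conj_by[OF assms])

lemma conj_by_psd: "A \<in> psd \<Longrightarrow> conj_by P A \<in> psd"
  and conj_by_nsd: "A \<in> nsd \<Longrightarrow> conj_by P A \<in> nsd"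
  and conj_by_Sym: "A \<in> Sym \<Longrightarrow> conj_by P A \<in> Sym"
  using transpose_conj_by[of P A] by (auto simp: conj_by_def psd_congruence nsd_congruence Sym_def)

lemma diag_mat_nth: "diag_mat l $ i $ j = (if i = j then l i else 0)"
  by (simp add: diag_mat_def)

lemma mult_diag_mat_nth [simp]: "(A ** diag_mat l) $ i $ j = A$i$j * l j"
  by (simp add: matrix_matrix_mult_def diag_mat_nth if_distrib[of "\<lambda>x. _ * x"] cong: if_cong)

lemma diag_mat_mult_nth [simp]: "(diag_mat l ** A) $ i $ j = l i * A$i$j"
  by (simp add: matrix_matrix_mult_def diag_mat_nth if_distrib[of "\<lambda>x. x * _"] cong: if_cong)

lemma inner_diag_mat: "diag_mat l \<bullet> A = (\<Sum>i\<in>UNIV. l i * A$i$i)"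
  by (simp add: inner_matrix_eq diag_mat_nth if_distrib[of "\<lambda>x. x * _"] cong: if_cong)

lemma transpose_diag_mat [simp]: "transpose (diag_mat l) = diag_mat l"
  by (simp add: transpose_def vec_eq_iff diag_mat_nth)

lemma diag_mat_add: "diag_mat l + diag_mat m = diag_mat (\<lambda>i. l i + m i)"
  by (simp add: vec_eq_iff diag_mat_nth)

lemma diag_mat_mult_vector_nth [simp]: "(diag_mat l *v v) $ i = l i * v$i"
  by (simp add: matrix_vector_mult_def diag_mat_nth if_distrib[of "\<lambda>x. x * _"] cong: if_cong)

lemma inner_diag_mat_mult: "v \<bullet> (diag_mat l *v v) = (\<Sum>i\<in>UNIV. l i * (v$i)\<^sup>2)"
  by (simp add: inner_vec_def power2_eq_square algebra_simps)

lemma diag_mat_psd: "(\<And>i. 0 \<le> l i) \<Longrightarrow> diag_mat l \<in> psd"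
  and diag_mat_nsd: "(\<And>i. l i \<le> 0) \<Longrightarrow> diag_mat l \<in> nsd"
  by (auto simp: psd_def nsd_def inner_diag_mat_mult intro!: sum_nonneg sum_nonpos mult_nonpos_nonneg)

lemma inner_axis_matrix: "axis i 1 \<bullet> ((M::real^'n^'n) *v axis j 1) = M$i$j"
  by (simp add: inner_axis' matrix_vector_mul_component inner_axis)

lemma psd_diag_nonneg: "M \<in> psd \<Longrightarrow> 0 \<le> M$i$i"
  and nsd_diag_nonpos: "M \<in> nsd \<Longrightarrow> M$i$i \<le> 0"
  using inner_axis_matrix[of i M i] by (auto simp: psd_def nsd_def) (metis)+

lemma Sym_nth: "M \<in> Sym \<Longrightarrow> M$i$j = M$j$i"
  by (auto simp: Sym_def transpose_def vec_eq_iff)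

theorem symmetric_spectral_decomposition:
  fixes A :: "real^'n^'n"
  assumes A: "A \<in> Sym"
  obtains P l where "orthogonal_matrix P" "A = conj_by P (diag_mat l)"
proof -
  obtain v :: "'n \<Rightarrow> real^'n" and l where
    v: "\<And>i j. v i \<bullet> v j = (if i = j then 1 else 0)" and l: "\<And>i. A *v v i = l i *\<^sub>R v i"
    using symmetric_orthonormal_eigenvectors[OF A] by blast
  define P where "P = (\<chi> i j. v j $ i)"
  have P: "transpose P ** P = mat 1"
    using v by (simp add: P_def vec_eq_iff matrix_matrix_mult_def transpose_def inner_vec_def mat_def)
  then have orth: "orthogonal_matrix P" by (simp add: orthogonal_matrix)
  have "(A ** P) $ i $ j = (A *v v j) $ i" for i j
    by (simp add: P_def matrix_matrix_mult_def matrix_vector_mult_def)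
  then have AP: "A ** P = P ** diag_mat l"
    by (simp add: vec_eq_iff l P_def)
  have "A = A ** P ** transpose P"
    using orth by (simp add: orthogonal_matrix_def flip: matrix_mul_assoc)
  also have "\<dots> = conj_by P (diag_mat l)" by (simp add: AP conj_by_def)
  finally show ?thesis using orth that by metis
qed

text \<open>In an eigenbasis of \<open>X\<close> the inner product sums nonnegative eigenvalues
  times the nonpositive diagonal of the transformed \<open>Y\<close>. This is the weak duality
  behind the lower bounds.\<close>

lemma inner_psd_nsd: 
  assumes "X \<in> psd" "Y \<in> nsd"
  shows "X \<bullet> Y \<le> 0"
proof -
  obtain P l where P: "orthogonal_matrix P" and X: "X = conj_by P (diag_mat l)"
    using symmetric_spectral_decomposition psd_subset_Sym[OF assms(1)] by metis
  have "diag_mat l = conj_by (transpose P) X" by (simp add: X conj_by_inverse[OF P])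
  then have "diag_mat l \<in> psd" using assms(1) by (simp add: conj_by_psd)
  then have "0 \<le> l i" for i using psd_diag_nonneg[of _ i] by (fastforce simp: diag_mat_nth)
  moreover have "conj_by (transpose P) Y $ i $ i \<le> 0" for i
    by (intro nsd_diag_nonpos conj_by_nsd assms)
  ultimately show ?thesis
    by (simp add: X inner_conj_by_swap inner_diag_mat sum_nonpos mult_nonneg_nonpos)
qed

lemma proj_nsd_in: "proj_nsd Z \<in> nsd"
  unfolding proj_nsd_def using closest_point_in_set[OF closed_nsd] zero_in_nsd by blast

text \<open>Moreau's criterion: \<open>X\<close> is normal to the cone at \<open>Y\<close>, as it
  pairs nonpositively with every element and to zero with \<open>Y\<close>. Later values of the
  projection are found by exhibiting such a splitting.\<close>

lemma proj_nsd_eqI: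
  fixes X Y :: "real^'n^'n"
  assumes "X \<in> psd" "Y \<in> nsd" "X \<bullet> Y = 0"
  shows "proj_nsd (X + Y) = Y"
  unfolding proj_nsd_def
proof (rule closest_point_unique[symmetric, OF convex_nsd closed_nsd assms(2)], intro ballI)
  fix V :: "real^'n^'n" assume V: "V \<in> nsd"
  have "(norm X)\<^sup>2 \<le> (norm X)\<^sup>2 + 2 * (X \<bullet> (Y - V)) + (norm (Y - V))\<^sup>2"
    using inner_psd_nsd[OF assms(1) V] assms(3) zero_le_power2[of "norm (Y - V)"]
    unfolding inner_diff_right by (simp only: right_diff_distrib)
  also have "\<dots> = (norm (X + (Y - V)))\<^sup>2"
    by (simp add: power2_norm_eq_inner inner_add_left inner_add_right inner_commute)
  finally have "norm X \<le> norm (X + (Y - V))" by (rule power2_le_imp_le) simp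
  then show "dist (X + Y) Y \<le> dist (X + Y) V" by (simp add: dist_norm algebra_simps)
qed

lemma nonneg_nonpos_split:
  "diag_mat (\<lambda>i. max (a i) 0) + diag_mat (\<lambda>i. min (a i) 0) = diag_mat a"
  "diag_mat (\<lambda>i. max (a i) 0) \<bullet> diag_mat (\<lambda>i. min (a i) 0) = 0"
  by (simp_all add: diag_mat_add inner_diag_mat diag_mat_nth)
    (auto simp: diag_mat_def vec_eq_iff intro!: sum.neutral split: split_max split_min)

lemma proj_nsd_conj_by_diag:
  assumes P: "orthogonal_matrix P"
  shows "proj_nsd (conj_by P (diag_mat a)) = conj_by P (diag_mat (\<lambda>i. min (a i) 0))"
  using proj_nsd_eqI[OF conj_by_psd[OF diag_mat_psd] conj_by_nsd[OF diag_mat_nsd],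
      of "\<lambda>i. max (a i) 0" "\<lambda>i. min (a i) 0" P P] nonneg_nonpos_split[of a]
  by (simp add: inner_conj_by[OF P] flip: conj_by_add)

lemma
  assumes "Z \<in> Sym"
  shows psd_diff_proj_nsd: "Z - proj_nsd Z \<in> psd"
    and diff_proj_nsd_orthogonal: "(Z - proj_nsd Z) \<bullet> proj_nsd Z = 0"
proof -
  obtain P a where P: "orthogonal_matrix P" and Z: "Z = conj_by P (diag_mat a)"
    using symmetric_spectral_decomposition assms by metis
  have "diag_mat a - diag_mat (\<lambda>i. min (a i) 0) = diag_mat (\<lambda>i. max (a i) 0)"
    using nonneg_nonpos_split(1)[of a] by (metis add_diff_cancel_right')
  then have "Z - proj_nsd Z = conj_by P (diag_mat (\<lambda>i. max (a i) 0))"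
    by (simp add: Z proj_nsd_conj_by_diag[OF P] flip: conj_by_diff)
  then show "Z - proj_nsd Z \<in> psd" "(Z - proj_nsd Z) \<bullet> proj_nsd Z = 0"
    using nonneg_nonpos_split(2)[of a]
    by (simp_all add: conj_by_psd diag_mat_psd Z proj_nsd_conj_by_diag[OF P] inner_conj_by[OF P])
qed

lemma proj_nsd_lipschitz: "norm (proj_nsd A - proj_nsd B) \<le> norm (A - B)"
  using closest_point_lipschitz[OF convex_nsd closed_nsd, of A B] zero_in_nsd
  unfolding proj_nsd_def dist_norm by blast

text \<open>One diagonalisation of \<open>X + Y\<close> suffices: \<open>Y\<close> is the projection
  of the sum, hence has the same eigenvectors with the negative parts of the eigenvalues, and
  \<open>X\<close> takes the positive parts.\<close>

lemma simultaneous_diagonalization: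
  fixes X Y :: "real^'n^'n"
  assumes "X \<in> psd" "Y \<in> nsd" "X \<bullet> Y = 0"
  obtains P l m where "orthogonal_matrix P" "X = conj_by P (diag_mat l)" "Y = conj_by P (diag_mat m)"
    "\<And>i. 0 \<le> l i" "\<And>i. m i \<le> 0" "\<And>i. l i * m i = 0"
proof -
  have "X + Y \<in> Sym" using assms by (simp add: psd_subset_Sym nsd_subset_Sym subspace_add subspace_Sym)
  then obtain P a where P: "orthogonal_matrix P" and XY: "X + Y = conj_by P (diag_mat a)"
    using symmetric_spectral_decomposition by metis
  have Y: "Y = conj_by P (diag_mat (\<lambda>i. min (a i) 0))"
    using proj_nsd_eqI[OF assms] by (simp add: XY proj_nsd_conj_by_diag[OF P])
  moreover have "X = conj_by P (diag_mat (\<lambda>i. max (a i) 0))"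
    using XY Y nonneg_nonpos_split(1)[of a, symmetric] by (simp add: conj_by_add)
  ultimately show ?thesis using P by (intro that) (auto split: split_max split_min)
qed

lemma psd_nsd_orthogonal_mult_zero:
  assumes "X \<in> psd" "Y \<in> nsd" "X \<bullet> Y = 0"
  shows "X ** Y = 0" "Y ** X = 0"
proof -
  obtain P l m where P: "orthogonal_matrix P" "X = conj_by P (diag_mat l)" "Y = conj_by P (diag_mat m)"
    and 0: "\<And>i. l i * m i = 0"
    using simultaneous_diagonalization[OF assms] by metis
  have "diag_mat l ** diag_mat m = 0" "diag_mat m ** diag_mat l = 0"
    using 0 by (auto simp: vec_eq_iff diag_mat_nth)
  then show "X ** Y = 0" "Y ** X = 0" by (simp_all add: P conj_by_mult[OF P(1)])
qed

section \<open>The pseudo-inverse and the sigma-term in eigencoordinates\<close>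

lemma Moore_Penrose_unique:
  fixes M :: "real^'n^'n"
  assumes X: "M ** X ** M = M" "X ** M ** X = X" "transpose (M ** X) = M ** X" "transpose (X ** M) = X ** M"
    and Y: "M ** Y ** M = M" "Y ** M ** Y = Y" "transpose (M ** Y) = M ** Y" "transpose (Y ** M) = Y ** M"
  shows "X = Y"
proof -
  have "M ** X = (M ** Y) ** (M ** X)" by (simp add: matrix_mul_assoc Y(1))
  also have "\<dots> = transpose ((M ** X) ** (M ** Y))"
    using X(3) Y(3) by (metis matrix_transpose_mul)
  also have "\<dots> = M ** Y" by (simp add: matrix_mul_assoc X(1) Y(3))
  finally have 1: "M ** X = M ** Y" .
  have "X ** M = (X ** M) ** (Y ** M)" using Y(1) by (metis matrix_mul_assoc)
  also have "\<dots> = transpose ((Y ** M) ** (X ** M))"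
    using X(4) Y(4) by (metis matrix_transpose_mul)
  also have "\<dots> = Y ** M" using X(1) Y(4) by (metis matrix_mul_assoc)
  finally have 2: "X ** M = Y ** M" .
  show ?thesis using 1 2 X(2) Y(2) by (metis matrix_mul_assoc)
qed

text \<open>Since \<open>1 / 0 = 0\<close>, the reciprocal spectrum is that of the pseudo-inverse at
  zero eigenvalues too; the Penrose equations hold entrywise and determine it.\<close>

lemma pinv_conj_by_diag:
  assumes P: "orthogonal_matrix P"
  shows "pinv (conj_by P (diag_mat l)) = conj_by P (diag_mat (\<lambda>i. 1 / l i))"
proof -
  let ?M = "conj_by P (diag_mat l)" and ?X = "conj_by P (diag_mat (\<lambda>i. 1 / l i))"
  have *: "?M ** ?X ** ?M = ?M" "?X ** ?M ** ?X = ?X"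
    "transpose (?M ** ?X) = ?M ** ?X" "transpose (?X ** ?M) = ?X ** ?M"
    by (auto simp: conj_by_mult[OF P] transpose_conj_by matrix_transpose_mul intro!: arg_cong[of _ _ "conj_by P"])
      (auto simp: vec_eq_iff diag_mat_nth)
  then show ?thesis
    unfolding pinv_def by (intro the_equality conjI) (auto intro: Moore_Penrose_unique)
qed

text \<open>The convention \<open>x / 0 = 0\<close> drops the indices in the kernel of the first argument.\<close>
lemma Upsilon_conj_by_diag:
  assumes P: "orthogonal_matrix P" and H: "H \<in> Sym"
  defines "h \<equiv> conj_by (transpose P) H"
  shows "Upsilon (conj_by P (diag_mat l)) (conj_by P (diag_mat m)) H
     = 2 * (\<Sum>i\<in>UNIV. \<Sum>j\<in>UNIV. m j * (h$i$j)\<^sup>2 / l i)"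
proof -
  have h: "h \<in> Sym" by (simp add: h_def conj_by_Sym H)
  have Hh: "H = conj_by P h" by (simp add: h_def conj_by_inverse'[OF P])
  have "(h ** diag_mat (\<lambda>i. 1 / l i) ** h) $ j $ j = (\<Sum>i\<in>UNIV. (h$i$j)\<^sup>2 / l i)" for j
    using Sym_nth[OF h, of j] by (simp add: matrix_matrix_mult_def[of _ h] power2_eq_square)
  then have "diag_mat m \<bullet> (h ** diag_mat (\<lambda>i. 1 / l i) ** h) = (\<Sum>j\<in>UNIV. \<Sum>i\<in>UNIV. m j * (h$i$j)\<^sup>2 / l i)"
    by (simp add: inner_diag_mat sum_distrib_left)
  also have "\<dots> = (\<Sum>i\<in>UNIV. \<Sum>j\<in>UNIV. m j * (h$i$j)\<^sup>2 / l i)" by (rule sum.swap)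
  finally show ?thesis
    unfolding Upsilon_def pinv_conj_by_diag[OF P] Hh conj_by_mult[OF P] inner_conj_by[OF P]
    by simp
qed

subsection \<open>The uniform second order lower bound\<close>

text \<open>Weak duality: every \<open>V \<in> nsd\<close> gives the bound
  \<open>- Y' \<bullet> X'' \<ge> (V - Y') \<bullet> X''\<close>; it is used with the congruence \<open>V = (I + S) Y' (I + S)\<^sup>T\<close>.\<close>
lemma complementarity_congruence_bound:
  fixes X' X'' Y' S H :: "real^'n^'n"
  assumes r: "0 < r" and X': "X' \<in> psd" and Y': "Y' \<in> nsd" and XY: "X' \<bullet> Y' = 0"
    and X'': "X'' \<in> psd" and H: "H \<in> Sym"
  shows "(S ** Y' ** transpose S) \<bullet> (X' + H) + 2 * ((S ** Y') \<bullet> H)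
           - (norm (S ** Y' + Y' ** transpose S + S ** Y' ** transpose S))\<^sup>2 / (2 * r)
         \<le> - (Y' \<bullet> X'') + r / 2 * (norm (X'' - X' - H))\<^sup>2"
proof -
  let ?V = "(mat 1 + S) ** Y' ** transpose (mat 1 + S)"
  define K where "K = S ** Y' + Y' ** transpose S + S ** Y' ** transpose S"
  define E where "E = X'' - X' - H"
  have V: "?V = Y' + K"
    by (simp add: K_def matrix_add_ldistrib matrix_add_rdistrib transpose_add algebra_simps)
  have "?V \<in> nsd" by (rule nsd_congruence[OF Y'])
  then have "X'' \<bullet> ?V \<le> 0" using inner_psd_nsd X'' by blast
  then have 1: "K \<bullet> X'' \<le> - (Y' \<bullet> X'')" by (simp add: V inner_add_right inner_commute[of X''])
  have YX: "Y' ** X' = 0" "X' ** Y' = 0" using psd_nsd_orthogonal_mult_zero[OF X' Y' XY] by auto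
  have Yt: "transpose Y' = Y'" and Ht: "transpose H = H" using Y' H by (auto simp: nsd_def Sym_def)
  \<comment> \<open>In the two parts of \<open>K\<close> linear in \<open>S\<close>, the factor
    \<open>Y'\<close> meets \<open>X'\<close> and the product vanishes.\<close>
  have KX: "K \<bullet> X' = (S ** Y' ** transpose S) \<bullet> X'"
    unfolding K_def inner_add_left inner_mult_right[of S Y'] inner_mult_left[of Y' "transpose S"]
    by (simp add: Yt YX)
  have "(Y' ** transpose S) \<bullet> H = transpose (Y' ** transpose S) \<bullet> transpose H"
    by (simp only: inner_transpose)
  also have "\<dots> = (S ** Y') \<bullet> H" by (simp add: matrix_transpose_mul Yt Ht del: inner_transpose)
  finally have KH: "K \<bullet> H = 2 * ((S ** Y') \<bullet> H) + (S ** Y' ** transpose S) \<bullet> H"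
    by (simp add: K_def inner_add_left)
  \<comment> \<open>Completing the square: the penalty \<open>r / 2\<close> pays for the unknown
    defect \<open>E\<close> at the price of the term with \<open>1 / (2 * r)\<close>.\<close>
  have "0 \<le> (norm (r *\<^sub>R E + K))\<^sup>2 / (2 * r)" using r by simp
  also have "\<dots> = r / 2 * (norm E)\<^sup>2 + K \<bullet> E + (norm K)\<^sup>2 / (2 * r)"
    unfolding power2_norm_eq_inner using r
    by (simp add: inner_add_left inner_add_right inner_commute[of E K] field_simps)
  finally have 2: "- (K \<bullet> E) \<le> r / 2 * (norm E)\<^sup>2 + (norm K)\<^sup>2 / (2 * r)" by simp
  have X''_eq: "X'' = X' + H + E" by (simp add: E_def)
  have "K \<bullet> X'' = K \<bullet> X' + K \<bullet> H + K \<bullet> E" by (subst X''_eq) (simp add: inner_add_right)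
  with 1 2 show ?thesis
    unfolding K_def[symmetric] E_def[symmetric] KX KH by (simp add: inner_add_right)
qed

text \<open>Homogeneity of degree two. The switch \<open>c\<close> is 1 for the actual bound and 0
  for its leading part, in which the quadratic part of \<open>K\<close> is dropped; after scaling it
  appears as \<open>c * s\<close>, which tends to 0 with \<open>s\<close>.\<close>

lemma congruence_bound_scale:
  fixes T Y Z u :: "real^'n^'n"
  shows "((s *\<^sub>R T) ** Y ** transpose (s *\<^sub>R T)) \<bullet> Z + 2 * (((s *\<^sub>R T) ** Y) \<bullet> (s *\<^sub>R u))
      - (norm ((s *\<^sub>R T) ** Y + Y ** transpose (s *\<^sub>R T) + c *\<^sub>R ((s *\<^sub>R T) ** Y ** transpose (s *\<^sub>R T))))\<^sup>2 / (2 * r)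
    = s\<^sup>2 * ((T ** Y ** transpose T) \<bullet> Z + 2 * ((T ** Y) \<bullet> u)
      - (norm (T ** Y + Y ** transpose T + (c * s) *\<^sub>R (T ** Y ** transpose T)))\<^sup>2 / (2 * r))"
proof -
  have "(s *\<^sub>R T) ** Y + Y ** transpose (s *\<^sub>R T) + c *\<^sub>R ((s *\<^sub>R T) ** Y ** transpose (s *\<^sub>R T))
    = s *\<^sub>R (T ** Y + Y ** transpose T + (c * s) *\<^sub>R (T ** Y ** transpose T))"
    by (simp add: transpose_scalar matrix_scaleR_left matrix_scaleR_right algebra_simps)
  then have "(norm ((s *\<^sub>R T) ** Y + Y ** transpose (s *\<^sub>R T) + c *\<^sub>R ((s *\<^sub>R T) ** Y ** transpose (s *\<^sub>R T))))\<^sup>2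
    = s\<^sup>2 * (norm (T ** Y + Y ** transpose T + (c * s) *\<^sub>R (T ** Y ** transpose T)))\<^sup>2"
    by (simp only: norm_scaleR power_mult_distrib power2_abs)
  then show ?thesis
    by (simp add: transpose_scalar matrix_scaleR_left matrix_scaleR_right)
      (simp add: power2_eq_square algebra_simps)
qed

lemma dist_Pair_le: "dist (a, b) (c, d) \<le> dist a c + dist b d"
  by (simp add: dist_Pair_Pair sqrt_sum_squares_le_sum)

text \<open>Writing \<open>H = s u\<close> with a unit matrix \<open>u\<close> and dividing by
  \<open>s^2\<close> turns the bound into a function of \<open>(X', Y', s, u)\<close> that is
  continuous up to \<open>s = 0\<close>. On a compact set it is uniformly continuous, and the
  leading part at the reference pair is its value at \<open>(X, Y, 0, u)\<close>.\<close>

lemma complementarity_congruence_bound_uniform: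
  fixes X Y :: "real^'n^'n" and S :: "real^'n^'n \<Rightarrow> real^'n^'n"
  assumes S: "bounded_linear S" and r: "0 < r" and e: "0 < e"
  shows "\<exists>\<delta>>0. \<forall>X'\<in>psd. \<forall>Y'\<in>nsd. \<forall>X''\<in>psd. \<forall>H\<in>Sym. X' \<bullet> Y' = 0 \<longrightarrow>
      norm (X' - X) < \<delta> \<longrightarrow> norm (Y' - Y) < \<delta> \<longrightarrow> norm H < \<delta> \<longrightarrow>
      (S H ** Y ** transpose (S H)) \<bullet> X + 2 * ((S H ** Y) \<bullet> H)
         - (norm (S H ** Y + Y ** transpose (S H)))\<^sup>2 / (2 * r) - e * (norm H)\<^sup>2
      \<le> - (Y' \<bullet> X'') + r / 2 * (norm (X'' - X' - H))\<^sup>2"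
proof -
  define F where "F = (\<lambda>(X', Y', s, u). (S u ** Y' ** transpose (S u)) \<bullet> (X' + s *\<^sub>R u) + 2 * ((S u ** Y') \<bullet> u)
     - (norm (S u ** Y' + Y' ** transpose (S u) + s *\<^sub>R (S u ** Y' ** transpose (S u))))\<^sup>2 / (2 * r))"
  let ?C = "cball X 1 \<times> cball Y 1 \<times> cball (0::real) 1 \<times> sphere (0::real^'n^'n) 1"
  have "continuous_on ?C F"
    unfolding F_def case_prod_beta
    using r by (intro continuous_intros bounded_linear.continuous_on[OF S]) auto
  moreover have "compact ?C" by (intro compact_Times compact_cball compact_sphere)
  ultimately have "uniformly_continuous_on ?C F" by (rule compact_uniformly_continuous)
  then obtain d where d: "d > 0" and dF: "\<And>z z'. z \<in> ?C \<Longrightarrow> z' \<in> ?C \<Longrightarrow> dist z' z < d \<Longrightarrow> dist (F z') (F z) < e"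
    unfolding uniformly_continuous_on_def using e by metis
  \<comment> \<open>Three coordinates move, each by less than \<open>\<delta>\<close>, hence a total
    below \<open>3 * \<delta> < d\<close>; the cap 1 keeps the point in the compact set.\<close>
  define \<delta> where "\<delta> = min 1 (d / 4)"
  have \<delta>: "0 < \<delta>" "\<delta> \<le> 1" "3 * \<delta> < d" using d by (auto simp: \<delta>_def)
  show ?thesis
  proof (intro exI[of _ \<delta>] conjI ballI impI \<delta>)
    fix X' Y' X'' H :: "real^'n^'n"
    assume A: "X' \<in> psd" "Y' \<in> nsd" "X'' \<in> psd" "H \<in> Sym" "X' \<bullet> Y' = 0"
      and B: "norm (X' - X) < \<delta>" "norm (Y' - Y) < \<delta>" "norm H < \<delta>"
    let ?R = "- (Y' \<bullet> X'') + r / 2 * (norm (X'' - X' - H))\<^sup>2"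
    show "(S H ** Y ** transpose (S H)) \<bullet> X + 2 * ((S H ** Y) \<bullet> H)
         - (norm (S H ** Y + Y ** transpose (S H)))\<^sup>2 / (2 * r) - e * (norm H)\<^sup>2 \<le> ?R"
    proof (cases "H = 0")
      case True
      moreover have "0 \<le> ?R"
        using inner_psd_nsd[OF A(3,2)] r by (intro add_nonneg_nonneg) (auto simp: inner_commute)
      ultimately show ?thesis by (simp add: linear_0[OF bounded_linear.linear[OF S]])
    next
      case False
      define s u where "s = norm H" and "u = H /\<^sub>R s"
      have s: "s > 0" and H: "H = s *\<^sub>R u" and u: "norm u = 1"
        using False by (auto simp: s_def u_def)
      have SH: "S H = s *\<^sub>R S u" by (simp add: H linear_cmul[OF bounded_linear.linear[OF S]])
      have "dist (X', Y', s, u) (X, Y, 0, u) \<le> dist X' X + dist (Y', s, u) (Y, 0, u)"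
        by (rule dist_Pair_le)
      also have "dist (Y', s, u) (Y, 0, u) \<le> dist Y' Y + dist (s, u) (0, u)"
        by (rule dist_Pair_le)
      also have "dist (s, u) (0, u) = s" using s by (simp add: dist_prod_def)
      finally have "dist (X', Y', s, u) (X, Y, 0, u) < d"
        using B \<delta> by (simp add: dist_norm s_def)
      moreover have "(X', Y', s, u) \<in> ?C" "(X, Y, 0, u) \<in> ?C"
        using B \<delta> u s by (auto simp: dist_norm norm_minus_commute s_def)
      ultimately have "dist (F (X', Y', s, u)) (F (X, Y, 0, u)) < e"
        by (intro dF)
      then have "F (X, Y, 0, u) - e \<le> F (X', Y', s, u)"
        by (simp add: dist_real_def)
      then have "s\<^sup>2 * F (X, Y, 0, u) - e * s\<^sup>2 \<le> s\<^sup>2 * F (X', Y', s, u)"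
        using mult_left_mono[of _ _ "s\<^sup>2"] by (fastforce simp: algebra_simps)
      also have "s\<^sup>2 * F (X', Y', s, u) =
          (S H ** Y' ** transpose (S H)) \<bullet> (X' + H) + 2 * ((S H ** Y') \<bullet> H)
           - (norm (S H ** Y' + Y' ** transpose (S H) + S H ** Y' ** transpose (S H)))\<^sup>2 / (2 * r)"
        using congruence_bound_scale[of s "S u" Y' "X' + H" u 1 r]
        by (simp add: F_def SH flip: H)
      also have "\<dots> \<le> ?R" using complementarity_congruence_bound[OF r A(1,2,5,3,4)] .
      also have "s\<^sup>2 * F (X, Y, 0, u) = (S H ** Y ** transpose (S H)) \<bullet> X + 2 * ((S H ** Y) \<bullet> H)
         - (norm (S H ** Y + Y ** transpose (S H)))\<^sup>2 / (2 * r)"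
        using congruence_bound_scale[of s "S u" Y X u 0 r]
        by (simp add: F_def SH flip: H)
      finally show ?thesis by (simp add: s_def)
    qed
  qed
qed

text \<open>Positions \<open>(i, j)\<close> and \<open>(j, i)\<close> must be compared jointly: an
  entry of \<open>S\<close> in a mixed block sits at one of them, while its price in the squared
  norm is charged at both.\<close>

lemma sum_sym_mono:
  fixes t b :: "'n::finite \<Rightarrow> 'n \<Rightarrow> real"
  assumes "\<And>i j. t i j + t j i \<le> b i j + b j i"
  shows "(\<Sum>i\<in>UNIV. \<Sum>j\<in>UNIV. t i j) \<le> (\<Sum>i\<in>UNIV. \<Sum>j\<in>UNIV. b i j)"
proof -
  have *: "(\<Sum>i\<in>UNIV. \<Sum>j\<in>UNIV. g i j + g j i) = 2 * (\<Sum>i\<in>UNIV. \<Sum>j\<in>UNIV. g i j)"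
    for g :: "'n \<Rightarrow> 'n \<Rightarrow> real"
    using sum.swap[of "\<lambda>i j. g j i" UNIV UNIV] by (simp add: sum.distrib)
  have "(\<Sum>i\<in>UNIV. \<Sum>j\<in>UNIV. t i j + t j i) \<le> (\<Sum>i\<in>UNIV. \<Sum>j\<in>UNIV. b i j + b j i)"
    by (intro sum_mono assms)
  then show ?thesis using *[of t] *[of b] by simp
qed

lemma sum_sym_eq:
  fixes t b :: "'n::finite \<Rightarrow> 'n \<Rightarrow> real"
  assumes "\<And>i j. t i j + t j i = b i j + b j i"
  shows "(\<Sum>i\<in>UNIV. \<Sum>j\<in>UNIV. t i j) = (\<Sum>i\<in>UNIV. \<Sum>j\<in>UNIV. b i j)"
  using assms by (intro antisym sum_sym_mono) simp_all

locale complementary_pair =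
  fixes P :: "real^'n^'n" and l m :: "'n \<Rightarrow> real"
  assumes P: "orthogonal_matrix P"
    and l: "\<And>i. 0 \<le> l i" and m: "\<And>i. m i \<le> 0" and lm: "\<And>i. l i * m i = 0"
begin

definition "X = conj_by P (diag_mat l)"
definition "Y = conj_by P (diag_mat m)"
abbreviation "co \<equiv> conj_by (transpose P)"

text \<open>With \<open>\<alpha>\<close>, \<open>\<beta>\<close>, \<open>\<gamma>\<close> the index sets of the paper (\<open>l i > 0\<close>; \<open>l i = m i = 0\<close>; \<open>m i < 0\<close>), \<open>pen H\<close> is
  the squared norm of the blocks \<open>P\<^sub>\<beta>\<^sup>T H P\<^sub>\<gamma>\<close> and \<open>P\<^sub>\<gamma>\<^sup>T H P\<^sub>\<gamma>\<close>, which cut out the affine hull of the critical cone.\<close>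
definition pen :: "real^'n^'n \<Rightarrow> real" where
  "pen H = (\<Sum>i\<in>UNIV. \<Sum>j\<in>UNIV. if l i = 0 \<and> m j < 0 then (co H $ i $ j)\<^sup>2 else 0)"

text \<open>Collects the price of the entries \<open>- h / l\<close> of \<open>S\<close> between
  positive and negative eigenvalues; terms with \<open>l i = 0\<close> vanish by division by
  zero.\<close>

definition rbound :: real where "rbound = (\<Sum>i\<in>UNIV. \<Sum>j\<in>UNIV. (m j / l i)\<^sup>2)"

text \<open>The block between zero and negative eigenvalues would allow the factor \<open>r\<close>;
  the block of negative eigenvalues allows only \<open>r / 2\<close>, which is taken for
  both.\<close>

definition lower :: "real \<Rightarrow> real^'n^'n \<Rightarrow> real" where
  "lower r H = - Upsilon X Y H / 2 + r / 2 * pen H - rbound / r * (norm H)\<^sup>2"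

lemma X_psd: "X \<in> psd" and Y_nsd: "Y \<in> nsd" and XY: "X \<bullet> Y = 0"
  using l m lm
  by (auto simp: X_def Y_def conj_by_psd diag_mat_psd conj_by_nsd diag_mat_nsd inner_conj_by[OF P]
      inner_diag_mat diag_mat_nth intro!: sum.neutral)

lemma Upsilon_XY: "H \<in> Sym \<Longrightarrow>
    Upsilon X Y H = 2 * (\<Sum>i\<in>UNIV. \<Sum>j\<in>UNIV. m j * (co H $ i $ j)\<^sup>2 / l i)"
  unfolding X_def Y_def by (rule Upsilon_conj_by_diag[OF P])

lemma pen_nonneg: "0 \<le> pen H"
  unfolding pen_def by (intro sum_nonneg) auto

lemma rbound_nonneg: "0 \<le> rbound"
  unfolding rbound_def by (intro sum_nonneg) auto

lemma pen_eq_0_iff: "pen H = 0 \<longleftrightarrow> (\<forall>i j. l i = 0 \<and> m j < 0 \<longrightarrow> co H $ i $ j = 0)"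
  unfolding pen_def by (subst sum_nonneg_eq_0_iff; force simp: sum_nonneg sum_nonneg_eq_0_iff split: if_splits)

text \<open>Entries of the (nearly) optimal \<open>S\<close> in the congruence bound, in eigencoordinates.\<close>
definition s_entry :: "real \<Rightarrow> real^'n^'n \<Rightarrow> 'n \<Rightarrow> 'n \<Rightarrow> real" where
  "s_entry r h i j = (if m j = 0 then 0 else if 0 < l i then - h$i$j / l i
     else if m i = 0 then r * h$i$j / m j else r * h$i$j / (2 * m j))"

text \<open>For a pair of positions the left side is a concave quadratic in the two entries of
  \<open>s\<close>. Within the blocks of \<open>pen\<close> the chosen entries maximise it exactly.
  Between positive and negative eigenvalues they maximise it without the \<open>1 / r\<close> term,
  which leaves the sigma-term and the squared ratio \<open>m / l\<close>.\<close>

lemma congruence_bound_value: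
  assumes r: "0 < r" and h: "h \<in> Sym"
  defines "s \<equiv> (\<chi> i j. s_entry r h i j)"
  shows "(s ** diag_mat m ** transpose s) \<bullet> diag_mat l + 2 * ((s ** diag_mat m) \<bullet> h)
      - (norm (s ** diag_mat m + diag_mat m ** transpose s))\<^sup>2 / (2 * r)
     = (\<Sum>i\<in>UNIV. \<Sum>j\<in>UNIV. - (m j * (h$i$j)\<^sup>2 / l i) - (m j / l i)\<^sup>2 * (h$i$j)\<^sup>2 / r
         + (if l i = 0 \<and> m j < 0 then (if m i = 0 then r else r / 2) * (h$i$j)\<^sup>2 else 0))"
    (is "?L = (\<Sum>i\<in>UNIV. \<Sum>j\<in>UNIV. ?b i j)")
proof -
  let ?t = "\<lambda>i j. (s$i$j)\<^sup>2 * m j * l i + 2 * (s$i$j * m j * h$i$j) - (s$i$j * m j + m i * s$j$i)\<^sup>2 / (2 * r)"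
  have 1: "(s ** diag_mat m ** transpose s) \<bullet> diag_mat l = (\<Sum>i\<in>UNIV. \<Sum>j\<in>UNIV. (s$i$j)\<^sup>2 * m j * l i)"
    by (simp add: inner_commute[of _ "diag_mat l"] inner_diag_mat matrix_matrix_mult_def[of "s ** _"]
        transpose_def sum_distrib_left power2_eq_square algebra_simps)
  have 2: "2 * ((s ** diag_mat m) \<bullet> h) = (\<Sum>i\<in>UNIV. \<Sum>j\<in>UNIV. 2 * (s$i$j * m j * h$i$j))"
    by (simp add: inner_matrix_eq sum_distrib_left)
  have 3: "(norm (s ** diag_mat m + diag_mat m ** transpose s))\<^sup>2 / (2 * r)
     = (\<Sum>i\<in>UNIV. \<Sum>j\<in>UNIV. (s$i$j * m j + m i * s$j$i)\<^sup>2 / (2 * r))"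
    unfolding norm_matrix_sq sum_divide_distrib by (simp add: transpose_def)
  have "?L = (\<Sum>i\<in>UNIV. \<Sum>j\<in>UNIV. ?t i j)"
    unfolding 1 2 3 by (simp add: sum.distrib sum_subtractf)
  also have "\<dots> = (\<Sum>i\<in>UNIV. \<Sum>j\<in>UNIV. ?b i j)"
  proof (rule sum_sym_eq)
    fix i j
    have hs: "h$j$i = h$i$j" using Sym_nth[OF h] .
    have l0: "0 < l k \<or> l k = 0" and m0: "m k < 0 \<or> m k = 0" and lm0: "l k = 0 \<or> m k = 0" for k
      using l[of k] m[of k] lm[of k] by auto
    have [simp]: "s$a$b = s_entry r h a b" for a b by (simp add: s_def)
    consider "m i = 0" "m j = 0" | "m i < 0" "m j < 0" | "m i = 0" "m j < 0" | "m i < 0" "m j = 0"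
      using m0 by blast
    then show "?t i j + ?t j i = ?b i j + ?b j i"
    proof cases
      case 1 then show ?thesis by (simp add: s_entry_def)
    next
      case 2
      then have "l i = 0" "l j = 0" using lm0 by force+
      with 2 show ?thesis using r by (simp add: s_entry_def hs field_simps power2_eq_square)
    next
      case 3
      then have "l j = 0" using lm0 by force
      with 3 l0[of i] show ?thesis using r by (auto simp: s_entry_def hs field_simps power2_eq_square)
    next
      case 4
      then have "l i = 0" using lm0 by force
      with 4 l0[of j] show ?thesis using r by (auto simp: s_entry_def hs field_simps power2_eq_square)
    qed
  qed
  finally show ?thesis .
qed

lemma bounded_linear_s_entry: "bounded_linear (\<lambda>H. conj_by P (\<chi> i j. s_entry r (co H) i j))"
proof (rule bounded_linear_compose[OF bounded_linear_conj_by])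
  have "linear (\<lambda>H. \<chi> i j. s_entry r (co H) i j)"
    by (rule linearI) (auto simp: vec_eq_iff s_entry_def conj_by_add conj_by_scaleR add_divide_distrib diff_divide_distrib algebra_simps)
  then show "bounded_linear (\<lambda>H. \<chi> i j. s_entry r (co H) i j)" by (simp add: linear_linear)
qed

text \<open>Orthogonal invariance reduces the claim to eigencoordinates, where two things are given
  away: \<open>r\<close> becomes \<open>r / 2\<close> in one block, and each entry in the
  \<open>1 / r\<close> term is bounded by the norm of \<open>H\<close>.\<close>

lemma lower_le:
  assumes r: "0 < r" and H: "H \<in> Sym"
  defines "S \<equiv> conj_by P (\<chi> i j. s_entry r (co H) i j)"
  shows "lower r H \<le> (S ** Y ** transpose S) \<bullet> X + 2 * ((S ** Y) \<bullet> H)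
         - (norm (S ** Y + Y ** transpose S))\<^sup>2 / (2 * r)" (is "_ \<le> ?R")
proof -
  define h where "h = co H"
  have Hh: "H = conj_by P h" and h: "h \<in> Sym"
    by (simp_all add: h_def conj_by_inverse'[OF P] conj_by_Sym H)
  have "\<bar>h$i$j\<bar> \<le> norm h" for i j
    using component_le_norm_cart[of "h$i" j] Finite_Cartesian_Product.norm_nth_le[of h i] by linarith
  then have hle: "(h$i$j)\<^sup>2 \<le> (norm H)\<^sup>2" for i j
    unfolding Hh norm_conj_by[OF P] by (simp add: abs_le_square_iff[symmetric])
  have "lower r H = (\<Sum>i\<in>UNIV. \<Sum>j\<in>UNIV. - (m j * (h$i$j)\<^sup>2 / l i) - (m j / l i)\<^sup>2 * (norm H)\<^sup>2 / r
         + (if l i = 0 \<and> m j < 0 then r / 2 * (h$i$j)\<^sup>2 else 0))"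
    unfolding lower_def Upsilon_XY[OF H] pen_def rbound_def h_def[symmetric]
    by (simp add: sum.distrib sum_subtractf sum_distrib_left sum_distrib_right sum_divide_distrib sum_negf)
      (auto intro!: sum.cong)
  also have "\<dots> \<le> (\<Sum>i\<in>UNIV. \<Sum>j\<in>UNIV. - (m j * (h$i$j)\<^sup>2 / l i) - (m j / l i)\<^sup>2 * (h$i$j)\<^sup>2 / r
         + (if l i = 0 \<and> m j < 0 then (if m i = 0 then r else r / 2) * (h$i$j)\<^sup>2 else 0))"
    using r by (intro sum_mono add_mono diff_mono order_refl divide_right_mono mult_left_mono hle)
      (auto intro!: mult_right_mono)
  also have "\<dots> = ?R"
    unfolding congruence_bound_value[OF r h, symmetric] S_def X_def Y_def transpose_conj_by
      conj_by_mult[OF P] h_def[symmetric] inner_conj_by[OF P] conj_by_add[symmetric] norm_conj_by[OF P]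
    by (subst Hh) (simp add: inner_conj_by[OF P])
  finally show ?thesis .
qed

text \<open>\<open>s_entry\<close> uses \<open>P\<close>, \<open>l\<close>, \<open>m\<close> of the
  reference pair only and is linear in \<open>H\<close>, so one fixed linear \<open>S\<close> serves
  all nearby \<open>X'\<close>, \<open>Y'\<close>, whatever their ranks.\<close>

theorem second_order_lower_bound:
  assumes r: "0 < r" and e: "0 < e"
  shows "\<exists>\<delta>>0. \<forall>X'\<in>psd. \<forall>Y'\<in>nsd. \<forall>X''\<in>psd. \<forall>H\<in>Sym. X' \<bullet> Y' = 0 \<longrightarrow>
      norm (X' - X) < \<delta> \<longrightarrow> norm (Y' - Y) < \<delta> \<longrightarrow> norm H < \<delta> \<longrightarrow>
      lower r H - e * (norm H)\<^sup>2 \<le> - (Y' \<bullet> X'') + r / 2 * (norm (X'' - X' - H))\<^sup>2"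
proof -
  let ?S = "\<lambda>H. conj_by P (\<chi> i j. s_entry r (co H) i j)"
  obtain \<delta> where "\<delta> > 0" and \<delta>: "\<And>X' Y' X'' H. X' \<in> psd \<Longrightarrow> Y' \<in> nsd \<Longrightarrow> X'' \<in> psd \<Longrightarrow> H \<in> Sym \<Longrightarrow>
      X' \<bullet> Y' = 0 \<Longrightarrow> norm (X' - X) < \<delta> \<Longrightarrow> norm (Y' - Y) < \<delta> \<Longrightarrow> norm H < \<delta> \<Longrightarrow>
      (?S H ** Y ** transpose (?S H)) \<bullet> X + 2 * ((?S H ** Y) \<bullet> H)
         - (norm (?S H ** Y + Y ** transpose (?S H)))\<^sup>2 / (2 * r) - e * (norm H)\<^sup>2
      \<le> - (Y' \<bullet> X'') + r / 2 * (norm (X'' - X' - H))\<^sup>2"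
    using complementarity_congruence_bound_uniform[OF bounded_linear_s_entry[of r] r e, of X Y] by meson
  show ?thesis
    by (intro exI[of _ \<delta>] conjI \<open>\<delta> > 0\<close> ballI impI order_trans[OF diff_right_mono[OF lower_le[OF r]] \<delta>])
qed

end

subsection \<open>Finsler's lemma and second order expansions\<close>

text \<open>On the unit sphere the sets where \<open>A + n N\<close> is nonpositive are compact and
  decrease with \<open>n\<close>. A common point would have \<open>N = 0\<close> by the Archimedean
  property and \<open>A \<le> 0\<close>, against \<open>pos\<close>; so one set is empty, and
  homogeneity spreads the positive minimum on the sphere to the whole space.\<close>

lemma Finsler:
  fixes A N :: "'a::euclidean_space \<Rightarrow> real"
  assumes cont: "continuous_on UNIV A" "continuous_on UNIV N"
    and hom: "\<And>c d. A (c *\<^sub>R d) = c\<^sup>2 * A d" "\<And>c d. N (c *\<^sub>R d) = c\<^sup>2 * N d"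
    and N: "\<And>d. 0 \<le> N d" and pos: "\<And>d. d \<noteq> 0 \<Longrightarrow> N d = 0 \<Longrightarrow> 0 < A d"
  obtains r \<mu> where "0 < r" "0 < \<mu>" "\<And>d. \<mu> * (norm d)\<^sup>2 \<le> A d + r * N d"
proof -
  let ?K = "sphere (0::'a) 1"
  define F where "F n = {d \<in> ?K. A d + real n * N d \<le> 0}" for n
  have cont': "continuous_on S (\<lambda>d. A d + c * N d)" for S c
    by (intro continuous_intros continuous_on_subset[OF cont(1)] continuous_on_subset[OF cont(2)]) auto
  have "compact (F n)" for n
  proof -
    have "closed {d. A d + real n * N d \<le> 0}"
      by (intro closed_Collect_le cont' continuous_intros)
    moreover have "F n = ?K \<inter> {d. A d + real n * N d \<le> 0}" by (auto simp: F_def)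
    ultimately show ?thesis by (metis compact_Int_closed compact_sphere)
  qed
  moreover have "F n \<subseteq> F k" if "k \<le> n" for k n
  proof
    fix d assume "d \<in> F n"
    moreover have "real k * N d \<le> real n * N d" using that N by (intro mult_right_mono) auto
    ultimately show "d \<in> F k" by (simp add: F_def)
  qed
  moreover have "\<Inter> (range F) = {}"
  proof (rule ccontr)
    assume "\<Inter> (range F) \<noteq> {}"
    then obtain d where "d \<in> \<Inter> (range F)" by blast
    then have d: "norm d = 1" and le: "\<And>n. A d + real n * N d \<le> 0" by (auto simp: F_def)
    have "N d = 0"
    proof (rule ccontr)
      assume "N d \<noteq> 0"
      with N[of d] have "N d > 0" by simp
      then obtain n where "- A d < real n * N d" using reals_Archimedean3 by blast
      with le[of n] show False by linarith
    qed
    moreover have "d \<noteq> 0" using d by auto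
    ultimately show False using pos[of d] le[of 0] by simp
  qed
  ultimately obtain n where n: "F n = {}" using compact_nest[of F] by blast
  \<comment> \<open>The shift by one makes \<open>r\<close> positive even if \<open>n = 0\<close>,
    and nonnegativity of \<open>N\<close> keeps the estimate.\<close>
  define r where "r = real n + 1"
  have posK: "0 < A d + r * N d" if "d \<in> ?K" for d
  proof -
    have "0 < A d + real n * N d" using n that by (force simp: F_def)
    also have "\<dots> \<le> A d + r * N d" using N by (simp add: r_def algebra_simps)
    finally show ?thesis .
  qed
  have "?K \<noteq> {}" by simp
  then obtain d0 where d0: "d0 \<in> ?K" "\<And>d. d \<in> ?K \<Longrightarrow> A d0 + r * N d0 \<le> A d + r * N d"
    using continuous_attains_inf[OF compact_sphere _ cont', of 0 1 r] by blast
  show ?thesis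
  proof (rule that[of r "A d0 + r * N d0"])
    show "0 < r" by (simp add: r_def)
    show "0 < A d0 + r * N d0" using posK d0 by blast
    show "(A d0 + r * N d0) * (norm d)\<^sup>2 \<le> A d + r * N d" for d
    proof (cases "d = 0")
      case True
      then show ?thesis using hom[of 0 d] by simp
    next
      case False
      then have u: "d /\<^sub>R norm d \<in> ?K" and d: "d = norm d *\<^sub>R (d /\<^sub>R norm d)" by auto
      have "A d + r * N d = (norm d)\<^sup>2 * (A (d /\<^sub>R norm d) + r * N (d /\<^sub>R norm d))"
        by (subst d, subst hom, subst (3) d, subst hom) (simp add: algebra_simps)
      then show ?thesis using mult_left_mono[OF d0(2)[OF u], of "(norm d)\<^sup>2"] by (simp add: mult.commute)
    qed
  qed
qed

lemma has_derivative_Sym: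
  assumes "(F has_derivative D) (at x)" "\<And>x. F x \<in> Sym"
  shows "D d \<in> Sym"
proof -
  have "((\<lambda>x. transpose (F x)) has_derivative (\<lambda>d. transpose (D d))) (at x)"
    by (intro derivative_intros assms)
  moreover have "(\<lambda>x. transpose (F x)) = F" using assms(2) by (auto simp: Sym_def)
  ultimately have "(\<lambda>d. transpose (D d)) = D"
    using has_derivative_unique[OF assms(1)] by metis
  then show ?thesis by (metis (mono_tags) Sym_def mem_Collect_eq)
qed

section \<open>Second order expansions of the Lagrangian and of the constraint\<close>

locale c2_problem =
  fixes f :: "'a::euclidean_space \<Rightarrow> real" and f1 f2
    and G :: "'a \<Rightarrow> real^'n^'n" and G1 G2
  assumes f1: "\<And>x. (f has_derivative blinfun_apply (f1 x)) (at x)"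
    and f2: "\<And>x. (f1 has_derivative blinfun_apply (f2 x)) (at x)"
    and f2_cont: "continuous_on UNIV f2"
    and G1: "\<And>x. (G has_derivative blinfun_apply (G1 x)) (at x)"
    and G2: "\<And>x. (G1 has_derivative blinfun_apply (G2 x)) (at x)"
    and G2_cont: "continuous_on UNIV G2"
    and G_Sym: "\<And>x. G x \<in> Sym"
begin

lemma G1_Sym: "G1 x d \<in> Sym"
  using has_derivative_Sym[OF G1 G_Sym] .

lemma frechet_G: "frechet_derivative G (at x) = blinfun_apply (G1 x)"
  using frechet_derivative_at[OF G1] by simp

lemma Lag_derivative: "((\<lambda>x. Lag f G x Y) has_derivative (\<lambda>d. f1 x d + Y \<bullet> G1 x d)) (at x)"
  unfolding Lag_def by (auto intro!: derivative_eq_intros f1 G1)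

lemma frechet_Lag: "frechet_derivative (\<lambda>x. Lag f G x Y) (at x) = (\<lambda>d. f1 x d + Y \<bullet> G1 x d)"
  using frechet_derivative_at[OF Lag_derivative] by simp

definition q :: "real^'n^'n \<Rightarrow> 'a \<Rightarrow> 'a \<Rightarrow> real" where
  "q Y x d = f2 x d d + Y \<bullet> G2 x d d"

lemma hess_Lag: "hess (\<lambda>z. Lag f G z Y) x d e = f2 x e d + Y \<bullet> G2 x e d"
proof -
  have "((\<lambda>z. f1 z d + Y \<bullet> G1 z d) has_derivative (\<lambda>e. f2 x e d + Y \<bullet> G2 x e d)) (at x)"
    by (auto intro!: derivative_eq_intros f2 G2)
  from frechet_derivative_at[OF this] show ?thesis
    unfolding hess_def frechet_Lag by (metis (mono_tags))
qed

lemma inner_Lxx: "d \<bullet> Lxx f G x Y d = q Y x d"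
proof -
  define g where "g e = f2 x e d + Y \<bullet> G2 x e d" for e
  have "linear (\<lambda>e. f2 x e d + Y \<bullet> G2 x e d)"
    by (rule linearI) (simp_all add: blinfun.add_right blinfun.add_left blinfun.scaleR_right
        blinfun.scaleR_left inner_add_right algebra_simps)
  then have lin: "linear g" unfolding g_def .
  have "g d = g (\<Sum>b\<in>Basis. (d \<bullet> b) *\<^sub>R b)" by (simp add: euclidean_representation)
  also have "\<dots> = (\<Sum>b\<in>Basis. (d \<bullet> b) *\<^sub>R g b)" by (simp add: linear_sum[OF lin] linear_cmul[OF lin])
  finally show ?thesis
    by (simp add: q_def Lxx_def hess_Lag inner_sum_right mult.commute g_def)
qed

lemma q_scaleR: "q Y x (c *\<^sub>R d) = c\<^sup>2 * q Y x d"
  by (simp add: q_def blinfun.scaleR_right blinfun.scaleR_left power2_eq_square algebra_simps)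

lemma continuous_q: "continuous_on S (q Y x)"
  unfolding q_def
  by (intro continuous_intros bounded_bilinear.continuous_on[OF bounded_bilinear_blinfun_apply])

text \<open>The same device as for the congruence bound: restrict to unit \<open>d\<close>, use
  uniform continuity on a compact set, and scale back by homogeneity.\<close>

lemma q_uniform:
  assumes e: "0 < e"
  obtains \<delta> where "0 < \<delta>" "\<And>x Y d. norm (x - xb) < \<delta> \<Longrightarrow> norm (Y - Yb) < \<delta> \<Longrightarrow>
    q Yb xb d - e * (norm d)\<^sup>2 \<le> q Y x d"
proof -
  define F where "F = (\<lambda>(x, Y, d). q Y x d)"
  let ?C = "cball xb 1 \<times> cball Yb 1 \<times> sphere (0::'a) 1"
  have "continuous_on ?C F"
    unfolding F_def q_def case_prod_beta
    by (intro continuous_intros bounded_bilinear.continuous_on[OF bounded_bilinear_blinfun_apply]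
        continuous_on_compose2[OF f2_cont] continuous_on_compose2[OF G2_cont]) auto
  moreover have "compact ?C" by (intro compact_Times compact_cball compact_sphere)
  ultimately have "uniformly_continuous_on ?C F" by (rule compact_uniformly_continuous)
  then obtain \<eta> where \<eta>: "\<eta> > 0" and \<eta>F: "\<And>z z'. z \<in> ?C \<Longrightarrow> z' \<in> ?C \<Longrightarrow> dist z' z < \<eta> \<Longrightarrow> dist (F z') (F z) < e"
    unfolding uniformly_continuous_on_def using e by metis
  show ?thesis
  proof (rule that[of "min 1 (\<eta> / 3)"])
    show "0 < min 1 (\<eta> / 3)" using \<eta> by simp
    fix x Y and d :: 'a
    assume x: "norm (x - xb) < min 1 (\<eta> / 3)" and Y: "norm (Y - Yb) < min 1 (\<eta> / 3)"
    show "q Yb xb d - e * (norm d)\<^sup>2 \<le> q Y x d"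
    proof (cases "d = 0")
      case True
      then show ?thesis using q_scaleR[of _ _ 0 d] by simp
    next
      case False
      define u where "u = d /\<^sub>R norm d"
      have u: "norm u = 1" and d: "d = norm d *\<^sub>R u" using False by (auto simp: u_def)
      have "dist (x, Y, u) (xb, Yb, u) \<le> dist x xb + (dist Y Yb + dist u u)"
        by (meson add_left_mono dist_Pair_le order_trans)
      also have "\<dots> < \<eta>" using x Y \<eta> by (simp add: dist_norm)
      finally have "dist (F (x, Y, u)) (F (xb, Yb, u)) < e"
        using x Y u by (intro \<eta>F) (auto simp: dist_norm norm_minus_commute)
      then have "q Yb xb u - e \<le> q Y x u" by (simp add: F_def dist_real_def)
      then have "(norm d)\<^sup>2 * (q Yb xb u - e) \<le> (norm d)\<^sup>2 * q Y x u" by (intro mult_left_mono) auto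
      then show ?thesis
        by (subst (1 3) d) (simp add: q_scaleR algebra_simps)
    qed
  qed
qed

lemma Lag_taylor:
  obtains y where "y \<in> closed_segment x x'"
    "Lag f G x' Y = Lag f G x Y + (f1 x (x' - x) + Y \<bullet> G1 x (x' - x)) + q Y y (x' - x) / 2"
proof -
  define d where "d = x' - x"
  let ?g0 = "\<lambda>t. Lag f G (x + t *\<^sub>R d) Y"
  let ?g1 = "\<lambda>t. f1 (x + t *\<^sub>R d) d + Y \<bullet> G1 (x + t *\<^sub>R d) d"
  let ?g2 = "\<lambda>t. q Y (x + t *\<^sub>R d) d"
  have aff: "((\<lambda>t. x + t *\<^sub>R d) has_derivative (\<lambda>h. h *\<^sub>R d)) (at t)" for t
    by (auto intro!: derivative_eq_intros)
  have "(?g0 has_derivative (\<lambda>h. h * ?g1 t)) (at t)" for t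
    using has_derivative_compose[OF aff Lag_derivative[of Y "x + t *\<^sub>R d"]]
    by (simp add: blinfun.scaleR_right algebra_simps)
  then have d0: "(?g0 has_real_derivative ?g1 t) (at t)" for t
    by (simp add: has_field_derivative_def mult_commute_abs)
  have "(?g1 has_derivative (\<lambda>h. h * ?g2 t)) (at t)" for t
    using has_derivative_compose[OF aff f2[of "x + t *\<^sub>R d"]] has_derivative_compose[OF aff G2[of "x + t *\<^sub>R d"]]
    by (auto intro!: derivative_eq_intros simp: q_def blinfun.scaleR_right blinfun.scaleR_left algebra_simps)
  then have d1: "(?g1 has_real_derivative ?g2 t) (at t)" for t
    by (simp add: has_field_derivative_def mult_commute_abs)
  let ?D = "\<lambda>k::nat. if k = 0 then ?g0 else if k = 1 then ?g1 else ?g2"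
  have "\<exists>t. 0 < t \<and> t \<le> 1 \<and> ?g0 1 = (\<Sum>k<2. ?D k 0 / fact k * 1 ^ k) + ?D 2 t / fact 2 * 1 ^ 2"
  proof (rule Maclaurin2)
    show "\<forall>k t. k < 2 \<and> 0 \<le> t \<and> t \<le> 1 \<longrightarrow> DERIV (?D k) t :> ?D (Suc k) t"
      using d0 d1 by (auto simp: less_2_cases_iff)
  qed auto
  then obtain t where t: "0 < t" "t \<le> 1" "?g0 1 = ?g0 0 + ?g1 0 + ?g2 t / 2"
    by (auto simp: numeral_2_eq_2)
  have "x + t *\<^sub>R d \<in> closed_segment x x'"
    unfolding closed_segment_def using t by (auto simp: d_def algebra_simps intro!: exI[of _ t])
  with t show ?thesis by (intro that[of "x + t *\<^sub>R d"]) (auto simp: d_def)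
qed

text \<open>The intermediate point of the Taylor formula stays in the convex ball, so
  \<open>q_uniform\<close> applies to it; the estimate is uniform in the base point and in the
  multiplier, as subgradients at nearby points require.\<close>

lemma Lag_second_order_lower:
  assumes e: "0 < e"
  obtains \<delta> where "0 < \<delta>" "\<And>x x' Y. norm (x - xb) < \<delta> \<Longrightarrow> norm (x' - xb) < \<delta> \<Longrightarrow> norm (Y - Yb) < \<delta> \<Longrightarrow>
    q Yb xb (x' - x) / 2 - e * (norm (x' - x))\<^sup>2 \<le>
      Lag f G x' Y - Lag f G x Y - (f1 x (x' - x) + Y \<bullet> G1 x (x' - x))"
proof -
  obtain \<delta> where \<delta>: "0 < \<delta>" "\<And>x Y d. norm (x - xb) < \<delta> \<Longrightarrow> norm (Y - Yb) < \<delta> \<Longrightarrow>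
    q Yb xb d - 2 * e * (norm d)\<^sup>2 \<le> q Y x d"
    using q_uniform[of "2 * e"] e by (metis mult_pos_pos zero_less_numeral)
  show ?thesis
  proof (rule that[OF \<delta>(1)])
    fix x x' Y
    assume *: "norm (x - xb) < \<delta>" "norm (x' - xb) < \<delta>" "norm (Y - Yb) < \<delta>"
    obtain y where y: "y \<in> closed_segment x x'" and
      L: "Lag f G x' Y = Lag f G x Y + (f1 x (x' - x) + Y \<bullet> G1 x (x' - x)) + q Y y (x' - x) / 2"
      by (rule Lag_taylor)
    have "closed_segment x x' \<subseteq> ball xb \<delta>"
      using * by (intro closed_segment_subset) (auto simp: dist_norm norm_minus_commute)
    then have "norm (y - xb) < \<delta>" using y by (auto simp: dist_norm norm_minus_commute)
    from \<delta>(2)[OF this *(3), of "x' - x"]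
    show "q Yb xb (x' - x) / 2 - e * (norm (x' - x))\<^sup>2 \<le>
      Lag f G x' Y - Lag f G x Y - (f1 x (x' - x) + Y \<bullet> G1 x (x' - x))"
      unfolding L by simp
  qed
qed

text \<open>The derivative is frozen at \<open>xb\<close> while both points vary, because the second
  order bound will be applied to \<open>H = G1 xb d\<close>. Continuity of \<open>G1\<close> and the
  mean value inequality on a ball give it.\<close>

lemma G_strict_derivative:
  assumes e: "0 < e"
  obtains \<delta> where "0 < \<delta>" "\<And>x x'. norm (x - xb) < \<delta> \<Longrightarrow> norm (x' - xb) < \<delta> \<Longrightarrow>
    norm (G x' - G x - G1 xb (x' - x)) \<le> e * norm (x' - x)"
proof -
  have "isCont G1 xb" using has_derivative_continuous[OF G2] .
  then obtain \<delta> where \<delta>: "0 < \<delta>" "\<And>x. norm (x - xb) < \<delta> \<Longrightarrow> norm (G1 x - G1 xb) < e"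
    unfolding continuous_at_eps_delta dist_norm using e by blast
  show ?thesis
  proof (rule that[OF \<delta>(1)])
    fix x x' assume *: "norm (x - xb) < \<delta>" "norm (x' - xb) < \<delta>"
    have seg: "closed_segment x x' \<subseteq> ball xb \<delta>"
      using * by (intro closed_segment_subset) (auto simp: dist_norm norm_minus_commute)
    have "norm (G x' - G x - G1 xb (x' - x)) \<le> norm (x' - x) * e"
    proof (rule differentiable_bound_linearization[where S = "ball xb \<delta>" and f' = "\<lambda>x. blinfun_apply (G1 x)"])
      show "x + t *\<^sub>R (x' - x) \<in> ball xb \<delta>" if "t \<in> {0..1}" for t
      proof -
        have "x + t *\<^sub>R (x' - x) \<in> closed_segment x x'"
          unfolding closed_segment_def using that by (auto simp: algebra_simps intro!: exI[of _ t])
        then show ?thesis using seg by blast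
      qed
      show "(G has_derivative blinfun_apply (G1 y)) (at y within ball xb \<delta>)" for y
        using G1 has_derivative_at_withinI by blast
      show "onorm (blinfun_apply (G1 y) - blinfun_apply (G1 xb)) \<le> e" if "y \<in> ball xb \<delta>" for y
      proof -
        have "blinfun_apply (G1 y) - blinfun_apply (G1 xb) = blinfun_apply (G1 y - G1 xb)"
          by (auto simp: blinfun.diff_left)
        then show ?thesis
          using \<delta>(2)[of y] that by (simp add: norm_blinfun.rep_eq[symmetric] dist_norm norm_minus_commute)
      qed
    qed (use \<delta> in auto)
    then show "norm (G x' - G x - G1 xb (x' - x)) \<le> e * norm (x' - x)" by (simp add: mult.commute)
  qed
qed

end

subsection \<open>Feasible arcs and the affine hull of the critical cone\<close>

lemma norm_matrix_vector_le: "norm ((A::real^'n^'m) *v v) \<le> norm A * norm v"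
proof (rule power2_le_imp_le)
  have "(norm (A *v v))\<^sup>2 = (\<Sum>i\<in>UNIV. (A$i \<bullet> v)\<^sup>2)"
    unfolding power2_norm_eq_inner inner_vec_def[of "A *v v"]
    by (simp add: matrix_vector_mul_component power2_eq_square)
  also have "\<dots> \<le> (\<Sum>i\<in>UNIV. (norm (A$i))\<^sup>2 * (norm v)\<^sup>2)"
    by (intro sum_mono) (metis Cauchy_Schwarz_ineq power2_norm_eq_inner)
  also have "\<dots> = (norm A)\<^sup>2 * (norm v)\<^sup>2"
    by (simp add: power2_norm_eq_inner inner_vec_def[of A A] sum_distrib_right)
  finally show "(norm (A *v v))\<^sup>2 \<le> (norm A * norm v)\<^sup>2" by (simp add: power_mult_distrib)
qed simp

lemma psd_shift: 
  assumes "A \<in> Sym" "norm A \<le> c"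
  shows "A + c *\<^sub>R mat 1 \<in> psd"
proof -
  have "0 \<le> v \<bullet> ((A + c *\<^sub>R mat 1) *v v)" for v
  proof -
    have "\<bar>v \<bullet> (A *v v)\<bar> \<le> norm v * norm (A *v v)" by (rule Cauchy_Schwarz_ineq2)
    also have "\<dots> \<le> norm v * (norm A * norm v)" by (intro mult_left_mono norm_matrix_vector_le) simp
    also have "\<dots> \<le> norm v * (c * norm v)" using assms by (intro mult_left_mono mult_right_mono) auto
    finally have "\<bar>v \<bullet> (A *v v)\<bar> \<le> c * (v \<bullet> v)" by (simp add: dot_square_norm power2_eq_square mult_ac)
    moreover have "(A + c *\<^sub>R mat 1) *v v = A *v v + c *\<^sub>R v"
      by (simp add: matrix_vector_mult_add_rdistrib scaleR_matrix_vector_assoc[symmetric])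
    ultimately show ?thesis by (simp add: inner_add_right abs_le_iff)
  qed
  then show ?thesis using assms by (auto simp: psd_def Sym_def transpose_add transpose_scalar)
qed

text \<open>\<open>K\<close> solves \<open>K A + A K\<^sup>T = h\<close> for \<open>A = diag_mat a\<close>, so that
  \<open>(I + K) A (I + K)\<^sup>T\<close> is a feasible arc with velocity \<open>h\<close>.\<close>
definition arc_gen :: "('n \<Rightarrow> real) \<Rightarrow> real^'n^'n \<Rightarrow> real^'n^'n" where
  "arc_gen a h = (\<chi> i j. if a j = 0 then 0 else if a i = 0 then h$i$j / a j else h$i$j / (2 * a j))"

text \<open>\<open>z\<close> is the solvability condition for \<open>K\<close>: on the block where
  both eigenvalues of \<open>A\<close> are zero, \<open>K A + A K^T\<close> vanishes.\<close>

lemma psd_arc: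
  fixes a :: "'n::finite \<Rightarrow> real" and h :: "real^'n^'n"
  assumes a: "\<And>i. 0 \<le> a i" and h: "h \<in> Sym" and z: "\<And>i j. a i = 0 \<Longrightarrow> a j = 0 \<Longrightarrow> h$i$j = 0"
  defines "K \<equiv> arc_gen a h"
  shows "diag_mat a + t *\<^sub>R h + t\<^sup>2 *\<^sub>R (K ** diag_mat a ** transpose K) \<in> psd"
proof -
  have "K ** diag_mat a + diag_mat a ** transpose K = h"
    using Sym_nth[OF h] z by (auto simp: vec_eq_iff K_def arc_gen_def transpose_def field_simps)
  then have "(mat 1 + t *\<^sub>R K) ** diag_mat a ** transpose (mat 1 + t *\<^sub>R K)
      = diag_mat a + t *\<^sub>R h + t\<^sup>2 *\<^sub>R (K ** diag_mat a ** transpose K)"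
    by (auto simp: matrix_add_ldistrib matrix_add_rdistrib transpose_add transpose_scalar
        matrix_scaleR_left matrix_scaleR_right power2_eq_square algebra_simps)
  moreover have "(mat 1 + t *\<^sub>R K) ** diag_mat a ** transpose (mat 1 + t *\<^sub>R K) \<in> psd"
    by (intro psd_congruence diag_mat_psd a)
  ultimately show ?thesis by simp
qed

text \<open>The curvature of the arc paired with the multiplier is half the sigma-term. Only rows
  \<open>j\<close> with \<open>m j\<close> nonzero count; there \<open>a j = 0\<close>, and the
  entries of \<open>K\<close> are \<open>h / a\<close>.\<close>

lemma inner_diag_arc:
  fixes a m :: "'n::finite \<Rightarrow> real" and h :: "real^'n^'n"
  assumes am: "\<And>i. a i * m i = 0" and h: "h \<in> Sym"
  defines "K \<equiv> arc_gen a h"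
  shows "diag_mat m \<bullet> (K ** diag_mat a ** transpose K) = (\<Sum>i\<in>UNIV. \<Sum>j\<in>UNIV. m j * (h$i$j)\<^sup>2 / a i)"
proof -
  have "m j * (K ** diag_mat a ** transpose K) $ j $ j = (\<Sum>i\<in>UNIV. m j * (h$i$j)\<^sup>2 / a i)" for j
  proof (cases "m j = 0")
    case False
    then have "a j = 0" using am[of j] by simp
    have "(K ** diag_mat a ** transpose K) $ j $ j = (\<Sum>i\<in>UNIV. K$j$i * a i * K$j$i)"
      unfolding matrix_matrix_mult_def[of _ "transpose K"] by (simp add: transpose_def)
    also have "\<dots> = (\<Sum>i\<in>UNIV. (h$i$j)\<^sup>2 / a i)"
      using Sym_nth[OF h, of j] \<open>a j = 0\<close>
      by (auto simp: K_def arc_gen_def power2_eq_square intro!: sum.cong)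
    finally have "(K ** diag_mat a ** transpose K) $ j $ j = (\<Sum>i\<in>UNIV. (h$i$j)\<^sup>2 / a i)" .
    then show ?thesis by (simp add: sum_distrib_left)
  qed simp
  then have "diag_mat m \<bullet> (K ** diag_mat a ** transpose K) = (\<Sum>j\<in>UNIV. \<Sum>i\<in>UNIV. m j * (h$i$j)\<^sup>2 / a i)"
    by (simp add: inner_diag_mat)
  also have "\<dots> = (\<Sum>i\<in>UNIV. \<Sum>j\<in>UNIV. m j * (h$i$j)\<^sup>2 / a i)" by (rule sum.swap)
  finally show ?thesis .
qed

context complementary_pair
begin

lemma co_X: "co X = diag_mat l" and co_Y: "co Y = diag_mat m"
  by (simp_all add: X_def Y_def conj_by_inverse[OF P])

lemma inner_co: "co A \<bullet> co B = A \<bullet> B"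
  by (simp add: inner_conj_by_swap conj_by_inverse'[OF P])

text \<open>A tangent direction is positive semidefinite on the kernel of \<open>X\<close>.
  Orthogonality to \<open>Y\<close> makes a weighted sum of its nonnegative diagonal entries over
  negative \<open>m j\<close> zero, so these entries vanish, and a zero diagonal entry of a positive
  semidefinite block annihilates its row.\<close>

lemma critical_cone_subset: "critical_cone X Y \<subseteq> {H \<in> Sym. pen H = 0}"
proof
  fix H assume "H \<in> critical_cone X Y"
  then obtain t :: "nat \<Rightarrow> real" and Hk where t: "\<And>k. t k > 0" and Hk: "\<And>k. X + t k *\<^sub>R Hk k \<in> psd" and lim: "Hk \<longlonglongrightarrow> H"
    and YH: "Y \<bullet> H = 0"
    by (auto simp: critical_cone_def tangent_cone_def)
  have "Hk k \<in> Sym" for k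
  proof -
    have "(1 / t k) *\<^sub>R ((X + t k *\<^sub>R Hk k) - X) \<in> Sym"
      by (intro subspace_scale subspace_diff subspace_Sym psd_subset_Sym Hk X_psd)
    then show ?thesis using t[of k] by simp
  qed
  then have H: "H \<in> Sym" using closed_sequentially[OF closed_Sym] lim by blast
  define h where "h = co H"
  have h: "h \<in> Sym" by (simp add: h_def conj_by_Sym H)
  \<comment> \<open>For \<open>w\<close> in the kernel of the diagonal matrix \<open>l\<close> the
    base point contributes nothing, so the sign survives division by \<open>t k\<close> and the
    limit.\<close>
  have hpos: "0 \<le> w \<bullet> (h *v w)" if w: "\<And>i. 0 < l i \<Longrightarrow> w$i = 0" for w
  proof (rule LIMSEQ_le_const)
    have "(\<lambda>k. co (Hk k)) \<longlonglongrightarrow> h"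
      unfolding h_def by (intro bounded_linear.tendsto[OF bounded_linear_conj_by] lim)
    then show "(\<lambda>k. w \<bullet> (co (Hk k) *v w)) \<longlonglongrightarrow> w \<bullet> (h *v w)"
      unfolding matrix_vector_mult_def by (intro tendsto_intros)
    have "0 \<le> w \<bullet> (co (Hk k) *v w)" for k
    proof -
      have "diag_mat l + t k *\<^sub>R co (Hk k) \<in> psd"
        using conj_by_psd[OF Hk[of k], of "transpose P"] by (simp add: conj_by_add conj_by_scaleR co_X)
      then have "0 \<le> w \<bullet> ((diag_mat l + t k *\<^sub>R co (Hk k)) *v w)" by (simp add: psd_def)
      also have "\<dots> = w \<bullet> (diag_mat l *v w) + t k * (w \<bullet> (co (Hk k) *v w))"
        by (simp add: matrix_vector_mult_add_rdistrib scaleR_matrix_vector_assoc[symmetric] inner_add_right)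
      also have "w \<bullet> (diag_mat l *v w) = 0"
        unfolding inner_diag_mat_mult using w l by (intro sum.neutral) (auto simp: less_le)
      finally show ?thesis using t[of k] by (simp add: zero_le_mult_iff)
    qed
    then show "\<exists>N. \<forall>k\<ge>N. 0 \<le> w \<bullet> (co (Hk k) *v w)" by blast
  qed
  have l0: "l j = 0" if "m j < 0" for j using lm[of j] that by simp
  have hjj: "0 \<le> h$j$j" if "l j = 0" for j
  proof -
    have "0 \<le> axis j 1 \<bullet> (h *v axis j 1)" using that by (intro hpos) (auto simp: axis_def)
    then show ?thesis by (simp add: inner_axis_matrix)
  qed
  have "(\<Sum>j\<in>UNIV. - (m j * h$j$j)) = 0"
    using YH inner_co[of Y H] by (simp add: co_Y h_def inner_diag_mat sum_negf)
  moreover have "0 \<le> - (m j * h$j$j)" for j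
    using m[of j] hjj[of j] lm[of j] by (cases "m j = 0") (auto simp: mult_nonpos_nonneg)
  ultimately have mh: "m j * h$j$j = 0" for j
    by (subst (asm) sum_nonneg_eq_0_iff) auto
  have "h$i$j = 0" if i: "l i = 0" and j: "m j < 0" for i j
  proof (rule quadratic_nonneg_imp_linear_zero)
    fix s :: real
    have "h$j$j = 0" using mh[of j] j by simp
    moreover have "0 \<le> (axis j 1 + s *\<^sub>R axis i 1) \<bullet> (h *v (axis j 1 + s *\<^sub>R axis i 1))"
      using i l0[OF j] by (intro hpos) (auto simp: axis_def)
    ultimately show "0 \<le> h$i$i * s\<^sup>2 + 2 * s * h$i$j"
      using Sym_nth[OF h, of i j]
      by (simp add: matrix_vector_right_distrib matrix_vector_mult_scaleR inner_add_left inner_add_right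
          inner_axis_matrix power2_eq_square algebra_simps)
  qed
  then show "H \<in> {H \<in> Sym. pen H = 0}" using H by (auto simp: pen_eq_0_iff h_def)
qed

lemma psd_in_critical_cone:
  assumes "A \<in> psd" "Y \<bullet> A = 0"
  shows "A \<in> critical_cone X Y"
proof -
  have "X + (1 / Suc k) *\<^sub>R A \<in> psd" for k :: nat
    by (intro psd_add psd_scaleR X_psd assms) simp
  then show ?thesis
    using assms(2) LIMSEQ_Suc[OF lim_1_over_n[where 'a=real]] unfolding critical_cone_def tangent_cone_def
    by (auto intro!: exI[of _ "\<lambda>k. 1 / real (Suc k)"] exI[of _ "\<lambda>k. A"])
qed

lemma arc_in_critical_cone:
  assumes h: "h \<in> Sym" and z: "\<And>i j. l i = 0 \<Longrightarrow> l j = 0 \<Longrightarrow> h$i$j = 0"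
  shows "conj_by P h \<in> critical_cone X Y"
proof -
  let ?M = "arc_gen l h ** diag_mat l ** transpose (arc_gen l h)"
  let ?t = "\<lambda>k. 1 / real (Suc k)"
  have t: "?t \<longlonglongrightarrow> 0" using LIMSEQ_Suc[OF lim_1_over_n[where 'a=real]] by simp
  have "X + s *\<^sub>R (conj_by P h + s *\<^sub>R conj_by P ?M) \<in> psd" for s
  proof -
    have "diag_mat l + s *\<^sub>R h + s\<^sup>2 *\<^sub>R ?M \<in> psd"
      by (rule psd_arc[OF l h]) (rule z)
    from conj_by_psd[OF this, of P] show ?thesis
      by (simp add: X_def conj_by_add conj_by_scaleR power2_eq_square scaleR_add_right add.assoc)
  qed
  moreover have "(\<lambda>k. conj_by P h + ?t k *\<^sub>R conj_by P ?M) \<longlonglongrightarrow> conj_by P h + 0 *\<^sub>R conj_by P ?M"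
    by (intro tendsto_intros t)
  ultimately have "conj_by P h \<in> tangent_cone psd X"
    unfolding tangent_cone_def using t by (auto intro!: exI[of _ ?t] exI[of _ "\<lambda>k. conj_by P h + ?t k *\<^sub>R conj_by P ?M"])
  moreover have "Y \<bullet> conj_by P h = 0"
  proof -
    have "m i * h$i$i = 0" for i using z[of i i] lm[of i] by auto
    then show ?thesis unfolding Y_def inner_conj_by[OF P] inner_diag_mat by (simp only: sum.neutral_const)
  qed
  ultimately show ?thesis by (simp add: critical_cone_def)
qed

text \<open>For the harder inclusion let \<open>h0\<close> be the block of \<open>h\<close> on the
  common kernel of \<open>X\<close> and \<open>Y\<close>. \<open>h - h0\<close> is the velocity of a
  feasible arc; \<open>h0\<close> need not be semidefinite, but \<open>h0 + c e\<close> and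
  \<open>c e\<close> are. The three critical directions enter with coefficients 1, 1 and -1, which
  sum to 1.\<close>

theorem affine_hull_critical_cone: "affine hull critical_cone X Y = {H \<in> Sym. pen H = 0}" (is "_ = ?T")
proof
  have "subspace ?T"
    by (auto simp: subspace_def pen_eq_0_iff conj_by_add conj_by_scaleR
        subspace_0[OF subspace_Sym] subspace_add[OF subspace_Sym] subspace_scale[OF subspace_Sym])
  then show "affine hull critical_cone X Y \<subseteq> ?T"
    by (intro hull_minimal critical_cone_subset subspace_imp_affine)
  show "?T \<subseteq> affine hull critical_cone X Y"
  proof
    fix H assume "H \<in> ?T"
    then have H: "H \<in> Sym" and pen: "pen H = 0" by auto
    define h where "h = co H"
    have h: "h \<in> Sym" and Hh: "H = conj_by P h"
      by (simp_all add: h_def conj_by_Sym H conj_by_inverse'[OF P])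
    have z: "h$i$j = 0" "h$j$i = 0" if "l i = 0" "m j < 0" for i j
      using pen that Sym_nth[OF h, of i j] by (auto simp: pen_eq_0_iff h_def)
    have m0: "m i = 0 \<or> m i < 0" for i using m[of i] by auto
    define e where "e = (\<lambda>i. if l i = 0 \<and> m i = 0 then 1 else 0 :: real)"
    define h0 where "h0 = diag_mat e ** h ** diag_mat e"
    have h0_nth: "h0$i$j = e i * h$i$j * e j" for i j by (simp add: h0_def)
    have h0: "h0 \<in> Sym" using Sym_nth[OF h] by (simp add: Sym_def vec_eq_iff transpose_def h0_nth)
    define c where "c = norm h"
    have "conj_by P (h - h0) \<in> critical_cone X Y"
    proof (rule arc_in_critical_cone)
      show "h - h0 \<in> Sym" by (intro subspace_diff subspace_Sym h h0)
      show "(h - h0)$i$j = 0" if "l i = 0" "l j = 0" for i j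
        using that m0[of i] m0[of j] z by (auto simp: h0_nth e_def)
    qed
    moreover have "diag_mat e ** (h + c *\<^sub>R mat 1) ** transpose (diag_mat e) \<in> psd"
      by (intro psd_congruence psd_shift h) (simp add: c_def)
    then have "h0 + c *\<^sub>R diag_mat e \<in> psd"
    proof -
      have "diag_mat e ** diag_mat e = diag_mat e"
        by (simp add: vec_eq_iff diag_mat_nth e_def)
      then show ?thesis
        using \<open>diag_mat e ** (h + c *\<^sub>R mat 1) ** transpose (diag_mat e) \<in> psd\<close>
        by (simp add: h0_def matrix_add_ldistrib matrix_add_rdistrib matrix_scaleR_left matrix_scaleR_right)
    qed
    then have "conj_by P (h0 + c *\<^sub>R diag_mat e) \<in> critical_cone X Y"
      by (intro psd_in_critical_cone conj_by_psd)
        (auto simp: Y_def inner_conj_by[OF P] inner_diag_mat h0_nth diag_mat_nth e_def intro!: sum.neutral)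
    moreover have "conj_by P (c *\<^sub>R diag_mat e) \<in> critical_cone X Y"
      by (intro psd_in_critical_cone conj_by_psd psd_scaleR diag_mat_psd)
        (auto simp: Y_def inner_conj_by[OF P] inner_diag_mat diag_mat_nth e_def c_def intro!: sum.neutral)
    ultimately have "1 *\<^sub>R conj_by P (h - h0) + 1 *\<^sub>R conj_by P (h0 + c *\<^sub>R diag_mat e)
        + (- 1) *\<^sub>R conj_by P (c *\<^sub>R diag_mat e) \<in> affine hull critical_cone X Y"
      by (intro mem_affine_3 affine_affine_hull hull_inc) auto
    moreover have "1 *\<^sub>R conj_by P (h - h0) + 1 *\<^sub>R conj_by P (h0 + c *\<^sub>R diag_mat e)
        + (- 1) *\<^sub>R conj_by P (c *\<^sub>R diag_mat e) = H"
      by (simp add: Hh conj_by_add conj_by_diff)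
    ultimately show "H \<in> affine hull critical_cone X Y" by metis
  qed
qed

lemma continuous_pen: "continuous_on S pen"
proof -
  have "continuous_on S (\<lambda>H. if c then (co H $ i $ j)\<^sup>2 else 0)" for c i j
    by (cases c) (auto intro!: continuous_intros bounded_linear.continuous_on[OF bounded_linear_conj_by])
  then show ?thesis unfolding pen_def[abs_def] by (intro continuous_on_sum)
qed

lemma pen_scaleR: "pen (c *\<^sub>R H) = c\<^sup>2 * pen H"
  by (auto simp: pen_def conj_by_scaleR sum_distrib_left power_mult_distrib intro!: sum.cong)

end

section \<open>The program at the reference pair and its second order condition\<close>

locale sdp = complementary_pair P l m + c2_problem f f1 f2 G G1 G2
  for P :: "real^'n^'n" and l m :: "'n \<Rightarrow> real"
    and f :: "'a::euclidean_space \<Rightarrow> real" and f1 f2 and G :: "'a \<Rightarrow> real^'n^'n" and G1 G2 +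
  fixes xb :: 'a
  assumes G_xb: "G xb = X" and stat: "\<And>d. f1 xb d + Y \<bullet> G1 xb d = 0"
begin

definition ssosc :: bool where
  "ssosc \<longleftrightarrow> (\<forall>d. d \<noteq> 0 \<and> pen (G1 xb d) = 0 \<longrightarrow> 0 < q Y xb d - Upsilon X Y (G1 xb d))"

text \<open>Finsler's lemma is applied to the part of \<open>q / 2 + lower\<close> without the
  \<open>1 / r\<close> error, which is then absorbed by a larger \<open>r\<close>. Raising
  \<open>r\<close> is harmless since \<open>pen\<close> is nonnegative.\<close>

lemma ssosc_uniform:
  assumes ssosc
  obtains r0 \<mu> where "0 < r0" "0 < \<mu>"
    "\<And>r d. r0 \<le> r \<Longrightarrow> \<mu> * (norm d)\<^sup>2 \<le> q Y xb d / 2 + lower r (G1 xb d)"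
proof -
  let ?A = "\<lambda>d. q Y xb d / 2 - Upsilon X Y (G1 xb d) / 2"
  let ?N = "\<lambda>d. pen (G1 xb d) / 2"
  have G1_cont: "continuous_on S (blinfun_apply (G1 xb))" for S
    by (intro linear_continuous_on blinfun.bounded_linear_right)
  obtain r1 \<mu> where r1: "0 < r1" and \<mu>: "0 < \<mu>" and F: "\<And>d. \<mu> * (norm d)\<^sup>2 \<le> ?A d + r1 * ?N d"
  proof (rule Finsler[of ?A ?N])
    show "continuous_on UNIV ?A" unfolding Upsilon_def by (intro continuous_intros continuous_q G1_cont) auto
    show "continuous_on UNIV ?N"
      by (intro continuous_intros continuous_on_compose2[OF continuous_pen G1_cont]) auto
    show "?A (c *\<^sub>R d) = c\<^sup>2 * ?A d" for c d
      by (simp add: q_scaleR Upsilon_def blinfun.scaleR_right matrix_scaleR_left matrix_scaleR_right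
          power2_eq_square algebra_simps)
    show "?N (c *\<^sub>R d) = c\<^sup>2 * ?N d" for c d by (simp add: pen_scaleR blinfun.scaleR_right)
    show "0 \<le> ?N d" for d by (simp add: pen_nonneg)
    show "0 < ?A d" if "d \<noteq> 0" "?N d = 0" for d using assms that by (force simp: ssosc_def)
  qed blast
  define B where "B = rbound * (norm (G1 xb))\<^sup>2"
  \<comment> \<open>For \<open>r\<close> beyond \<open>2 * B / \<mu>\<close> the error
    \<open>B / r\<close> costs at most half of \<open>\<mu>\<close>.\<close>
  define r0 where "r0 = max r1 (2 * B / \<mu>)"
  show ?thesis
  proof (rule that[of r0 "\<mu> / 2"])
    show "0 < r0" "0 < \<mu> / 2" using r1 \<mu> by (auto simp: r0_def)
    fix r d assume r: "r0 \<le> r"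
    have "0 < r" using r r1 by (auto simp: r0_def)
    have "r1 \<le> r" "2 * B / \<mu> \<le> r" using r by (auto simp: r0_def)
    then have B: "B / r \<le> \<mu> / 2" using \<mu> \<open>0 < r\<close> by (simp add: field_simps)
    have "(norm (G1 xb d))\<^sup>2 \<le> (norm (G1 xb))\<^sup>2 * (norm d)\<^sup>2"
      using norm_blinfun[of "G1 xb" d] by (metis norm_ge_zero power_mono power_mult_distrib)
    then have "rbound / r * (norm (G1 xb d))\<^sup>2 \<le> rbound / r * ((norm (G1 xb))\<^sup>2 * (norm d)\<^sup>2)"
      using rbound_nonneg \<open>0 < r\<close> by (intro mult_left_mono) auto
    also have "\<dots> = B / r * (norm d)\<^sup>2" by (simp add: B_def)
    also have "\<dots> \<le> \<mu> / 2 * (norm d)\<^sup>2" using B by (intro mult_right_mono) auto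
    finally have 1: "rbound / r * (norm (G1 xb d))\<^sup>2 \<le> \<mu> / 2 * (norm d)\<^sup>2" .
    have "r1 * ?N d \<le> r * ?N d" using \<open>r1 \<le> r\<close> pen_nonneg by (intro mult_right_mono) auto
    with 1 F[of d] show "\<mu> / 2 * (norm d)\<^sup>2 \<le> q Y xb d / 2 + lower r (G1 xb d)"
      unfolding lower_def by (simp add: algebra_simps)
  qed
qed

end

subsection \<open>Derivatives of the projection\<close>

definition schur :: "('n::finite \<Rightarrow> 'n \<Rightarrow> real) \<Rightarrow> real^'n^'n \<Rightarrow> real^'n^'n" where
  "schur w h = (\<chi> i j. w i j * h$i$j)"

lemma schur_nth [simp]: "schur w h $ i $ j = w i j * h$i$j"
  by (simp add: schur_def)

lemma bounded_linear_schur: "bounded_linear (schur w)"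
proof -
  have "linear (schur w)" by (rule linearI) (auto simp: vec_eq_iff algebra_simps)
  then show ?thesis by (simp add: linear_linear)
qed

lemma schur_zero [simp]: "schur w 0 = 0"
  by (simp add: vec_eq_iff)

text \<open>First divided differences of \<open>\<lambda>t. min t 0\<close>.\<close>
definition divdiff_min :: "real \<Rightarrow> real \<Rightarrow> real" where
  "divdiff_min x y = (if x < 0 \<and> y < 0 then 1 else if x < 0 then x / (x - y)
     else if y < 0 then y / (y - x) else 0)"

text \<open>The perturbed matrix is matched up to second order by a sum \<open>A + B\<close> with \<open>A\<close> positive
  semidefinite, \<open>B\<close> negative semidefinite and \<open>A \<bullet> B = 0\<close>; as \<open>B\<close> is the projection of that sum,
  nonexpansiveness transfers the derivative of \<open>B\<close> to the projection.\<close>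
theorem proj_nsd_has_derivative:
  fixes a :: "'n::finite \<Rightarrow> real"
  assumes P: "orthogonal_matrix P" and a: "\<And>i. a i \<noteq> 0"
  shows "(proj_nsd has_derivative
      (\<lambda>H. conj_by P (schur (\<lambda>i j. divdiff_min (a i) (a j)) (conj_by (transpose P) H))))
      (at (conj_by P (diag_mat a)) within Sym)"
proof -
  define Z where "Z = conj_by P (diag_mat a)"
  define D where "D = (\<lambda>H. conj_by P (schur (\<lambda>i j. divdiff_min (a i) (a j)) (conj_by (transpose P) H)))"
  define ap where "ap = (\<lambda>i. max (a i) 0)"
  define am where "am = (\<lambda>i. min (a i) 0)"
  \<comment> \<open>\<open>wA\<close> and \<open>wC\<close> solve \<open>K D + D K^T = h\<close> on
    the blocks of equal sign. \<open>wS\<close> solves the mixed block, where both parts contribute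
    and the factor is the gap \<open>a j - a i\<close>.\<close>
  define wA where "wA = (\<lambda>i j. if 0 < a i \<and> 0 < a j then 1 / (2 * a j) else 0)"
  define wC where "wC = (\<lambda>i j. if a i < 0 \<and> a j < 0 then 1 / (2 * a j) else 0)"
  define wS where "wS = (\<lambda>i j. if a i < 0 \<and> 0 < a j then 1 / (a j - a i) else 0)"
  define lift where "lift = (\<lambda>w (y::real^'n^'n). schur w (conj_by (transpose P) (y - Z)))"
  define dl where "dl = (\<lambda>w (H::real^'n^'n). schur w (conj_by (transpose P) H))"
  define M where "M = (\<lambda>y. (mat 1 + lift wS y) ** (mat 1 + lift wA y))"
  define R where "R = (\<lambda>y. (mat 1 - transpose (lift wS y)) ** (mat 1 + lift wC y))"
  define A where "A = (\<lambda>y. conj_by P (M y ** diag_mat ap ** transpose (M y)))"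
  define B where "B = (\<lambda>y. conj_by P (R y ** diag_mat am ** transpose (R y)))"
  have a': "0 < a i \<or> a i < 0" for i using a[of i] by auto
  have lift_deriv [derivative_intros]: "(lift w has_derivative dl w) (at y)" for w y
    unfolding lift_def dl_def
    by (auto intro!: derivative_eq_intros bounded_linear.has_derivative[OF bounded_linear_schur]
        bounded_linear.has_derivative[OF bounded_linear_conj_by])
  have lift_Z [simp]: "lift w Z = 0" for w by (simp add: lift_def)
  have MZ [simp]: "M Z = mat 1" and RZ [simp]: "R Z = mat 1" by (simp_all add: M_def R_def)
  have M_deriv: "(M has_derivative (\<lambda>H. dl wA H + dl wS H)) (at Z)"
    unfolding M_def by (rule has_derivative_eq_rhs, (rule derivative_intros)+) simp
  have R_deriv: "(R has_derivative (\<lambda>H. dl wC H - transpose (dl wS H))) (at Z)"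
    unfolding R_def by (rule has_derivative_eq_rhs, (rule derivative_intros)+) simp
  define dA where "dA = (\<lambda>H. conj_by P (diag_mat ap ** transpose (dl wA H + dl wS H) + (dl wA H + dl wS H) ** diag_mat ap))"
  define dB where "dB = (\<lambda>H. conj_by P (diag_mat am ** transpose (dl wC H - transpose (dl wS H)) + (dl wC H - transpose (dl wS H)) ** diag_mat am))"
  have A_deriv: "(A has_derivative dA) (at Z)"
    unfolding A_def dA_def
    by (rule bounded_linear.has_derivative[OF bounded_linear_conj_by],
        rule has_derivative_eq_rhs, (rule derivative_intros M_deriv)+) simp
  have B_deriv: "(B has_derivative dB) (at Z)"
    unfolding B_def dB_def
    by (rule bounded_linear.has_derivative[OF bounded_linear_conj_by],
        rule has_derivative_eq_rhs, (rule derivative_intros R_deriv)+) simp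
  have AB_eq: "dA H + dB H = H" and B_eq: "dB H = D H" if H: "H \<in> Sym" for H
  proof -
    define h where "h = conj_by (transpose P) H"
    have h: "h $ i $ j = h $ j $ i" for i j by (intro Sym_nth) (simp add: h_def conj_by_Sym H)
    have Hh: "H = conj_by P h" by (simp add: h_def conj_by_inverse'[OF P])
    have nth: "dl w H $ i $ j = w i j * h $ i $ j" for w i j by (simp add: dl_def h_def)
    have "diag_mat ap ** transpose (dl wA H + dl wS H) + (dl wA H + dl wS H) ** diag_mat ap
       + (diag_mat am ** transpose (dl wC H - transpose (dl wS H)) + (dl wC H - transpose (dl wS H)) ** diag_mat am) = h"
    proof (simp only: vec_eq_iff, intro allI)
      fix i j
      have "h$j$i = h$i$j" by (rule h)
      with a'[of i] a'[of j] show "(diag_mat ap ** transpose (dl wA H + dl wS H) + (dl wA H + dl wS H) ** diag_mat ap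
       + (diag_mat am ** transpose (dl wC H - transpose (dl wS H)) + (dl wC H - transpose (dl wS H)) ** diag_mat am)) $ i $ j = h $ i $ j"
        by (auto simp: nth transpose_def wA_def wC_def wS_def ap_def am_def max_def min_def field_simps)
    qed
    then show "dA H + dB H = H" by (simp add: dA_def dB_def Hh flip: conj_by_add)
    have "diag_mat am ** transpose (dl wC H - transpose (dl wS H)) + (dl wC H - transpose (dl wS H)) ** diag_mat am
        = schur (\<lambda>i j. divdiff_min (a i) (a j)) h"
    proof (simp only: vec_eq_iff, intro allI)
      fix i j
      have "h$j$i = h$i$j" by (rule h)
      with a'[of i] a'[of j] show "(diag_mat am ** transpose (dl wC H - transpose (dl wS H)) + (dl wC H - transpose (dl wS H)) ** diag_mat am) $ i $ j
          = schur (\<lambda>i j. divdiff_min (a i) (a j)) h $ i $ j"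
        by (auto simp: nth transpose_def wA_def wC_def wS_def am_def min_def divdiff_min_def field_simps)
    qed
    then show "dB H = D H" by (simp add: dB_def D_def h_def)
  qed
  have projAB: "proj_nsd (A y + B y) = B y" for y
  proof (rule proj_nsd_eqI)
    show "A y \<in> psd" "B y \<in> nsd" unfolding A_def B_def
      by (intro conj_by_psd conj_by_nsd psd_congruence nsd_congruence diag_mat_psd diag_mat_nsd; simp add: ap_def am_def)+
    let ?S = "lift wS y"
    \<comment> \<open>\<open>S\<close> sends positive coordinates to negative ones and kills the
      latter; from \<open>S^2 = 0\<close> follows \<open>(I - S) (I + S) = I\<close>, which keeps
      the two parts orthogonal exactly and not only to first order.\<close>
    have SS: "?S ** ?S = 0"
      by (auto simp: vec_eq_iff matrix_matrix_mult_def lift_def wS_def intro!: sum.neutral)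
    have CA: "transpose (lift wC y) ** lift wA y = 0"
      by (auto simp: vec_eq_iff matrix_matrix_mult_def transpose_def lift_def wC_def wA_def intro!: sum.neutral)
    have CA': "diag_mat am ** transpose (lift wC y) ** diag_mat ap = 0"
      "diag_mat am ** lift wA y ** diag_mat ap = 0" "diag_mat am ** diag_mat ap = 0"
      by (auto simp: vec_eq_iff transpose_def lift_def wC_def wA_def am_def ap_def diag_mat_nth min_def max_def)
    have "transpose (R y) ** M y = (mat 1 + transpose (lift wC y)) ** ((mat 1 - ?S) ** (mat 1 + ?S)) ** (mat 1 + lift wA y)"
      by (simp add: R_def M_def matrix_transpose_mul transpose_add transpose_diff matrix_mul_assoc)
    also have "(mat 1 - ?S) ** (mat 1 + ?S) = mat 1"
      by (simp add: matrix_diff_rdistrib matrix_add_ldistrib SS)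
    finally have "diag_mat am ** (transpose (R y) ** M y) ** diag_mat ap = 0"
      by (simp add: matrix_add_rdistrib matrix_add_ldistrib CA CA')
    then have "(R y ** diag_mat am ** transpose (R y)) ** M y ** diag_mat ap = 0"
      by (metis matrix_mul_assoc matrix_mul_rzero)
    then have "(M y ** diag_mat ap ** transpose (M y)) \<bullet> (R y ** diag_mat am ** transpose (R y)) = 0"
      by (simp add: inner_mult_right[of "M y ** _"] inner_mult_right[of "M y"])
    then show "A y \<bullet> B y = 0" by (simp add: A_def B_def inner_conj_by[OF P])
  qed
  have "diag_mat ap + diag_mat am = diag_mat a"
    using nonneg_nonpos_split(1)[of a] by (simp add: ap_def am_def)
  moreover have "A Z + B Z = conj_by P (diag_mat ap + diag_mat am)"
    by (simp add: A_def B_def conj_by_add)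
  ultimately have ABZ: "A Z + B Z = Z" by (simp add: Z_def)
  have "(proj_nsd has_derivative D) (at Z within Sym)"
    unfolding has_derivative_within_alt
  proof (intro conjI allI impI)
    show "bounded_linear D" unfolding D_def
      by (intro bounded_linear_compose[OF bounded_linear_conj_by] bounded_linear_compose[OF bounded_linear_schur]
          bounded_linear_conj_by)
    fix e :: real assume "0 < e"
    then have e: "0 < e / 2" by simp
    have "((\<lambda>y. A y + B y) has_derivative (\<lambda>H. dA H + dB H)) (at Z)"
      by (intro derivative_intros A_deriv B_deriv)
    then obtain d1 where d1: "0 < d1" "\<And>y. norm (y - Z) < d1 \<Longrightarrow>
        norm (A y + B y - (A Z + B Z) - (dA (y - Z) + dB (y - Z))) \<le> e / 2 * norm (y - Z)"
      unfolding has_derivative_at_alt using e by blast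
    obtain d2 where d2: "0 < d2" "\<And>y. norm (y - Z) < d2 \<Longrightarrow>
        norm (B y - B Z - dB (y - Z)) \<le> e / 2 * norm (y - Z)"
      using B_deriv unfolding has_derivative_at_alt using e by blast
    show "\<exists>d>0. \<forall>y\<in>Sym. norm (y - Z) < d \<longrightarrow>
        norm (proj_nsd y - proj_nsd Z - D (y - Z)) \<le> e * norm (y - Z)"
    proof (intro exI[of _ "min d1 d2"] conjI ballI impI)
      show "0 < min d1 d2" using d1 d2 by simp
      fix y assume y: "y \<in> Sym" "norm (y - Z) < min d1 d2"
      have "Z \<in> Sym" unfolding Z_def by (intro conj_by_Sym) (simp add: Sym_def)
      then have yZ: "y - Z \<in> Sym" using y subspace_diff[OF subspace_Sym] by blast
      \<comment> \<open>\<open>dA + dB\<close> is the identity on symmetric matrices, so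
        \<open>A y + B y\<close> misses \<open>y\<close> by a small multiple of the step; this is
        half of the allowed error, the other half goes to the derivative of
        \<open>B\<close>.\<close>
      have "norm (proj_nsd y - proj_nsd (A y + B y)) \<le> norm (A y + B y - y)"
        using proj_nsd_lipschitz[of y "A y + B y"] by (simp add: norm_minus_commute)
      also have "\<dots> \<le> e / 2 * norm (y - Z)"
        using d1(2)[of y] y AB_eq[OF yZ] ABZ by (simp add: add_diff_eq)
      finally have 1: "norm (proj_nsd y - B y) \<le> e / 2 * norm (y - Z)" by (simp add: projAB)
      have 2: "norm (B y - B Z - D (y - Z)) \<le> e / 2 * norm (y - Z)"
        using d2(2)[of y] y B_eq[OF yZ] by simp
      have BZ: "proj_nsd Z = B Z" using projAB[of Z] ABZ by simp
      have "proj_nsd y - proj_nsd Z - D (y - Z) = (proj_nsd y - B y) + (B y - B Z - D (y - Z))"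
        by (simp add: BZ)
      then have "norm (proj_nsd y - proj_nsd Z - D (y - Z))
          \<le> norm (proj_nsd y - B y) + norm (B y - B Z - D (y - Z))"
        by (metis norm_triangle_ineq)
      with 1 2 show "norm (proj_nsd y - proj_nsd Z - D (y - Z)) \<le> e * norm (y - Z)"
        by (simp add: algebra_simps)
    qed
  qed
  then show ?thesis by (simp add: D_def Z_def)
qed

context complementary_pair
begin

text \<open>Perturbing the zero eigenvalues upwards selects the limiting Jacobian that vanishes on the
  block of zero eigenvalues.\<close>
lemma exists_B_subgradient:
  assumes \<rho>: "0 < \<rho>"
  obtains W where "W \<in> B_subdiff_proj_nsd (X + (1 / \<rho>) *\<^sub>R Y)"
    "\<And>H. H \<in> Sym \<Longrightarrow> pen H = 0 \<Longrightarrow> \<rho> * (H \<bullet> W H) \<le> - Upsilon X Y H"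
proof -
  define s where "s = (\<lambda>i. l i + m i / \<rho>)"
  define a where "a = (\<lambda>k i. s i + (if s i = 0 then 1 / real (Suc k) else 0))"
  define W where "W = (\<lambda>H. conj_by P (schur (\<lambda>i j. divdiff_min (s i) (s j)) (co H)))"
  have "diag_mat s = diag_mat l + (1 / \<rho>) *\<^sub>R diag_mat m"
    by (simp add: vec_eq_iff diag_mat_nth s_def)
  then have Z: "X + (1 / \<rho>) *\<^sub>R Y = conj_by P (diag_mat s)"
    by (simp add: X_def Y_def conj_by_add conj_by_scaleR)
  have t0: "(\<lambda>k. 1 / real (Suc k)) \<longlonglongrightarrow> 0" using LIMSEQ_Suc[OF lim_1_over_n[where 'a=real]] by simp
  have a_lim: "(\<lambda>k. a k i) \<longlonglongrightarrow> s i" for i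
    unfolding a_def using tendsto_add[OF tendsto_const[of "s i"] t0] by (cases "s i = 0") auto
  have a_ne: "a k i \<noteq> 0" for k i by (auto simp: a_def)
  have a_neg: "a k i < 0 \<longleftrightarrow> s i < 0" for k i by (auto simp: a_def not_less add_nonneg_nonneg)
  \<comment> \<open>By \<open>a_neg\<close> the sign pattern does not depend on \<open>k\<close>, so
    each divided difference stays in one branch, where it is continuous.\<close>
  have dd_lim: "(\<lambda>k. divdiff_min (a k i) (a k j)) \<longlonglongrightarrow> divdiff_min (s i) (s j)" for i j
    unfolding divdiff_min_def a_neg by (auto intro!: tendsto_intros a_lim)
  have "W \<in> B_subdiff_proj_nsd (X + (1 / \<rho>) *\<^sub>R Y)"
    unfolding B_subdiff_proj_nsd_def mem_Collect_eq Z
  proof (intro exI conjI allI ballI)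
    fix k
    show "conj_by P (diag_mat (a k)) \<in> Sym" by (intro conj_by_Sym) (simp add: Sym_def)
    show "(proj_nsd has_derivative (\<lambda>k H. conj_by P (schur (\<lambda>i j. divdiff_min (a k i) (a k j)) (co H))) k)
      (at (conj_by P (diag_mat (a k))) within Sym)"
      by (rule proj_nsd_has_derivative[OF P a_ne])
  next
    show "(\<lambda>k. conj_by P (diag_mat (a k))) \<longlonglongrightarrow> conj_by P (diag_mat s)"
      by (intro bounded_linear.tendsto[OF bounded_linear_conj_by] vec_tendstoI)
        (auto simp: diag_mat_nth intro!: a_lim)
  next
    fix H :: "real^'n^'n"
    show "(\<lambda>k. conj_by P (schur (\<lambda>i j. divdiff_min (a k i) (a k j)) (co H))) \<longlonglongrightarrow> W H"
      unfolding W_def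
      by (intro bounded_linear.tendsto[OF bounded_linear_conj_by] vec_tendstoI)
        (auto intro!: tendsto_intros dd_lim)
  qed
  moreover have "\<rho> * (H \<bullet> W H) \<le> - Upsilon X Y H" if H: "H \<in> Sym" and pen: "pen H = 0" for H
  proof -
    define h where "h = co H"
    have h: "h $ i $ j = h $ j $ i" for i j by (intro Sym_nth) (simp add: h_def conj_by_Sym H)
    have z: "h$i$j = 0" if "l i = 0" "m j < 0" for i j using pen that by (auto simp: pen_eq_0_iff h_def)
    have "\<rho> * (H \<bullet> W H) = \<rho> * (h \<bullet> schur (\<lambda>i j. divdiff_min (s i) (s j)) h)"
      by (simp add: W_def inner_conj_by_swap[of P, symmetric] inner_commute h_def)
        (simp add: inner_commute inner_conj_by_swap)
    also have "\<dots> = (\<Sum>i\<in>UNIV. \<Sum>j\<in>UNIV. \<rho> * divdiff_min (s i) (s j) * (h$i$j)\<^sup>2)"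
      by (simp add: inner_matrix_eq sum_distrib_left power2_eq_square mult_ac)
    \<comment> \<open>The divided differences are symmetric, whereas the sigma-term counts a mixed
      pair at one position only; its factor 2 restores the balance, so pairs are compared.\<close>
    also have "\<dots> \<le> (\<Sum>i\<in>UNIV. \<Sum>j\<in>UNIV. - (2 * (m j * (h$i$j)\<^sup>2 / l i)))"
    proof (rule sum_sym_mono)
      fix i j
      \<comment> \<open>The Jacobian weight has denominator \<open>l i - m j / \<rho>\<close>,
        larger than the \<open>l i\<close> of the sigma-term.\<close>
      have key: "\<rho> * (m j / \<rho> / (m j / \<rho> - l i)) \<le> - (m j / l i)" if "0 < l i" "m j < 0" for i j
      proof -
        have "\<rho> * (m j / \<rho> / (m j / \<rho> - l i)) = - m j / (l i - m j / \<rho>)"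
        proof -
          have "\<rho> * (m j / \<rho> / (m j / \<rho> - l i)) = m j / (m j / \<rho> - l i)" using \<rho> by simp
          also have "\<dots> = - m j / (l i - m j / \<rho>)" by (metis minus_diff_eq minus_divide_divide)
          finally show ?thesis .
        qed
        also have "\<dots> \<le> - m j / l i"
        proof (rule divide_left_mono)
          have "m j / \<rho> < 0" using that \<rho> by (simp add: divide_neg_pos)
          then show "l i \<le> l i - m j / \<rho>" "0 < (l i - m j / \<rho>) * l i" using that by auto
        qed (use that in simp)
        finally show ?thesis by simp
      qed
      have cs: "(0 < l i \<and> m i = 0) \<or> (l i = 0 \<and> m i < 0) \<or> (l i = 0 \<and> m i = 0)" for i
        using l[of i] m[of i] lm[of i] by auto
      have hs: "h$j$i = h$i$j" by (rule h)
      have neg: "m i / \<rho> < 0 \<longleftrightarrow> m i < 0" for i using \<rho> by (simp add: divide_less_0_iff)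
      have hkey: "2 * (\<rho> * (m j / \<rho> / (m j / \<rho> - l i)) * c) \<le> - (2 * (m j * c / l i))"
        if "0 < l i" "m j < 0" "0 \<le> c" for i j c
        using mult_right_mono[OF key[OF that(1,2)] that(3)] by simp
      show "\<rho> * divdiff_min (s i) (s j) * (h$i$j)\<^sup>2 + \<rho> * divdiff_min (s j) (s i) * (h$j$i)\<^sup>2
        \<le> - (2 * (m j * (h$i$j)\<^sup>2 / l i)) + - (2 * (m i * (h$j$i)\<^sup>2 / l j))"
        using cs[of i] cs[of j]
      proof (elim disjE conjE)
        assume *: "0 < l i" "m i = 0" "l j = 0" "m j < 0"
        then show ?thesis using hkey[OF *(1,4), of "(h$i$j)\<^sup>2"] \<rho>
          by (simp add: s_def divdiff_min_def neg hs not_less)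
      next
        assume *: "l i = 0" "m i < 0" "0 < l j" "m j = 0"
        then show ?thesis using hkey[OF *(3,2), of "(h$i$j)\<^sup>2"] \<rho>
          by (simp add: s_def divdiff_min_def neg hs not_less)
      qed (use z[of i j] z[of j i] \<rho> in \<open>auto simp: s_def divdiff_min_def neg hs\<close>)
    qed
    also have "\<dots> = - Upsilon X Y H"
      unfolding Upsilon_XY[OF H] h_def by (simp add: sum_negf sum_distrib_left)
    finally show ?thesis .
  qed
  ultimately show ?thesis by (rule that)
qed

end

section \<open>Lower bounds for B-subgradients\<close>

context complementary_pair
begin

lemma lower_scaleR: "lower r (t *\<^sub>R H) = t\<^sup>2 * lower r H"
proof -
  have "Upsilon X Y (t *\<^sub>R H) = t\<^sup>2 * Upsilon X Y H"
    by (simp add: Upsilon_def matrix_scaleR_left matrix_scaleR_right power2_eq_square)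
  then show ?thesis
    by (simp add: lower_def pen_scaleR power_mult_distrib algebra_simps)
qed

text \<open>Using the lower bound at both end points of \<open>[A, B]\<close> and adding the two inequalities
  turns it into a monotonicity estimate for the projection.\<close>
lemma proj_nsd_monotone_lower:
  assumes \<rho>: "0 < \<rho>" and e: "0 < e"
  obtains \<delta> where "0 < \<delta>" "\<And>A B. A \<in> Sym \<Longrightarrow> B \<in> Sym \<Longrightarrow>
      dist A (X + (1 / \<rho>) *\<^sub>R Y) < \<delta> \<Longrightarrow> dist B (X + (1 / \<rho>) *\<^sub>R Y) < \<delta> \<Longrightarrow>
      2 * (lower \<rho> (B - A) - e * (norm (B - A))\<^sup>2) \<le> \<rho> * ((proj_nsd B - proj_nsd A) \<bullet> (B - A))"
proof -
  obtain \<eta> where \<eta>: "0 < \<eta>" and lb: "\<And>X' Y' X'' H. X' \<in> psd \<Longrightarrow> Y' \<in> nsd \<Longrightarrow> X'' \<in> psd \<Longrightarrow> H \<in> Sym \<Longrightarrow>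
      X' \<bullet> Y' = 0 \<Longrightarrow> norm (X' - X) < \<eta> \<Longrightarrow> norm (Y' - Y) < \<eta> \<Longrightarrow> norm H < \<eta> \<Longrightarrow>
      lower \<rho> H - e * (norm H)\<^sup>2 \<le> - (Y' \<bullet> X'') + \<rho> / 2 * (norm (X'' - X' - H))\<^sup>2"
    using second_order_lower_bound[OF \<rho> e] by meson
  let ?Z = "X + (1 / \<rho>) *\<^sub>R Y"
  have pZ: "proj_nsd ?Z = (1 / \<rho>) *\<^sub>R Y"
    using \<rho> XY by (intro proj_nsd_eqI X_psd nsd_scaleR Y_nsd) auto
  \<comment> \<open>The half serves the two quantities made of two displacements; the division by
    \<open>\<rho>\<close> serves the multiplier \<open>\<rho> proj_nsd A\<close>.\<close>
  define \<delta> where "\<delta> = min (\<eta> / 2) (\<eta> / \<rho>)"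
  have \<delta>: "0 < \<delta>" "2 * \<delta> \<le> \<eta>" "\<rho> * \<delta> \<le> \<eta>"
    using \<eta> \<rho> by (auto simp: \<delta>_def min_def field_simps)
  \<comment> \<open>The bound is used for the Moreau parts of \<open>A\<close> and \<open>B\<close>
    with \<open>H = B - A\<close>; the defect of the linearisation is then minus the difference of
    the projections.\<close>
  have half: "lower \<rho> (B - A) - e * (norm (B - A))\<^sup>2
      \<le> - ((\<rho> *\<^sub>R proj_nsd A) \<bullet> (B - proj_nsd B)) + \<rho> / 2 * (norm (proj_nsd B - proj_nsd A))\<^sup>2"
    if A: "A \<in> Sym" "dist A ?Z < \<delta>" and B: "B \<in> Sym" "dist B ?Z < \<delta>" for A B
  proof -
    have pA: "norm (proj_nsd A - (1 / \<rho>) *\<^sub>R Y) \<le> dist A ?Z"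
      using proj_nsd_lipschitz[of A ?Z] by (simp add: pZ dist_norm)
    have "A - proj_nsd A - X = (A - ?Z) - (proj_nsd A - (1 / \<rho>) *\<^sub>R Y)" by simp
    then have "norm (A - proj_nsd A - X) \<le> dist A ?Z + norm (proj_nsd A - (1 / \<rho>) *\<^sub>R Y)"
      unfolding dist_norm by (metis norm_triangle_ineq4)
    then have 1: "norm (A - proj_nsd A - X) < \<eta>" using pA A \<delta> by linarith
    have "\<rho> *\<^sub>R proj_nsd A - Y = \<rho> *\<^sub>R (proj_nsd A - (1 / \<rho>) *\<^sub>R Y)" using \<rho> by (simp add: algebra_simps)
    then have "norm (\<rho> *\<^sub>R proj_nsd A - Y) = \<rho> * norm (proj_nsd A - (1 / \<rho>) *\<^sub>R Y)" using \<rho> by simp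
    also have "\<dots> < \<rho> * \<delta>" using pA A \<rho> by simp
    finally have 2: "norm (\<rho> *\<^sub>R proj_nsd A - Y) < \<eta>" using \<delta> by simp
    have "dist B A \<le> dist B ?Z + dist A ?Z" by (rule dist_triangle2)
    then have 3: "norm (B - A) < \<eta>" using A B \<delta> by (simp add: dist_norm)
    have "B - proj_nsd B - (A - proj_nsd A) - (B - A) = - (proj_nsd B - proj_nsd A)" by simp
    then have 4: "norm (B - proj_nsd B - (A - proj_nsd A) - (B - A)) = norm (proj_nsd B - proj_nsd A)"
      by (simp only: norm_minus_cancel)
    have "lower \<rho> (B - A) - e * (norm (B - A))\<^sup>2 \<le> - ((\<rho> *\<^sub>R proj_nsd A) \<bullet> (B - proj_nsd B))
        + \<rho> / 2 * (norm (B - proj_nsd B - (A - proj_nsd A) - (B - A)))\<^sup>2"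
      using A B \<rho> diff_proj_nsd_orthogonal[OF A(1)]
      by (intro lb psd_diff_proj_nsd nsd_scaleR proj_nsd_in subspace_diff subspace_Sym 1 2 3) auto
    then show ?thesis unfolding 4 .
  qed
  show ?thesis
  proof (rule that[OF \<delta>(1)])
    fix A B :: "real^'n^'n"
    assume AB: "A \<in> Sym" "B \<in> Sym" "dist A ?Z < \<delta>" "dist B ?Z < \<delta>"
    have "lower \<rho> (A - B) = lower \<rho> (B - A)" using lower_scaleR[of \<rho> "-1" "B - A"] by simp
    then have "2 * (lower \<rho> (B - A) - e * (norm (B - A))\<^sup>2)
      \<le> - ((\<rho> *\<^sub>R proj_nsd A) \<bullet> (B - proj_nsd B)) - ((\<rho> *\<^sub>R proj_nsd B) \<bullet> (A - proj_nsd A))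
        + \<rho> * (norm (proj_nsd B - proj_nsd A))\<^sup>2"
      using half[OF AB(1,3,2,4)] half[OF AB(2,4,1,3)] by (simp add: norm_minus_commute)
    also have "\<dots> = \<rho> * ((proj_nsd B - proj_nsd A) \<bullet> (B - A))"
    proof -
      have "a \<bullet> (A - a) = 0 \<Longrightarrow> b \<bullet> (B - b) = 0 \<Longrightarrow>
        - ((\<rho> *\<^sub>R a) \<bullet> (B - b)) - ((\<rho> *\<^sub>R b) \<bullet> (A - a)) + \<rho> * (norm (b - a))\<^sup>2 = \<rho> * ((b - a) \<bullet> (B - A))"
        for a b :: "real^'n^'n"
        by (simp add: power2_norm_eq_inner inner_diff_left inner_diff_right inner_commute algebra_simps)
      from this[of "proj_nsd A" "proj_nsd B"] show ?thesis
        using diff_proj_nsd_orthogonal[OF AB(1)] diff_proj_nsd_orthogonal[OF AB(2)]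
        by (simp add: inner_commute)
    qed
    finally show "2 * (lower \<rho> (B - A) - e * (norm (B - A))\<^sup>2) \<le> \<rho> * ((proj_nsd B - proj_nsd A) \<bullet> (B - A))" .
  qed
qed

text \<open>Along \<open>Zk k + t H\<close> both sides of the monotonicity estimate are of order
  \<open>t^2\<close>; dividing and letting \<open>t\<close> tend to 0 bounds the Jacobian at
  \<open>Zk k\<close>. The bound passes to the limit in \<open>k\<close>, and \<open>e\<close> is
  arbitrary.\<close>

lemma B_subgradient_lower:
  assumes \<rho>: "0 < \<rho>" and W: "W \<in> B_subdiff_proj_nsd (X + (1 / \<rho>) *\<^sub>R Y)" and H: "H \<in> Sym"
  shows "2 * lower \<rho> H \<le> \<rho> * (H \<bullet> W H)"
proof (rule field_le_epsilon)
  fix e' :: real assume "0 < e'"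
  \<comment> \<open>Chosen so that \<open>2 * e * (norm H)^2\<close> stays below \<open>e'\<close>;
    the added 1 covers \<open>H = 0\<close>.\<close>
  define e where "e = e' / (2 * (norm H)\<^sup>2 + 1)"
  have e: "0 < e" using \<open>0 < e'\<close> by (simp add: e_def add_nonneg_pos)
  let ?Z = "X + (1 / \<rho>) *\<^sub>R Y"
  obtain Zk Wk where Zk: "\<And>k. Zk k \<in> Sym" and deriv: "\<And>k. (proj_nsd has_derivative Wk k) (at (Zk k) within Sym)"
    and Zk_lim: "Zk \<longlonglongrightarrow> ?Z" and Wk_lim: "(\<lambda>k. Wk k H) \<longlonglongrightarrow> W H"
    using W H unfolding B_subdiff_proj_nsd_def by blast
  obtain \<delta> where \<delta>: "0 < \<delta>" and mono: "\<And>A B. A \<in> Sym \<Longrightarrow> B \<in> Sym \<Longrightarrow>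
      dist A ?Z < \<delta> \<Longrightarrow> dist B ?Z < \<delta> \<Longrightarrow>
      2 * (lower \<rho> (B - A) - e * (norm (B - A))\<^sup>2) \<le> \<rho> * ((proj_nsd B - proj_nsd A) \<bullet> (B - A))"
    using proj_nsd_monotone_lower[OF \<rho> e] by metis
  let ?c = "2 * (lower \<rho> H - e * (norm H)\<^sup>2)"
  have bound: "?c \<le> \<rho> * (Wk k H \<bullet> H)" if near: "dist (Zk k) ?Z < \<delta>" for k
  proof -
    let ?p = "\<lambda>t. Zk k + t *\<^sub>R H"
    have pSym: "?p t \<in> Sym" for t using Zk H by (intro subspace_add subspace_scale subspace_Sym) auto
    have "(?p has_derivative (\<lambda>t. t *\<^sub>R H)) (at 0)" by (auto intro!: derivative_eq_intros)
    then have "((\<lambda>t. proj_nsd (?p t)) has_derivative (\<lambda>t. Wk k (t *\<^sub>R H))) (at 0)"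
      using has_derivative_in_compose2[of UNIV proj_nsd] deriv[of k] pSym
      by (intro has_derivative_in_compose[where g = proj_nsd and f = ?p, unfolded o_def])
        (auto intro: has_derivative_subset)
    then have "((\<lambda>t. proj_nsd (?p t) \<bullet> H) has_derivative (\<lambda>t. t * (Wk k H \<bullet> H))) (at 0)"
      using has_derivative_inner_left linear_cmul[OF has_derivative_linear[OF deriv[of k]]] by fastforce
    then have "DERIV (\<lambda>t. proj_nsd (?p t) \<bullet> H) 0 :> Wk k H \<bullet> H"
      by (simp add: has_field_derivative_def mult_commute_abs)
    then have "((\<lambda>t. (proj_nsd (?p t) \<bullet> H - proj_nsd (Zk k) \<bullet> H) / t) \<longlongrightarrow> Wk k H \<bullet> H) (at 0)"
      by (simp add: DERIV_def)
    then have lim: "((\<lambda>t. \<rho> * ((proj_nsd (?p t) \<bullet> H - proj_nsd (Zk k) \<bullet> H) / t)) \<longlongrightarrow> \<rho> * (Wk k H \<bullet> H)) (at 0)"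
      by (intro tendsto_intros)
    have "(?p \<longlongrightarrow> ?p 0) (at 0)" by (intro tendsto_intros)
    then have "eventually (\<lambda>t. dist (?p t) ?Z < \<delta>) (at 0)"
      using near by (intro order_tendstoD(2)[of "\<lambda>t. dist (?p t) ?Z" "dist (Zk k) ?Z"]) (auto intro!: tendsto_eq_intros)
    moreover have "eventually (\<lambda>t::real. t \<noteq> 0) (at 0)" by (rule eventually_neq_at_within)
    ultimately have "eventually (\<lambda>t. ?c \<le> \<rho> * ((proj_nsd (?p t) \<bullet> H - proj_nsd (Zk k) \<bullet> H) / t)) (at 0)"
    proof eventually_elim
      case (elim t)
      have "2 * (lower \<rho> (t *\<^sub>R H) - e * (norm (t *\<^sub>R H))\<^sup>2) \<le> \<rho> * ((proj_nsd (?p t) - proj_nsd (Zk k)) \<bullet> (t *\<^sub>R H))"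
        using mono[OF Zk[of k] pSym[of t] near elim(1)] by simp
      then have "t\<^sup>2 * ?c \<le> \<rho> * (t * (proj_nsd (?p t) \<bullet> H - proj_nsd (Zk k) \<bullet> H))"
        by (simp add: lower_scaleR power_mult_distrib inner_diff_left algebra_simps)
      also have "\<dots> = t\<^sup>2 * (\<rho> * ((proj_nsd (?p t) \<bullet> H - proj_nsd (Zk k) \<bullet> H) / t))"
        using elim(2) by (simp add: power2_eq_square)
      finally show ?case by (rule mult_left_le_imp_le) (use elim(2) in simp)
    qed
    with lim show ?thesis by (intro tendsto_lowerbound[OF lim]) auto
  qed
  have "eventually (\<lambda>k. dist (Zk k) ?Z < \<delta>) sequentially" using Zk_lim \<delta> by (rule tendstoD)
  then have "eventually (\<lambda>k. ?c \<le> \<rho> * (Wk k H \<bullet> H)) sequentially" by eventually_elim (rule bound)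
  moreover have "(\<lambda>k. \<rho> * (Wk k H \<bullet> H)) \<longlonglongrightarrow> \<rho> * (W H \<bullet> H)" by (intro tendsto_intros Wk_lim)
  ultimately have "?c \<le> \<rho> * (W H \<bullet> H)" by (intro tendsto_lowerbound) auto
  moreover have "2 * e * (norm H)\<^sup>2 \<le> e'"
  proof -
    have "2 * e * (norm H)\<^sup>2 = e' * (2 * (norm H)\<^sup>2 / (2 * (norm H)\<^sup>2 + 1))" by (simp add: e_def)
    also have "\<dots> \<le> e' * 1" using \<open>0 < e'\<close> by (intro mult_left_mono) (auto simp: divide_le_eq_1 add_nonneg_pos)
    finally show ?thesis by simp
  qed
  ultimately show "2 * lower \<rho> H \<le> \<rho> * (H \<bullet> W H) + e'" by (simp add: inner_commute algebra_simps)
qed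

end

section \<open>Second order condition and uniform positive definiteness\<close>

context sdp
begin

definition uniform_pd :: bool where
  "uniform_pd \<longleftrightarrow> (\<exists>\<rho>0>0. \<exists>\<eta>>0. \<forall>\<rho>\<ge>\<rho>0. \<forall>W \<in> B_subdiff_proj_nsd (G xb + (1 / \<rho>) *\<^sub>R Y).
     \<forall>d. d \<bullet> (Lxx f G xb Y d + \<rho> *\<^sub>R adjoint (frechet_derivative G (at xb))
                                (W (frechet_derivative G (at xb) d))) \<ge> \<eta> * (norm d)\<^sup>2)"

lemma inner_augmented_hessian:
  "d \<bullet> (Lxx f G xb Y d + \<rho> *\<^sub>R adjoint (frechet_derivative G (at xb)) (W (frechet_derivative G (at xb) d)))
    = q Y xb d + \<rho> * (G1 xb d \<bullet> W (G1 xb d))"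
proof -
  have "linear (blinfun_apply (G1 xb))" by (intro bounded_linear.linear blinfun.bounded_linear_right)
  from adjoint_works[OF this, of d "W (G1 xb d)"] show ?thesis
    by (simp add: frechet_G inner_add_right inner_Lxx)
qed

text \<open>Forward, a single \<open>\<rho>\<close> and one B-subgradient dominated by the
  sigma-term suffice. Backward, \<open>2 * lower\<close> bounds all B-subgradients at once, so the
  constants of \<open>ssosc_uniform\<close> serve directly.\<close>

theorem uniform_pd_iff_ssosc: "uniform_pd \<longleftrightarrow> ssosc"
proof
  assume uniform_pd
  then obtain \<rho> \<eta> where \<rho>: "0 < \<rho>" and \<eta>: "0 < \<eta>" and
    pd: "\<And>W d. W \<in> B_subdiff_proj_nsd (X + (1 / \<rho>) *\<^sub>R Y) \<Longrightarrow> \<eta> * (norm d)\<^sup>2 \<le> q Y xb d + \<rho> * (G1 xb d \<bullet> W (G1 xb d))"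
    unfolding uniform_pd_def inner_augmented_hessian G_xb by blast
  obtain W where W: "W \<in> B_subdiff_proj_nsd (X + (1 / \<rho>) *\<^sub>R Y)"
    "\<And>H. H \<in> Sym \<Longrightarrow> pen H = 0 \<Longrightarrow> \<rho> * (H \<bullet> W H) \<le> - Upsilon X Y H"
    using exists_B_subgradient[OF \<rho>] by blast
  show ssosc unfolding ssosc_def
  proof (intro allI impI)
    fix d assume d: "d \<noteq> 0 \<and> pen (G1 xb d) = 0"
    then have "0 < \<eta> * (norm d)\<^sup>2" using \<eta> by simp
    also have "\<dots> \<le> q Y xb d - Upsilon X Y (G1 xb d)"
      using pd[OF W(1), of d] W(2)[OF G1_Sym, of xb d] d by simp
    finally show "0 < q Y xb d - Upsilon X Y (G1 xb d)" .
  qed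
next
  assume ssosc
  then obtain r0 \<mu> where r0: "0 < r0" "0 < \<mu>" and lb: 
    "\<And>r d. r0 \<le> r \<Longrightarrow> \<mu> * (norm d)\<^sup>2 \<le> q Y xb d / 2 + lower r (G1 xb d)"
    using ssosc_uniform by metis
  show uniform_pd unfolding uniform_pd_def inner_augmented_hessian G_xb
  
  proof (rule exI[of _ r0], intro conjI r0(1), rule exI[of _ \<mu>], intro conjI r0(2) allI impI ballI)
    fix \<rho> W d assume \<rho>: "r0 \<le> \<rho>" and W: "W \<in> B_subdiff_proj_nsd (X + (1 / \<rho>) *\<^sub>R Y)"
    have "2 * lower \<rho> (G1 xb d) \<le> \<rho> * (G1 xb d \<bullet> W (G1 xb d))"
      using B_subgradient_lower[OF _ W G1_Sym] \<rho> r0 by simp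
    moreover have "0 \<le> \<mu> * (norm d)\<^sup>2" using r0 by simp
    ultimately show "\<mu> * (norm d)\<^sup>2 \<le> q Y xb d + \<rho> * (G1 xb d \<bullet> W (G1 xb d))"
      using lb[OF \<rho>, of d] by linarith
  qed
qed

end

subsection \<open>Variational strong convexity\<close>

lemma lim_subgrad_regular: "v \<in> regular_subgrad E \<phi> z \<Longrightarrow> v \<in> lim_subgrad E \<phi> z"
  unfolding lim_subgrad_def mem_Collect_eq
  by (intro conjI, (simp add: regular_subgrad_def)+, rule exI[of _ "\<lambda>_. z"], rule exI[of _ "\<lambda>_. v"]) simp

lemma lim_subgrad_in:
  assumes "closed E" "v \<in> lim_subgrad E \<phi> z"
  shows "v \<in> E" "z \<in> E" "\<bar>\<phi> z\<bar> \<noteq> \<infinity>"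
proof -
  obtain zk vk where "\<And>k. vk k \<in> regular_subgrad E \<phi> (zk k)" "(vk :: nat \<Rightarrow> _) \<longlonglongrightarrow> v"
    using assms(2) unfolding lim_subgrad_def by blast
  then show "v \<in> E" using closed_sequentially[OF assms(1), of vk v] by (auto simp: regular_subgrad_def)
  show "z \<in> E" "\<bar>\<phi> z\<bar> \<noteq> \<infinity>" using assms(2) by (auto simp: lim_subgrad_def)
qed

text \<open>The approximating sequences eventually enter the open sets, and convergence of the
  function values is part of the limiting subgradient; hence quadratic estimates need proof for
  regular subgradients only.\<close>

lemma lim_subgrad_bound:
  fixes \<phi> :: "'v::real_inner \<Rightarrow> ereal"
  assumes "open A" "open B" "z \<in> A" "v \<in> B" "v \<in> lim_subgrad E \<phi> z"
    and bound: "\<And>z v. z \<in> A \<Longrightarrow> v \<in> B \<Longrightarrow> v \<in> regular_subgrad E \<phi> z \<Longrightarrow>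
      \<phi> z + ereal (v \<bullet> (z' - z) + c * (norm (z' - z))\<^sup>2) \<le> \<phi> z'"
  shows "\<phi> z + ereal (v \<bullet> (z' - z) + c * (norm (z' - z))\<^sup>2) \<le> \<phi> z'"
proof -
  have fin: "\<bar>\<phi> z\<bar> \<noteq> \<infinity>" and ex: "\<exists>(zk :: nat \<Rightarrow> 'v) vk. (\<forall>k. vk k \<in> regular_subgrad E \<phi> (zk k)) \<and>
         zk \<longlonglongrightarrow> z \<and> (\<lambda>k. \<phi> (zk k)) \<longlonglongrightarrow> \<phi> z \<and> vk \<longlonglongrightarrow> v"
    using assms(5)[unfolded lim_subgrad_def mem_Collect_eq, THEN conjunct2] by - (erule conjunct1, erule conjunct2)
  then obtain zk vk where sub: "\<forall>k. vk k \<in> regular_subgrad E \<phi> (zk k)" and zk: "zk \<longlonglongrightarrow> z"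
    and \<phi>k: "(\<lambda>k. \<phi> (zk k)) \<longlonglongrightarrow> \<phi> z" and vk: "(vk :: nat \<Rightarrow> _) \<longlonglongrightarrow> v"
    by (elim exE conjE)
  have "eventually (\<lambda>k. zk k \<in> A) sequentially" "eventually (\<lambda>k. vk k \<in> B) sequentially"
    using topological_tendstoD[OF zk assms(1,3)] topological_tendstoD[OF vk assms(2,4)] .
  then have "eventually (\<lambda>k. \<phi> (zk k) + ereal (vk k \<bullet> (z' - zk k) + c * (norm (z' - zk k))\<^sup>2) \<le> \<phi> z') sequentially"
    by eventually_elim (intro bound sub[rule_format])
  moreover have "(\<lambda>k. \<phi> (zk k) + ereal (vk k \<bullet> (z' - zk k) + c * (norm (z' - zk k))\<^sup>2)) \<longlonglongrightarrow>
      \<phi> z + ereal (v \<bullet> (z' - z) + c * (norm (z' - z))\<^sup>2)"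
    by (intro tendsto_add_ereal fin \<phi>k tendsto_ereal tendsto_intros zk vk) auto
  ultimately show ?thesis by (intro tendsto_upperbound) auto
qed

text \<open>On the segment to \<open>z'\<close> the local subgradient inequality meets the strong
  convexity inequality; dividing by \<open>t\<close> makes the former global.\<close>

lemma regular_subgrad_strongly_convex:
  fixes \<psi> :: "'v::real_inner \<Rightarrow> ereal"
  assumes E: "subspace E" and proper: "proper_on E \<psi>" and \<mu>: "0 < \<mu>"
    and conv: "\<And>x y t. x \<in> E \<Longrightarrow> y \<in> E \<Longrightarrow> 0 \<le> t \<Longrightarrow> t \<le> 1 \<Longrightarrow> \<psi> (t *\<^sub>R x + (1 - t) *\<^sub>R y) \<le>
        ereal t * \<psi> x + ereal (1 - t) * \<psi> y - ereal (\<mu> / 2 * t * (1 - t) * (norm (x - y))\<^sup>2)"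
    and v: "v \<in> regular_subgrad E \<psi> z" and z': "z' \<in> E"
  shows "\<psi> z + ereal (v \<bullet> (z' - z) + \<mu> / 2 * (norm (z' - z))\<^sup>2) \<le> \<psi> z'"
proof (cases "\<psi> z' = \<infinity>")
  case False
  then obtain b where b: "\<psi> z' = ereal b" using proper z' unfolding proper_on_def by (cases "\<psi> z'") auto
  obtain a where a: "\<psi> z = ereal a" using v unfolding regular_subgrad_def by (cases "\<psi> z") auto
  have z: "z \<in> E" using v by (simp add: regular_subgrad_def)
  define n where "n = norm (z' - z)"
  have n: "0 \<le> n" by (simp add: n_def)
  have key: "v \<bullet> (z' - z) - e * n + \<mu> / 2 * (1 - e) * n\<^sup>2 \<le> b - a" if e: "0 < e" for e
  proof -
    obtain \<delta> where \<delta>: "0 < \<delta>" and sub: "\<And>w. w \<in> E \<Longrightarrow> norm (w - z) < \<delta> \<Longrightarrow>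
        \<psi> z + ereal (v \<bullet> (w - z) - e * norm (w - z)) \<le> \<psi> w"
      using v e unfolding regular_subgrad_def by blast
    \<comment> \<open>\<open>t \<le> e\<close> ties both limits to one parameter; the last bound
      keeps the point within \<open>\<delta>\<close>, also for \<open>n = 0\<close>.\<close>
    define t where "t = min (min 1 e) (\<delta> / (n + 1))"
    have t: "0 < t" "t \<le> 1" "t \<le> e" using e \<delta> n by (auto simp: t_def)
    have "t * n \<le> \<delta> / (n + 1) * n" using n by (intro mult_right_mono) (auto simp: t_def)
    also have "\<dots> < \<delta>" using \<delta> n by (simp add: field_simps)
    finally have tn: "t * n < \<delta>" .
    let ?w = "t *\<^sub>R z' + (1 - t) *\<^sub>R z"
    have w: "?w - z = t *\<^sub>R (z' - z)" by (simp add: algebra_simps)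
    have nw: "norm (?w - z) = t * n" unfolding w n_def using t by simp
    have "?w \<in> E" using E z z' by (intro subspace_add subspace_scale)
    from sub[OF this] have 1: "ereal (a + (t * (v \<bullet> (z' - z)) - e * (t * n))) \<le> \<psi> ?w"
      unfolding nw using tn by (simp add: a w)
    have "\<psi> ?w \<le> ereal (t * b + (1 - t) * a - \<mu> / 2 * t * (1 - t) * n\<^sup>2)"
      using conv[OF z' z, of t] t by (simp add: a b n_def)
    from order_trans[OF 1 this]
    have "t * (v \<bullet> (z' - z) - e * n + \<mu> / 2 * (1 - t) * n\<^sup>2) \<le> t * (b - a)"
      by (simp add: algebra_simps)
    then have "v \<bullet> (z' - z) - e * n + \<mu> / 2 * (1 - t) * n\<^sup>2 \<le> b - a" using t by simp
    moreover have "\<mu> / 2 * (1 - e) * n\<^sup>2 \<le> \<mu> / 2 * (1 - t) * n\<^sup>2"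
      using t \<mu> by (intro mult_right_mono mult_left_mono) auto
    ultimately show ?thesis by linarith
  qed
  have "((\<lambda>e. v \<bullet> (z' - z) - e * n + \<mu> / 2 * (1 - e) * n\<^sup>2) \<longlongrightarrow> v \<bullet> (z' - z) - 0 * n + \<mu> / 2 * (1 - 0) * n\<^sup>2) (at_right 0)"
    by (intro tendsto_intros)
  moreover have "eventually (\<lambda>e. v \<bullet> (z' - z) - e * n + \<mu> / 2 * (1 - e) * n\<^sup>2 \<le> b - a) (at_right 0)"
    using eventually_at_right_less[of 0] by eventually_elim (rule key)
  ultimately have "v \<bullet> (z' - z) - 0 * n + \<mu> / 2 * (1 - 0) * n\<^sup>2 \<le> b - a"
    by (rule tendsto_upperbound) simp
  then show ?thesis by (simp add: a b n_def)
qed simp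

lemma lim_subgrad_strongly_convex:
  fixes \<psi> :: "'v::real_inner \<Rightarrow> ereal"
  assumes E: "subspace E" and proper: "proper_on E \<psi>" and sc: "strongly_convex_on E \<psi>"
  obtains \<mu> where "0 < \<mu>" "\<And>z v z'. v \<in> lim_subgrad E \<psi> z \<Longrightarrow> z' \<in> E \<Longrightarrow>
    \<psi> z + ereal (v \<bullet> (z' - z) + \<mu> * (norm (z' - z))\<^sup>2) \<le> \<psi> z'"
proof -
  obtain \<mu> where \<mu>: "0 < \<mu>" and conv: "\<And>x y t. x \<in> E \<Longrightarrow> y \<in> E \<Longrightarrow> 0 \<le> t \<Longrightarrow> t \<le> 1 \<Longrightarrow> \<psi> (t *\<^sub>R x + (1 - t) *\<^sub>R y) \<le>
        ereal t * \<psi> x + ereal (1 - t) * \<psi> y - ereal (\<mu> / 2 * t * (1 - t) * (norm (x - y))\<^sup>2)"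
    using sc unfolding strongly_convex_on_def by blast
  show ?thesis
  proof (rule that[of "\<mu> / 2"])
    show "0 < \<mu> / 2" using \<mu> by simp
    fix z v z' assume sub: "v \<in> lim_subgrad E \<psi> z" and z': "z' \<in> E"
    show "\<psi> z + ereal (v \<bullet> (z' - z) + \<mu> / 2 * (norm (z' - z))\<^sup>2) \<le> \<psi> z'"
      by (rule lim_subgrad_bound[OF open_UNIV open_UNIV UNIV_I UNIV_I sub])
        (rule regular_subgrad_strongly_convex[OF E proper \<mu> conv _ z'])
  qed
qed

text \<open>The convex minorant is the supremum of the quadratics supplied by the growth condition.
  Its subdifferential cannot be larger near the reference point: a subgradient \<open>v\<close> at \<open>z\<close> is also a
  subgradient at a local minimiser of \<open>\<phi> - \<langle>v, \<cdot>\<rangle>\<close>, and strong monotonicity identifies the two points.\<close>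
theorem var_strongly_convexI:
  fixes \<phi> :: "'v::euclidean_space \<Rightarrow> ereal"
  assumes E: "subspace E" and \<kappa>: "0 < \<kappa>" and \<delta>: "0 < \<delta>" and vb: "vb \<in> lim_subgrad E \<phi> zb"
    and growth: "\<And>z v z'. z \<in> ball zb \<delta> \<Longrightarrow> v \<in> ball vb \<delta> \<Longrightarrow> v \<in> lim_subgrad E \<phi> z \<Longrightarrow>
      z' \<in> E \<Longrightarrow> z' \<in> ball zb \<delta> \<Longrightarrow> \<phi> z + ereal (v \<bullet> (z' - z) + \<kappa> * (norm (z' - z))\<^sup>2) \<le> \<phi> z'"
    and minimizer: "\<And>v. \<exists>z \<in> E \<inter> cball zb (\<delta> / 2). \<bar>\<phi> z\<bar> \<noteq> \<infinity> \<and>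
      (\<forall>z' \<in> E \<inter> cball zb (\<delta> / 2). \<phi> z + ereal (v \<bullet> (z' - z)) \<le> \<phi> z')"
  shows "var_strongly_convex E \<phi> zb vb"
proof -
  have clE: "closed E" by (rule closed_subspace[OF E])
  define S where "S = {(z, v). z \<in> ball zb \<delta> \<and> v \<in> ball vb \<delta> \<and> v \<in> lim_subgrad E \<phi> z}"
  define quad where "quad s y = real_of_ereal (\<phi> (fst s)) + (snd s \<bullet> (y - fst s) + \<kappa> * (norm (y - fst s))\<^sup>2)" for s y
  define \<psi> where "\<psi> y = (SUP s\<in>S. ereal (quad s y))" for y
  have quad_\<phi>: "ereal (quad (z, v) y) = \<phi> z + ereal (v \<bullet> (y - z) + \<kappa> * (norm (y - z))\<^sup>2)"
    if "v \<in> lim_subgrad E \<phi> z" for z v y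
    using lim_subgrad_in(3)[OF clE that] by (auto simp: quad_def ereal_real)
  have sb: "(zb, vb) \<in> S" using vb \<delta> by (simp add: S_def)
  have quad_le: "ereal (quad s y) \<le> \<psi> y" if "s \<in> S" for s y
    unfolding \<psi>_def using that by (rule SUP_upper)
  have \<psi>_le: "\<psi> y \<le> \<phi> y" if "y \<in> E" "y \<in> ball zb \<delta>" for y
    unfolding \<psi>_def
  proof (rule SUP_least)
    fix s assume "s \<in> S"
    then obtain z v where s: "s = (z, v)" "z \<in> ball zb \<delta>" "v \<in> ball vb \<delta>" "v \<in> lim_subgrad E \<phi> z"
      unfolding S_def by blast
    show "ereal (quad s y) \<le> \<phi> y" unfolding s(1) quad_\<phi>[OF s(4)] by (rule growth[OF s(2-4) that])
  qed
  have \<psi>_eq: "\<psi> z = \<phi> z" if "(z, v) \<in> S" for z v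
  proof (rule antisym)
    have s: "v \<in> lim_subgrad E \<phi> z" "z \<in> ball zb \<delta>" using that by (auto simp: S_def)
    show "\<psi> z \<le> \<phi> z" using \<psi>_le[OF lim_subgrad_in(2)[OF clE s(1)] s(2)] .
    show "\<phi> z \<le> \<psi> z" using quad_le[OF that, of z] quad_\<phi>[OF s(1), of z] by simp
  qed
  have \<psi>_not_MInf: "\<psi> y \<noteq> -\<infinity>" for y using quad_le[OF sb, of y] by auto
  have proper: "proper_on E \<psi>"
    unfolding proper_on_def
    using \<psi>_not_MInf \<psi>_eq[OF sb] lim_subgrad_in[OF clE vb] by (intro conjI bexI[of _ zb]) auto
  \<comment> \<open>All these quadratics share the leading part \<open>\<kappa> |y|^2\<close>, so
    their modulus survives the supremum.\<close>
  have quad_conv: "quad s (t *\<^sub>R x + (1 - t) *\<^sub>R y) = t * quad s x + (1 - t) * quad s y - \<kappa> * t * (1 - t) * (norm (x - y))\<^sup>2"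
    for s x y t
    unfolding quad_def power2_norm_eq_inner
    by (simp add: inner_diff_left inner_diff_right inner_add_left inner_add_right inner_commute algebra_simps)
  have sconv: "strongly_convex_on E \<psi>"
    unfolding strongly_convex_on_def
  proof (intro exI[of _ "2 * \<kappa>"] conjI ballI allI impI)
    fix x y and t :: real assume t: "0 \<le> t \<and> t \<le> 1"
    show "\<psi> (t *\<^sub>R x + (1 - t) *\<^sub>R y) \<le> ereal t * \<psi> x + ereal (1 - t) * \<psi> y
        - ereal (2 * \<kappa> / 2 * t * (1 - t) * (norm (x - y))\<^sup>2)"
      unfolding \<psi>_def[of "t *\<^sub>R x + (1 - t) *\<^sub>R y"]
    proof (rule SUP_least)
      fix s assume s: "s \<in> S"
      have "ereal (quad s (t *\<^sub>R x + (1 - t) *\<^sub>R y)) = ereal t * ereal (quad s x) + ereal (1 - t) * ereal (quad s y)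
          - ereal (2 * \<kappa> / 2 * t * (1 - t) * (norm (x - y))\<^sup>2)"
        by (simp add: quad_conv)
      also have "\<dots> \<le> ereal t * \<psi> x + ereal (1 - t) * \<psi> y - ereal (2 * \<kappa> / 2 * t * (1 - t) * (norm (x - y))\<^sup>2)"
        using t s by (intro ereal_minus_mono add_mono ereal_mult_left_mono quad_le) auto
      finally show "ereal (quad s (t *\<^sub>R x + (1 - t) *\<^sub>R y)) \<le> ereal t * \<psi> x + ereal (1 - t) * \<psi> y
          - ereal (2 * \<kappa> / 2 * t * (1 - t) * (norm (x - y))\<^sup>2)" .
    qed
  qed (use \<kappa> in simp)
  have "closed {(x, t::real). x \<in> E \<and> \<psi> x \<le> ereal t}"
  proof -
    have "{(x, t::real). x \<in> E \<and> \<psi> x \<le> ereal t} = (E \<times> UNIV) \<inter> (\<Inter>s\<in>S. {p. quad s (fst p) \<le> snd p})"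
      unfolding \<psi>_def by (auto simp: SUP_le_iff)
    moreover have "closed {p. quad s (fst p) \<le> snd p}" for s
      unfolding quad_def by (intro closed_Collect_le continuous_intros)
    ultimately show ?thesis by (auto intro!: closed_Int closed_Times closed_INT clE)
  qed
  then have closed_fun: "closed_fun_on E \<psi>" by (simp add: closed_fun_on_def)
  have sub_\<psi>: "v \<in> lim_subgrad E \<psi> z" if "(z, v) \<in> S" for z v
  proof (rule lim_subgrad_regular)
    have v: "v \<in> lim_subgrad E \<phi> z" using that by (simp add: S_def)
    note inE = lim_subgrad_in[OF clE v]
    show "v \<in> regular_subgrad E \<psi> z" unfolding regular_subgrad_def mem_Collect_eq
    proof (intro conjI allI impI)
      show "v \<in> E" "z \<in> E" "\<bar>\<psi> z\<bar> \<noteq> \<infinity>" using inE \<psi>_eq[OF that] by auto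
      fix \<epsilon> :: real assume "0 < \<epsilon>"
      show "\<exists>\<delta>>0. \<forall>z'\<in>E. norm (z' - z) < \<delta> \<longrightarrow> \<psi> z + ereal (v \<bullet> (z' - z) - \<epsilon> * norm (z' - z)) \<le> \<psi> z'"
      proof (intro exI[of _ 1] conjI ballI impI)
        fix z' assume "z' \<in> E"
        have "- (\<epsilon> * norm (z' - z)) \<le> 0" "0 \<le> \<kappa> * (norm (z' - z))\<^sup>2" using \<kappa> \<open>0 < \<epsilon>\<close> by auto
        then have "\<psi> z + ereal (v \<bullet> (z' - z) - \<epsilon> * norm (z' - z)) \<le> \<phi> z + ereal (v \<bullet> (z' - z) + \<kappa> * (norm (z' - z))\<^sup>2)"
          unfolding \<psi>_eq[OF that] by (intro add_left_mono) simp
        also have "\<dots> \<le> \<psi> z'" using quad_le[OF that, of z'] quad_\<phi>[OF v, of z'] by simp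
        finally show "\<psi> z + ereal (v \<bullet> (z' - z) - \<epsilon> * norm (z' - z)) \<le> \<psi> z'" .
      qed simp
    qed
  qed
  obtain \<mu> where \<mu>: "0 < \<mu>" and \<psi>_growth: "\<And>z v z'. v \<in> lim_subgrad E \<psi> z \<Longrightarrow> z' \<in> E \<Longrightarrow>
      \<psi> z + ereal (v \<bullet> (z' - z) + \<mu> * (norm (z' - z))\<^sup>2) \<le> \<psi> z'"
    using lim_subgrad_strongly_convex[OF E proper sconv] by metis
  \<comment> \<open>Growth at \<open>zb\<close> and minimality of \<open>y\<close> give
    \<open>\<kappa> |y - zb| \<le> |v - vb|\<close>; this radius puts the minimiser strictly inside
    the half ball, where constrained minimality is local minimality.\<close>
  define \<eta> where "\<eta> = min \<delta> (\<kappa> * \<delta> / 2)"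
  have \<eta>: "0 < \<eta>" "\<eta> \<le> \<delta>" "\<eta> \<le> \<kappa> * \<delta> / 2" using \<delta> \<kappa> by (auto simp: \<eta>_def)
  have converse: "(z, v) \<in> S" if v: "v \<in> ball vb \<eta>" and sub: "v \<in> lim_subgrad E \<psi> z" for z v
  proof -
    obtain y where y': "y \<in> E \<inter> cball zb (\<delta> / 2)" and fin: "\<bar>\<phi> y\<bar> \<noteq> \<infinity>" and
      min': "\<forall>z' \<in> E \<inter> cball zb (\<delta> / 2). \<phi> y + ereal (v \<bullet> (z' - y)) \<le> \<phi> z'"
      using minimizer[of v] by (elim bexE conjE)
    have y: "y \<in> E" "y \<in> cball zb (\<delta> / 2)" using y' by auto
    have min: "\<phi> y + ereal (v \<bullet> (z' - y)) \<le> \<phi> z'" if "z' \<in> E" "z' \<in> cball zb (\<delta> / 2)" for z'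
      using min' that by (meson IntI)
    have y\<delta>: "y \<in> ball zb \<delta>" using y \<delta> by simp
    have inE: "zb \<in> E" "\<bar>\<phi> zb\<bar> \<noteq> \<infinity>" using lim_subgrad_in[OF clE vb] by auto
    have "norm (y - zb) < \<delta> / 2"
    proof (cases "y = zb")
      case False
      have 1: "\<phi> zb + ereal (vb \<bullet> (y - zb) + \<kappa> * (norm (y - zb))\<^sup>2) \<le> \<phi> y"
        using growth[OF _ _ vb y(1) y\<delta>] \<delta> by simp
      have 2: "\<phi> y + ereal (v \<bullet> (zb - y)) \<le> \<phi> zb" using min[OF inE(1)] \<delta> by simp
      obtain a b where ab: "\<phi> zb = ereal a" "\<phi> y = ereal b" using fin inE(2) by (metis ereal_infinity_cases abs_ereal.elims ereal_real)
      have "\<kappa> * (norm (y - zb))\<^sup>2 \<le> (v - vb) \<bullet> (y - zb)"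
        using 1 2 unfolding ab by (simp add: inner_diff_left inner_diff_right)
      also have "\<dots> \<le> norm (v - vb) * norm (y - zb)" by (rule norm_cauchy_schwarz)
      finally have "\<kappa> * norm (y - zb) \<le> norm (v - vb)" using False by (simp add: power2_eq_square)
      also have "\<dots> < \<kappa> * (\<delta> / 2)" using v \<eta> by (simp add: dist_norm norm_minus_commute)
      finally show ?thesis using \<kappa> by simp
    qed (use \<delta> in simp)
    then have room: "0 < \<delta> / 2 - norm (y - zb)" by simp
    have vE: "v \<in> E" by (rule lim_subgrad_in[OF clE sub])
    have "v \<in> regular_subgrad E \<phi> y" unfolding regular_subgrad_def mem_Collect_eq
    proof (intro conjI allI impI vE y fin)
      fix \<epsilon> :: real assume "0 < \<epsilon>"
      show "\<exists>\<delta>>0. \<forall>z'\<in>E. norm (z' - y) < \<delta> \<longrightarrow> \<phi> y + ereal (v \<bullet> (z' - y) - \<epsilon> * norm (z' - y)) \<le> \<phi> z'"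
      proof (intro exI[of _ "\<delta> / 2 - norm (y - zb)"] conjI ballI impI room)
        fix z' assume z': "z' \<in> E" "norm (z' - y) < \<delta> / 2 - norm (y - zb)"
        have "norm (z' - zb) \<le> norm (z' - y) + norm (y - zb)" by (rule norm_diff_triangle_ineq[of z' y y zb, simplified])
        then have "z' \<in> cball zb (\<delta> / 2)" using z' by (simp add: dist_norm norm_minus_commute)
        have "\<phi> y + ereal (v \<bullet> (z' - y) - \<epsilon> * norm (z' - y)) \<le> \<phi> y + ereal (v \<bullet> (z' - y))"
          using \<open>0 < \<epsilon>\<close> by (intro add_left_mono) simp
        also have "\<dots> \<le> \<phi> z'" by (rule min) fact+
        finally show "\<phi> y + ereal (v \<bullet> (z' - y) - \<epsilon> * norm (z' - y)) \<le> \<phi> z'" .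
      qed
    qed
    then have yS: "(y, v) \<in> S" using y\<delta> v \<eta> by (simp add: S_def lim_subgrad_regular)
    have 1: "\<psi> y + ereal (v \<bullet> (z - y) + \<mu> * (norm (z - y))\<^sup>2) \<le> \<psi> z"
      by (rule \<psi>_growth[OF sub_\<psi>[OF yS] lim_subgrad_in(2)[OF clE sub]])
    have 2: "\<psi> z + ereal (v \<bullet> (y - z) + \<mu> * (norm (y - z))\<^sup>2) \<le> \<psi> y"
      by (rule \<psi>_growth[OF sub y(1)])
    have "\<bar>\<psi> z\<bar> \<noteq> \<infinity>" "\<bar>\<psi> y\<bar> \<noteq> \<infinity>" using lim_subgrad_in(3)[OF clE sub] fin \<psi>_eq[OF yS] by auto
    then obtain a b where ab: "\<psi> z = ereal a" "\<psi> y = ereal b" by (metis ereal_real)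
    have "\<mu> * (norm (y - z))\<^sup>2 \<le> 0"
      using 1 2 unfolding ab by (simp add: inner_diff_right norm_minus_commute)
    then have "y = z" using \<mu> by (simp add: mult_le_0_iff)
    with yS show ?thesis by simp
  qed
  have S_iff: "(z, v) \<in> S \<longleftrightarrow> z \<in> ball zb \<delta> \<and> v \<in> ball vb \<delta> \<and> v \<in> lim_subgrad E \<phi> z" for z v
    by (simp add: S_def)
  have sub: "v \<in> ball vb \<delta>" if "v \<in> ball vb \<eta>" for v using that \<eta> by simp
  have "v \<in> lim_subgrad E \<psi> z \<longleftrightarrow> v \<in> lim_subgrad E \<phi> z" if "z \<in> ball zb \<delta>" "v \<in> ball vb \<eta>" for z v
    using converse[OF that(2), of z] sub_\<psi>[of z v] S_iff[of z v] sub[OF that(2)] that(1) by argo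
  then have gph: "{(z, v). z \<in> ball zb \<delta> \<inter> E \<and> v \<in> ball vb \<eta> \<and> v \<in> lim_subgrad E \<psi> z} =
      {(z, v). z \<in> ball zb \<delta> \<inter> E \<and> v \<in> ball vb \<eta> \<and> v \<in> lim_subgrad E \<phi> z}"
    by (intro Collect_cong) (auto simp del: mem_ball)
  have eq: "\<forall>z v. z \<in> ball zb \<delta> \<inter> E \<and> v \<in> ball vb \<eta> \<and> v \<in> lim_subgrad E \<phi> z \<longrightarrow> \<psi> z = \<phi> z"
    using \<psi>_eq S_iff sub by (meson IntD1)
  show ?thesis unfolding var_strongly_convex_def
    by (rule conjI[OF vb], rule exI[of _ "ball zb \<delta>"], rule exI[of _ "ball vb \<eta>"], rule exI[of _ \<psi>],
        intro conjI open_ball convex_ball proper closed_fun sconv gph eq ballI)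
      (use \<delta> \<eta> in \<open>auto intro: \<psi>_le\<close>)
qed

subsection \<open>The function \<open>\<phi>\<^sub>r\<close>\<close>

lemma phi_r_feasible: "G x + U \<in> psd \<Longrightarrow> phi_r f G r (x, U) = ereal (f x + r / 2 * (norm U)\<^sup>2)"
  and phi_r_infeasible: "G x + U \<notin> psd \<Longrightarrow> phi_r f G r (x, U) = \<infinity>"
  by (simp_all add: phi_r_def ind_def)

text \<open>The subgradient inequality gives \<open>p d \<le> D d\<close> to first order in every
  direction; the directions \<open>d\<close> and \<open>-d\<close> together force equality.\<close>

lemma regular_subgrad_differentiable:
  fixes \<Psi> :: "'a::real_inner \<Rightarrow> real"
  assumes D: "(\<Psi> has_derivative D) (at x)"
    and lb: "\<And>e. 0 < e \<Longrightarrow> \<exists>\<delta>>0. \<forall>y. norm (y - x) < \<delta> \<longrightarrow> \<Psi> x + p \<bullet> (y - x) - e * norm (y - x) \<le> \<Psi> y"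
  shows "D d = p \<bullet> d"
proof -
  have ge: "p \<bullet> d \<le> D d" for d
  proof (rule field_le_epsilon)
    fix e :: real assume "0 < e"
    define N where "N = norm d + 1"
    define e' where "e' = e / 2 / N"
    have N: "0 < N" "norm d \<le> N" by (simp_all add: N_def add_nonneg_pos)
    have e': "0 < e'" using \<open>0 < e\<close> N by (simp add: e'_def)
    obtain \<delta>1 where \<delta>1: "0 < \<delta>1" "\<And>y. norm (y - x) < \<delta>1 \<Longrightarrow> \<Psi> x + p \<bullet> (y - x) - e' * norm (y - x) \<le> \<Psi> y"
      using lb[OF e'] by blast
    obtain \<delta>2 where \<delta>2: "0 < \<delta>2" "\<And>y. norm (y - x) < \<delta>2 \<Longrightarrow> norm (\<Psi> y - \<Psi> x - D (y - x)) \<le> e' * norm (y - x)"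
      using D e' unfolding has_derivative_at_alt by blast
    define t where "t = min \<delta>1 \<delta>2 / 2 / N"
    have t: "0 < t" using \<delta>1 \<delta>2 N by (simp add: t_def)
    have "t * norm d < min \<delta>1 \<delta>2"
    proof -
      have "t * norm d \<le> t * N" using t N by simp
      also have "\<dots> = min \<delta>1 \<delta>2 / 2" using N by (simp add: t_def)
      also have "\<dots> < min \<delta>1 \<delta>2" using \<delta>1(1) \<delta>2(1) by (simp add: min_def)
      finally show ?thesis .
    qed
    then have n: "norm (x + t *\<^sub>R d - x) < \<delta>1" "norm (x + t *\<^sub>R d - x) < \<delta>2" using t by simp_all
    have "D (t *\<^sub>R d) = t * D d" using linear_cmul[OF has_derivative_linear[OF D]] by simp
    then have "\<Psi> (x + t *\<^sub>R d) - \<Psi> x - t * D d \<le> e' * (t * norm d)"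
      using \<delta>2(2)[OF n(2)] t by simp
    moreover have "\<Psi> x + t * (p \<bullet> d) - e' * (t * norm d) \<le> \<Psi> (x + t *\<^sub>R d)"
      using \<delta>1(2)[OF n(1)] t by simp
    ultimately have "t * (p \<bullet> d) \<le> t * (D d + 2 * e' * norm d)" by (simp add: algebra_simps)
    then have "p \<bullet> d \<le> D d + 2 * e' * norm d" using t by simp
    also have "2 * e' * norm d \<le> e"
    proof -
      have "2 * e' * norm d = e * (norm d / N)" by (simp add: e'_def)
      also have "\<dots> \<le> e * 1" using \<open>0 < e\<close> N by (intro mult_left_mono) (auto simp: divide_le_eq_1)
      finally show ?thesis by simp
    qed
    finally show "p \<bullet> d \<le> D d + e" by simp
  qed
  have "D (- d) = - D d" using linear_neg[OF has_derivative_linear[OF D]] .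
  with ge[of d] ge[of "- d"] show ?thesis by simp
qed

context c2_problem
begin

abbreviation "E \<equiv> (UNIV :: 'a set) \<times> (Sym :: (real^'n^'n) set)"

lemma subspace_E: "subspace E"
  using subspace_Times[OF subspace_UNIV subspace_Sym] .

text \<open>Two families of test points: moving \<open>U\<close> with \<open>x\<close> fixed shows
  that \<open>s - r U\<close> is normal to the cone at \<open>G x + U\<close>; moving
  \<open>x\<close> while \<open>U\<close> compensates so that \<open>G x + U\<close> is constant
  leaves a smooth unconstrained function with gradient \<open>p\<close>.\<close>

lemma regular_subgrad_phi_r:
  assumes v: "(p, s) \<in> regular_subgrad E (phi_r f G r) (x, U)"
  shows "U \<in> Sym" "G x + U \<in> psd" "s - r *\<^sub>R U \<in> nsd" "(G x + U) \<bullet> (s - r *\<^sub>R U) = 0"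
    "p \<bullet> d = f1 x d + (s - r *\<^sub>R U) \<bullet> G1 x d"
proof -
  define Z where "Z = G x + U"
  define V where "V = s - r *\<^sub>R U"
  have s: "s \<in> Sym" and U: "U \<in> Sym" and fin: "\<bar>phi_r f G r (x, U)\<bar> \<noteq> \<infinity>"
    using v by (auto simp: regular_subgrad_def)
  have Z: "Z \<in> psd" using fin phi_r_infeasible[of G x U f r] unfolding Z_def by (cases "G x + U \<in> psd") auto
  have V: "V \<in> Sym" unfolding V_def using s U by (intro subspace_diff subspace_scale subspace_Sym)
  have sub: "\<exists>\<delta>>0. \<forall>x' U'. U' \<in> Sym \<longrightarrow> G x' + U' \<in> psd \<longrightarrow> norm (x' - x, U' - U) < \<delta> \<longrightarrow>
      f x + r / 2 * (norm U)\<^sup>2 + (p \<bullet> (x' - x) + s \<bullet> (U' - U)) - e * norm (x' - x, U' - U)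
        \<le> f x' + r / 2 * (norm U')\<^sup>2" if e: "0 < e" for e
  proof -
    obtain \<delta> where \<delta>: "0 < \<delta>" and *: "\<And>z'. z' \<in> E \<Longrightarrow> norm (z' - (x, U)) < \<delta> \<Longrightarrow>
        phi_r f G r (x, U) + ereal ((p, s) \<bullet> (z' - (x, U)) - e * norm (z' - (x, U))) \<le> phi_r f G r z'"
      using v e unfolding regular_subgrad_def by blast
    show ?thesis
    proof (intro exI[of _ \<delta>] conjI \<delta> allI impI)
      fix x' U' assume "U' \<in> Sym" "G x' + U' \<in> psd" "norm (x' - x, U' - U) < \<delta>"
      then show "f x + r / 2 * (norm U)\<^sup>2 + (p \<bullet> (x' - x) + s \<bullet> (U' - U)) - e * norm (x' - x, U' - U)
        \<le> f x' + r / 2 * (norm U')\<^sup>2"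
        using *[of "(x', U')"] Z by (simp add: phi_r_feasible Z_def add_diff_eq)
    qed
  qed
  have normal: "V \<bullet> D \<le> 0" if D: "D \<in> Sym" and feas: "\<And>t. 0 < t \<Longrightarrow> t \<le> 1 \<Longrightarrow> Z + t *\<^sub>R D \<in> psd" for D
  proof (rule field_le_epsilon)
    fix e :: real assume "0 < e"
    define e' where "e' = e / 2 / (norm D + 1)"
    have pos: "0 < norm D + 1" by (simp add: add_nonneg_pos)
    have e': "0 < e'" using \<open>0 < e\<close> pos by (simp add: e'_def)
    obtain \<delta> where \<delta>: "0 < \<delta>" and *: "\<And>x' U'. U' \<in> Sym \<Longrightarrow> G x' + U' \<in> psd \<Longrightarrow> norm (x' - x, U' - U) < \<delta> \<Longrightarrow>
      f x + r / 2 * (norm U)\<^sup>2 + (p \<bullet> (x' - x) + s \<bullet> (U' - U)) - e' * norm (x' - x, U' - U)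
        \<le> f x' + r / 2 * (norm U')\<^sup>2"
      using sub[OF e'] by blast
    have ev: "eventually (\<lambda>t. V \<bullet> D \<le> r / 2 * t * (norm D)\<^sup>2 + e' * norm D) (at_right 0)"
      unfolding eventually_at_right_field
    proof (intro exI[of _ "min 1 (\<delta> / (norm D + 1))"] conjI allI impI)
      show "0 < min 1 (\<delta> / (norm D + 1))" using \<delta> pos by simp
      fix t assume t: "0 < t" "t < min 1 (\<delta> / (norm D + 1))"
      then have "t * norm D \<le> t * (norm D + 1)" "t * (norm D + 1) < \<delta>" using pos by (auto simp: pos_less_divide_eq)
      then have "t * norm D < \<delta>" by linarith
      moreover have "G x + (U + t *\<^sub>R D) \<in> psd" using feas[of t] t by (simp add: Z_def add.assoc)
      moreover have "U + t *\<^sub>R D \<in> Sym" using U D by (intro subspace_add subspace_scale subspace_Sym)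
      ultimately have "r / 2 * (norm U)\<^sup>2 + t * (s \<bullet> D) - e' * (t * norm D) \<le> r / 2 * (norm (U + t *\<^sub>R D))\<^sup>2"
        using *[of "U + t *\<^sub>R D" x] t by (simp add: norm_Pair)
      also have "(norm (U + t *\<^sub>R D))\<^sup>2 = (norm U)\<^sup>2 + 2 * t * (U \<bullet> D) + t\<^sup>2 * (norm D)\<^sup>2"
        unfolding power2_norm_eq_inner by (simp add: inner_add_left inner_add_right inner_commute power2_eq_square algebra_simps)
      finally have "t * (V \<bullet> D) \<le> t * (r / 2 * t * (norm D)\<^sup>2 + e' * norm D)"
        by (simp add: V_def inner_diff_left power2_eq_square algebra_simps)
      then show "V \<bullet> D \<le> r / 2 * t * (norm D)\<^sup>2 + e' * norm D" using t by simp
    qed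
    have "((\<lambda>t. r / 2 * t * (norm D)\<^sup>2 + e' * norm D) \<longlongrightarrow> r / 2 * 0 * (norm D)\<^sup>2 + e' * norm D) (at_right 0)"
      by (intro tendsto_intros)
    then have "V \<bullet> D \<le> r / 2 * 0 * (norm D)\<^sup>2 + e' * norm D"
      by (rule tendsto_lowerbound[OF _ ev]) simp
    also have "\<dots> = e / 2 * (norm D / (norm D + 1))" by (simp add: e'_def)
    also have "\<dots> \<le> e / 2 * 1" using \<open>0 < e\<close> pos by (intro mult_left_mono) (auto simp: divide_le_eq_1)
    finally show "V \<bullet> D \<le> 0 + e" using \<open>0 < e\<close> by simp
  qed
  have VZ: "Z \<bullet> V = 0"
  proof (rule antisym)
    have "V \<bullet> Z \<le> 0" using Z by (intro normal psd_subset_Sym psd_add psd_scaleR) auto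
    then show "Z \<bullet> V \<le> 0" by (simp add: inner_commute)
    \<comment> \<open>A cone contains the segment from \<open>Z\<close> towards 0, so
      \<open>- Z\<close> is feasible for \<open>t \<le> 1\<close>; with the direction
      \<open>Z\<close> this yields equality.\<close>
    have "V \<bullet> (- Z) \<le> 0"
    proof (rule normal)
      show "- Z \<in> Sym" using psd_subset_Sym[OF Z] subspace_neg[OF subspace_Sym] by blast
      fix t :: real assume "0 < t" "t \<le> 1"
      then have "(1 - t) *\<^sub>R Z \<in> psd" by (intro psd_scaleR Z) simp
      then show "Z + t *\<^sub>R (- Z) \<in> psd" by (simp add: algebra_simps)
    qed
    then show "0 \<le> Z \<bullet> V" by (simp add: inner_commute)
  qed
  have "V \<in> nsd" unfolding nsd_def mem_Collect_eq
  proof (intro conjI allI)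
    show "transpose V = V" using V by (simp add: Sym_def)
    fix u :: "real^'n"
    \<comment> \<open>The rank one matrix \<open>u u^T\<close> turns the normality condition into
      the quadratic form of \<open>V\<close> at \<open>u\<close>.\<close>
    define D where "D = (\<chi> i j. u$i * u$j)"
    have Dw: "w \<bullet> (D *v w) = (u \<bullet> w)\<^sup>2" for w
      by (simp add: D_def inner_vec_def matrix_vector_mult_def power2_eq_square sum_product sum_distrib_left mult_ac)
    have Dpsd: "D \<in> psd" unfolding psd_def mem_Collect_eq Dw by (simp add: D_def transpose_def vec_eq_iff)
    have "u \<bullet> (V *v u) = V \<bullet> D"
      by (simp add: D_def inner_vec_def matrix_vector_mult_def sum_distrib_left mult_ac)
    also have "\<dots> \<le> 0" using Dpsd Z by (intro normal psd_subset_Sym psd_add psd_scaleR) auto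
    finally show "u \<bullet> (V *v u) \<le> 0" .
  qed
  then show "U \<in> Sym" "G x + U \<in> psd" "s - r *\<^sub>R U \<in> nsd" "(G x + U) \<bullet> (s - r *\<^sub>R U) = 0"
    using U Z VZ by (simp_all add: Z_def V_def)
  define \<Psi> where "\<Psi> y = f y + r / 2 * ((Z - G y) \<bullet> (Z - G y)) - s \<bullet> (Z - G y)" for y
  have "(\<Psi> has_derivative (\<lambda>d. f1 x d + r / 2 * ((Z - G x) \<bullet> (- G1 x d) + (- G1 x d) \<bullet> (Z - G x)) - s \<bullet> (- G1 x d))) (at x)"
    unfolding \<Psi>_def by (auto intro!: derivative_eq_intros f1 G1)
  then have \<Psi>_deriv: "(\<Psi> has_derivative (\<lambda>d. f1 x d + V \<bullet> G1 x d)) (at x)"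
    by (rule has_derivative_eq_rhs)
      (auto simp: Z_def V_def inner_diff_left inner_commute algebra_simps)
  have "f1 x d + V \<bullet> G1 x d = p \<bullet> d"
  proof (rule regular_subgrad_differentiable[OF \<Psi>_deriv])
    fix e :: real assume "0 < e"
    \<comment> \<open>Lipschitz constant of the compensated path: 1 for \<open>y\<close>, 1 for the
      linearisation error of \<open>G\<close> and \<open>norm (G1 x)\<close> for its linear
      part.\<close>
    define C where "C = 2 + norm (G1 x)"
    have C: "0 < C" by (simp add: C_def add_pos_nonneg)
    have eC: "0 < e / C" using \<open>0 < e\<close> C by simp
    obtain \<delta> where \<delta>: "0 < \<delta>" and *: "\<And>x' U'. U' \<in> Sym \<Longrightarrow> G x' + U' \<in> psd \<Longrightarrow> norm (x' - x, U' - U) < \<delta> \<Longrightarrow>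
      f x + r / 2 * (norm U)\<^sup>2 + (p \<bullet> (x' - x) + s \<bullet> (U' - U)) - e / C * norm (x' - x, U' - U)
        \<le> f x' + r / 2 * (norm U')\<^sup>2"
      using sub[OF eC] by blast
    obtain \<delta>' where \<delta>': "0 < \<delta>'" "\<And>y. norm (y - x) < \<delta>' \<Longrightarrow> norm (G y - G x - G1 x (y - x)) \<le> 1 * norm (y - x)"
      using G1[of x] unfolding has_derivative_at_alt using zero_less_one by blast
    show "\<exists>\<delta>>0. \<forall>y. norm (y - x) < \<delta> \<longrightarrow> \<Psi> x + p \<bullet> (y - x) - e * norm (y - x) \<le> \<Psi> y"
    proof (intro exI[of _ "min \<delta>' (\<delta> / C)"] conjI allI impI)
      show "0 < min \<delta>' (\<delta> / C)" using \<delta> \<delta>' C by simp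
      fix y assume y: "norm (y - x) < min \<delta>' (\<delta> / C)"
      let ?U' = "Z - G y"
      have U': "?U' \<in> Sym" using psd_subset_Sym[OF Z] G_Sym by (intro subspace_diff subspace_Sym)
      have "norm (?U' - U) = norm (G y - G x)" by (simp add: Z_def norm_minus_commute)
      also have "G y - G x = (G y - G x - G1 x (y - x)) + G1 x (y - x)" by simp
      also have "norm \<dots> \<le> norm (G y - G x - G1 x (y - x)) + norm (G1 x (y - x))" by (rule norm_triangle_ineq)
      also have "\<dots> \<le> norm (y - x) + norm (G1 x) * norm (y - x)"
        using \<delta>'(2)[of y] y norm_blinfun[of "G1 x" "y - x"] by (intro add_mono) auto
      finally have "norm (y - x) + norm (?U' - U) \<le> C * norm (y - x)" by (simp add: C_def algebra_simps)
      moreover have "norm (y - x, ?U' - U) \<le> norm (y - x) + norm (?U' - U)"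
        by (simp add: norm_Pair sqrt_sum_squares_le_sum)
      ultimately have n: "norm (y - x, ?U' - U) \<le> C * norm (y - x)" by linarith
      also have "\<dots> < \<delta>" using y C by (simp add: pos_less_divide_eq mult.commute)
      finally have "f x + r / 2 * (norm U)\<^sup>2 + (p \<bullet> (y - x) + s \<bullet> (?U' - U)) - e / C * norm (y - x, ?U' - U)
        \<le> f y + r / 2 * (norm ?U')\<^sup>2"
        using Z U' by (intro *) auto
      moreover have "e / C * norm (y - x, ?U' - U) \<le> e / C * (C * norm (y - x))"
        using n eC by (intro mult_left_mono) auto
      ultimately show "\<Psi> x + p \<bullet> (y - x) - e * norm (y - x) \<le> \<Psi> y"
        using C by (simp add: \<Psi>_def Z_def power2_norm_eq_inner inner_diff_right inner_add_right)
    qed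
  qed
  then show "p \<bullet> d = f1 x d + (s - r *\<^sub>R U) \<bullet> G1 x d" by (simp add: V_def)
qed

lemma phi_r_minimizer:
  assumes feas: "G x0 + U0 \<in> psd" "U0 \<in> Sym" and \<delta>: "0 \<le> \<delta>"
  shows "\<exists>z \<in> E \<inter> cball (x0, U0) \<delta>. \<bar>phi_r f G r z\<bar> \<noteq> \<infinity> \<and>
      (\<forall>z' \<in> E \<inter> cball (x0, U0) \<delta>. phi_r f G r z + ereal (v \<bullet> (z' - z)) \<le> phi_r f G r z')"
proof -
  define K where "K = (E \<inter> {z. G (fst z) + snd z \<in> psd}) \<inter> cball (x0, U0) \<delta>"
  define g where "g z = f (fst z) + r / 2 * (norm (snd z))\<^sup>2 - v \<bullet> z" for z
  have cf: "continuous_on S f" and cG: "continuous_on T G" for S T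
    using has_derivative_continuous[OF f1] has_derivative_continuous[OF G1]
    by (auto intro: continuous_at_imp_continuous_on)
  have "closed {z. G (fst z) + snd z \<in> psd}"
  proof -
    have "continuous_on UNIV (\<lambda>z. G (fst z) + snd z)"
      by (intro continuous_intros continuous_on_compose2[OF cG[of UNIV]]) auto
    from continuous_closed_preimage[OF this closed_UNIV closed_psd] show ?thesis
      by (simp add: vimage_def)
  qed
  then have "compact K" unfolding K_def
    by (intro closed_Int_compact closed_Int compact_cball closed_subspace[OF subspace_E])
  moreover have "(x0, U0) \<in> K" using feas \<delta> by (simp add: K_def)
  moreover have "continuous_on K g"
    unfolding g_def by (intro continuous_intros continuous_on_compose2[OF cf[of UNIV]]) auto
  ultimately obtain z where z: "z \<in> K" and min: "\<And>z'. z' \<in> K \<Longrightarrow> g z \<le> g z'"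
    using continuous_attains_inf[of K g] by blast
  have \<phi>: "phi_r f G r y = ereal (f (fst y) + r / 2 * (norm (snd y))\<^sup>2)" if "y \<in> K" for y
    using that phi_r_feasible[of G "fst y" "snd y" f r] by (simp add: K_def)
  show ?thesis
  proof (intro bexI[of _ z] conjI ballI)
    show "z \<in> E \<inter> cball (x0, U0) \<delta>" using z by (simp add: K_def)
    show "\<bar>phi_r f G r z\<bar> \<noteq> \<infinity>" by (simp add: \<phi>[OF z])
    fix z' assume z': "z' \<in> E \<inter> cball (x0, U0) \<delta>"
    show "phi_r f G r z + ereal (v \<bullet> (z' - z)) \<le> phi_r f G r z'"
    proof (cases "G (fst z') + snd z' \<in> psd")
      case True
      then have "z' \<in> K" using z' by (simp add: K_def)
      with min[OF this] show ?thesis by (simp add: \<phi> z g_def inner_diff_right)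
    next
      case False
      then show ?thesis using phi_r_infeasible[of G "fst z'" "snd z'" f r] by simp
    qed
  qed
qed

end

section \<open>Second order condition and strong variational sufficiency\<close>

context sdp
begin

lemma reference_regular_subgrad:
  assumes r: "0 < r" and U: "U \<in> Sym" "X + U \<in> psd" "Y \<bullet> U = 0"
  shows "(0, Y + r *\<^sub>R U) \<in> regular_subgrad E (phi_r f G r) (xb, U)"
  unfolding regular_subgrad_def mem_Collect_eq
proof (intro conjI allI impI)
  show "(0, Y + r *\<^sub>R U) \<in> E"
    using U nsd_subset_Sym[OF Y_nsd] by (auto intro!: subspace_add subspace_scale subspace_Sym)
  show "(xb, U) \<in> E" using U by simp
  have \<phi>: "phi_r f G r (xb, U) = ereal (f xb + r / 2 * (norm U)\<^sup>2)"
    using U by (simp add: phi_r_feasible G_xb)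
  then show "\<bar>phi_r f G r (xb, U)\<bar> \<noteq> \<infinity>" by simp
  fix e :: real assume e: "0 < e"
  have "((\<lambda>x. Lag f G x Y) has_derivative (\<lambda>d. 0)) (at xb)"
    using Lag_derivative[of Y xb] by (simp add: stat)
  then obtain \<delta> where \<delta>: "0 < \<delta>" and L: "\<And>y. norm (y - xb) < \<delta> \<Longrightarrow>
      norm (Lag f G y Y - Lag f G xb Y - 0) \<le> e * norm (y - xb)"
    unfolding has_derivative_at_alt using e by blast
  show "\<exists>\<delta>>0. \<forall>z'\<in>E. norm (z' - (xb, U)) < \<delta> \<longrightarrow>
     phi_r f G r (xb, U) + ereal ((0, Y + r *\<^sub>R U) \<bullet> (z' - (xb, U)) - e * norm (z' - (xb, U))) \<le> phi_r f G r z'"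
  proof (intro exI[of _ \<delta>] conjI \<delta> ballI impI)
    fix z' assume near: "norm (z' - (xb, U)) < \<delta>"
    obtain x' U' where z': "z' = (x', U')" by (cases z')
    show "phi_r f G r (xb, U) + ereal ((0, Y + r *\<^sub>R U) \<bullet> (z' - (xb, U)) - e * norm (z' - (xb, U))) \<le> phi_r f G r z'"
    proof (cases "G x' + U' \<in> psd")
      case False
      then show ?thesis by (simp add: z' phi_r_infeasible)
    next
      case True
      have nx: "norm (x' - xb) \<le> norm (z' - (xb, U))"
        using norm_fst_le[of "x' - xb" "U' - U"] by (simp add: z')
      have "- (e * norm (z' - (xb, U))) \<le> - (e * norm (x' - xb))" using nx e by simp
      also have "\<dots> \<le> Lag f G x' Y - Lag f G xb Y" using L[of x'] nx near by (auto simp: abs_le_iff)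
      finally have 1: "- (e * norm (z' - (xb, U))) \<le> f x' + Y \<bullet> G x' - f xb"
        using XY by (simp add: Lag_def G_xb inner_commute)
      have 2: "Y \<bullet> G x' + Y \<bullet> U' \<le> 0" using inner_psd_nsd[OF True Y_nsd] by (simp add: inner_commute inner_add_right)
      have "0 \<le> r / 2 * (norm (U' - U))\<^sup>2" using r by simp
      also have "\<dots> = r / 2 * (norm U')\<^sup>2 - r / 2 * (norm U)\<^sup>2 - (r *\<^sub>R U) \<bullet> (U' - U)"
        unfolding power2_norm_eq_inner by (simp add: inner_diff_left inner_diff_right inner_commute algebra_simps)
      finally have 3: "(r *\<^sub>R U) \<bullet> (U' - U) \<le> r / 2 * (norm U')\<^sup>2 - r / 2 * (norm U)\<^sup>2" by simp
      have "(0, Y + r *\<^sub>R U) \<bullet> (z' - (xb, U)) = Y \<bullet> U' + (r *\<^sub>R U) \<bullet> (U' - U)"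
        using U(3) by (simp add: z' inner_add_left inner_diff_right)
      then show ?thesis
        using 1 2 3 True unfolding \<phi> by (simp add: z' phi_r_feasible)
    qed
  qed
qed

lemma ssosc_growth:
  assumes ssosc
  obtains R \<kappa> \<delta> where "0 < R" "0 < \<kappa>" "0 < \<delta>"
    "\<And>z v z'. z \<in> ball (xb, 0) \<delta> \<Longrightarrow> v \<in> ball (0, Y) \<delta> \<Longrightarrow> v \<in> regular_subgrad E (phi_r f G R) z \<Longrightarrow>
      z' \<in> E \<Longrightarrow> z' \<in> ball (xb, 0) \<delta> \<Longrightarrow>
      phi_r f G R z + ereal (v \<bullet> (z' - z) + \<kappa> * (norm (z' - z))\<^sup>2) \<le> phi_r f G R z'"
proof -
  obtain r \<mu> where r: "0 < r" and \<mu>: "0 < \<mu>" and bound: "\<And>d. \<mu> * (norm d)\<^sup>2 \<le> q Y xb d / 2 + lower r (G1 xb d)"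
    using ssosc_uniform[OF assms] by (metis order_refl)
  \<comment> \<open>\<open>R / 2 = 2 * r\<close>: one \<open>r\<close> absorbs the penalty in the
    lower bound, since \<open>|w + eG|^2 \<le> 2 |w|^2 + 2 |eG|^2\<close>, and the other remains as
    growth in \<open>U\<close>.\<close>
  define R where "R = 4 * r"
  define C where "C = norm (G1 xb) + 1"
  have C: "0 < C" by (simp add: C_def add_nonneg_pos)
  define \<kappa> where "\<kappa> = min (\<mu> / 4) r"
  have R: "0 < R" and \<kappa>: "0 < \<kappa>" "\<kappa> \<le> \<mu> / 4" "\<kappa> \<le> r" using r \<mu> by (auto simp: R_def \<kappa>_def)
  \<comment> \<open>Three errors, from the Taylor expansion, from \<open>eG\<close> and from the
    lower bound, each cost \<open>\<mu> / 4\<close>; the last quarter of \<open>\<mu>\<close> is the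
    growth in \<open>x\<close>.\<close>
  define e1 where "e1 = sqrt (\<mu> / (4 * r))"
  define e2 where "e2 = \<mu> / (4 * C\<^sup>2)"
  have e: "0 < \<mu> / 4" "0 < e1" "0 < e2" "r * e1\<^sup>2 = \<mu> / 4" "e2 * C\<^sup>2 = \<mu> / 4"
    using r \<mu> C by (auto simp: e1_def e2_def)
  obtain \<delta>1 where \<delta>1: "0 < \<delta>1" and taylor: "\<And>x x' V. norm (x - xb) < \<delta>1 \<Longrightarrow> norm (x' - xb) < \<delta>1 \<Longrightarrow> norm (V - Y) < \<delta>1 \<Longrightarrow>
      q Y xb (x' - x) / 2 - \<mu> / 4 * (norm (x' - x))\<^sup>2 \<le>
        Lag f G x' V - Lag f G x V - (f1 x (x' - x) + V \<bullet> G1 x (x' - x))"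
    using Lag_second_order_lower[OF e(1)] by metis
  obtain \<delta>2 where \<delta>2: "0 < \<delta>2" and strict: "\<And>x x'. norm (x - xb) < \<delta>2 \<Longrightarrow> norm (x' - xb) < \<delta>2 \<Longrightarrow>
      norm (G x' - G x - G1 xb (x' - x)) \<le> e1 * norm (x' - x)"
    using G_strict_derivative[OF e(2)] by metis
  obtain \<delta>3 where \<delta>3: "0 < \<delta>3" and lb: "\<And>X' V X'' H. X' \<in> psd \<Longrightarrow> V \<in> nsd \<Longrightarrow> X'' \<in> psd \<Longrightarrow> H \<in> Sym \<Longrightarrow>
      X' \<bullet> V = 0 \<Longrightarrow> norm (X' - X) < \<delta>3 \<Longrightarrow> norm (V - Y) < \<delta>3 \<Longrightarrow> norm H < \<delta>3 \<Longrightarrow>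
      lower r H - e2 * (norm H)\<^sup>2 \<le> - (V \<bullet> X'') + r / 2 * (norm (X'' - X' - H))\<^sup>2"
    using second_order_lower_bound[OF r e(3)] by meson
  have "isCont G xb" using has_derivative_continuous[OF G1] .
  then obtain \<delta>4 where \<delta>4: "0 < \<delta>4" and Gc: "\<And>x. norm (x - xb) < \<delta>4 \<Longrightarrow> norm (G x - G xb) < \<delta>3 / 2"
    unfolding continuous_at_eps_delta dist_norm using \<delta>3 half_gt_zero by blast
  \<comment> \<open>\<open>V = s - R U\<close> may differ from \<open>Y\<close> by
    \<open>(1 + R) * \<delta>\<close>, and the norm of \<open>H\<close> may reach
    \<open>2 * C * \<delta>\<close>.\<close>
  define \<delta> where "\<delta> = Min {\<delta>1 / (1 + R), \<delta>1, \<delta>2, \<delta>3 / (1 + R), \<delta>3 / 2, \<delta>3 / (2 * C), \<delta>4}"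
  have \<delta>_le: "\<delta> \<le> \<delta>1 / (1 + R)" "\<delta> \<le> \<delta>1" "\<delta> \<le> \<delta>2" "\<delta> \<le> \<delta>3 / (1 + R)" "\<delta> \<le> \<delta>3 / 2" "\<delta> \<le> \<delta>3 / (2 * C)" "\<delta> \<le> \<delta>4"
    unfolding \<delta>_def by (intro Min_le; simp)+
  have \<delta>: "0 < \<delta>" using \<delta>1 \<delta>2 \<delta>3 \<delta>4 R C by (simp add: \<delta>_def)
  have \<delta>R: "(1 + R) * \<delta> \<le> \<delta>1" "(1 + R) * \<delta> \<le> \<delta>3" "2 * C * \<delta> \<le> \<delta>3"
    using \<delta>_le(1,4,6) R C by (simp_all add: pos_le_divide_eq mult.commute)
  show ?thesis
  proof (rule that[OF R \<kappa>(1) \<delta>])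
    fix z v z'
    assume z: "z \<in> ball (xb, 0) \<delta>" and v: "v \<in> ball (0, Y) \<delta>" and sub: "v \<in> regular_subgrad E (phi_r f G R) z"
      and z'E: "z' \<in> E" and z': "z' \<in> ball (xb, 0) \<delta>"
    obtain x U where z_eq: "z = (x, U)" by (cases z)
    obtain p s where v_eq: "v = (p, s)" by (cases v)
    obtain x' U' where z'_eq: "z' = (x', U')" by (cases z')
    define V where "V = s - R *\<^sub>R U"
    define d where "d = x' - x"
    define w where "w = U' - U"
    define H where "H = G1 xb d"
    define eG where "eG = G x' - G x - H"
    note facts = regular_subgrad_phi_r[OF sub[unfolded z_eq v_eq]]
    have U: "U \<in> Sym" and X': "G x + U \<in> psd" and V: "V \<in> nsd" and XV: "(G x + U) \<bullet> V = 0"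
      and p: "p \<bullet> d = f1 x d + V \<bullet> G1 x d" using facts by (auto simp: V_def)
    have near: "norm (x - xb) < \<delta>" "norm U < \<delta>" "norm (s - Y) < \<delta>" "norm (x' - xb) < \<delta>"
      using z v z' norm_fst_le[of "xb - x" "- U"] norm_snd_le[of "- U" "xb - x"]
        norm_snd_le[of "Y - s" "- p"] norm_fst_le[of "xb - x'" "- U'"]
      by (auto simp: z_eq v_eq z'_eq dist_norm norm_minus_commute)
    have "norm (V - Y) = norm ((s - Y) - R *\<^sub>R U)" by (simp add: V_def algebra_simps)
    also have "\<dots> \<le> norm (s - Y) + R * norm U" using norm_triangle_ineq4[of "s - Y" "R *\<^sub>R U"] R by simp
    also have "\<dots> < \<delta> + R * \<delta>" using near R by (intro add_strict_mono) auto
    finally have VY: "norm (V - Y) < (1 + R) * \<delta>" by (simp add: algebra_simps)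
    have "norm ((G x + U) - X) \<le> norm (G x - G xb) + norm U"
      using norm_triangle_ineq[of "G x - G xb" U] by (simp add: G_xb algebra_simps)
    also have "\<dots> < \<delta>3" using Gc[of x] near \<delta>_le by linarith
    finally have XX: "norm ((G x + U) - X) < \<delta>3" .
    have HC: "norm H \<le> C * norm d"
      using norm_blinfun[of "G1 xb" d] mult_right_mono[of "norm (G1 xb)" C "norm d"] by (simp add: H_def C_def)
    have "norm d \<le> norm (x' - xb) + norm (x - xb)"
      using norm_triangle_ineq4[of "x' - xb" "x - xb"] by (simp add: d_def)
    then have "norm d < 2 * \<delta>" using near by linarith
    then have "C * norm d < C * (2 * \<delta>)" using C by simp
    then have HH: "norm H < \<delta>3" using HC \<delta>R(3) by (simp add: mult_ac)
    show "phi_r f G R z + ereal (v \<bullet> (z' - z) + \<kappa> * (norm (z' - z))\<^sup>2) \<le> phi_r f G R z'"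
    proof (cases "G x' + U' \<in> psd")
      case False
      then show ?thesis by (simp add: z'_eq phi_r_infeasible)
    next
      case True
      have T: "q Y xb d / 2 - \<mu> / 4 * (norm d)\<^sup>2 \<le> Lag f G x' V - Lag f G x V - p \<bullet> d"
        unfolding p unfolding d_def using near \<delta>_le VY \<delta>R by (intro taylor) auto
      have eG: "norm eG \<le> e1 * norm d"
        unfolding eG_def H_def d_def using near \<delta>_le by (intro strict) auto
      have "H \<in> Sym" by (simp add: H_def G1_Sym)
      have "lower r H - e2 * (norm H)\<^sup>2 \<le> - (V \<bullet> (G x' + U')) + r / 2 * (norm (G x' + U' - (G x + U) - H))\<^sup>2"
        using VY \<delta>R by (intro lb X' V True \<open>H \<in> Sym\<close> XV XX HH) auto
      also have "G x' + U' - (G x + U) - H = w + eG" by (simp add: w_def eG_def)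
      finally have 1: "lower r H - e2 * (norm H)\<^sup>2 \<le> - (V \<bullet> (G x' + U')) + r / 2 * (norm (w + eG))\<^sup>2" .
      have "(norm (w + eG))\<^sup>2 \<le> 2 * (norm w)\<^sup>2 + 2 * (norm eG)\<^sup>2"
      proof -
        have "0 \<le> (norm (w - eG))\<^sup>2" by simp
        then show ?thesis unfolding power2_norm_eq_inner
          by (simp add: inner_diff_left inner_diff_right inner_add_left inner_add_right inner_commute)
      qed
      then have "r / 2 * (norm (w + eG))\<^sup>2 \<le> r / 2 * (2 * (norm w)\<^sup>2 + 2 * (norm eG)\<^sup>2)"
        using r by (intro mult_left_mono) auto
      also have "\<dots> = r * (norm w)\<^sup>2 + r * (norm eG)\<^sup>2" by (simp add: algebra_simps)
      also have "r * (norm eG)\<^sup>2 \<le> r * (e1 * norm d)\<^sup>2"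
        using r eG by (intro mult_left_mono power_mono) auto
      also have "r * (e1 * norm d)\<^sup>2 = \<mu> / 4 * (norm d)\<^sup>2" using e(4) by (simp add: power_mult_distrib mult.assoc[symmetric])
      finally have 2: "r / 2 * (norm (w + eG))\<^sup>2 \<le> r * (norm w)\<^sup>2 + \<mu> / 4 * (norm d)\<^sup>2" by simp
      have "e2 * (norm H)\<^sup>2 \<le> e2 * (C * norm d)\<^sup>2" using e(3) HC by (intro mult_left_mono power_mono) auto
      also have "\<dots> = \<mu> / 4 * (norm d)\<^sup>2" using e(5) by (simp add: power_mult_distrib mult.assoc[symmetric])
      finally have 3: "e2 * (norm H)\<^sup>2 \<le> \<mu> / 4 * (norm d)\<^sup>2" .
      have 4: "\<mu> * (norm d)\<^sup>2 \<le> q Y xb d / 2 + lower r H" using bound[of d] by (simp add: H_def)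
      have 5: "\<kappa> * (norm d)\<^sup>2 \<le> \<mu> / 4 * (norm d)\<^sup>2" "\<kappa> * (norm w)\<^sup>2 \<le> r * (norm w)\<^sup>2"
        by (intro mult_right_mono \<kappa> zero_le_power2)+
      \<comment> \<open>Complementarity of \<open>V\<close> and \<open>G x + U\<close> inserts the
        Lagrangian; the squares in \<open>U\<close> leave exactly \<open>R / 2\<close> times the
        square of \<open>w\<close>.\<close>
      have 6: "f x' + R / 2 * (norm U')\<^sup>2 - (f x + R / 2 * (norm U)\<^sup>2) - (p \<bullet> d + s \<bullet> w)
        = Lag f G x' V - Lag f G x V - p \<bullet> d - V \<bullet> (G x' + U') + 2 * r * (norm w)\<^sup>2"
      proof -
        have "V \<bullet> G x + V \<bullet> U = 0" using XV by (simp add: inner_commute inner_add_right)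
        moreover have "s = V + R *\<^sub>R U" by (simp add: V_def)
        ultimately show ?thesis
          unfolding Lag_def power2_norm_eq_inner w_def
          by (simp add: R_def inner_add_left inner_add_right inner_diff_left inner_diff_right inner_commute algebra_simps)
      qed
      have "\<kappa> * (norm (z' - z))\<^sup>2 = \<kappa> * (norm d)\<^sup>2 + \<kappa> * (norm w)\<^sup>2"
        by (simp add: z_eq z'_eq d_def w_def norm_Pair algebra_simps)
      moreover have "v \<bullet> (z' - z) = p \<bullet> d + s \<bullet> w" by (simp add: v_eq z_eq z'_eq d_def w_def)
      ultimately have "(f x + R / 2 * (norm U)\<^sup>2) + (v \<bullet> (z' - z) + \<kappa> * (norm (z' - z))\<^sup>2) \<le> f x' + R / 2 * (norm U')\<^sup>2"
        using T 1 2 3 4 5 6 by linarith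
      then show ?thesis by (simp add: z_eq z'_eq phi_r_feasible X' True)
    qed
  qed
qed

lemma ssosc_imp_strong_var_suff:
  assumes ssosc
  shows "strong_var_suff f G xb Y"
proof -
  obtain R \<kappa> \<delta> where R: "0 < R" and \<kappa>: "0 < \<kappa>" and \<delta>: "0 < \<delta>" and growth:
    "\<And>z v z'. z \<in> ball (xb, 0) \<delta> \<Longrightarrow> v \<in> ball (0, Y) \<delta> \<Longrightarrow> v \<in> regular_subgrad E (phi_r f G R) z \<Longrightarrow>
      z' \<in> E \<Longrightarrow> z' \<in> ball (xb, 0) \<delta> \<Longrightarrow>
      phi_r f G R z + ereal (v \<bullet> (z' - z) + \<kappa> * (norm (z' - z))\<^sup>2) \<le> phi_r f G R z'"
    using ssosc_growth[OF assms] by blast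
  have feas: "G xb + 0 \<in> psd" "(0 :: real^'n^'n) \<in> Sym" using X_psd by (simp_all add: G_xb subspace_0 subspace_Sym)
  have "(0, Y + R *\<^sub>R 0) \<in> regular_subgrad E (phi_r f G R) (xb, 0)"
    using feas by (intro reference_regular_subgrad R) (auto simp: G_xb)
  then have ref: "(0, Y) \<in> lim_subgrad E (phi_r f G R) (xb, 0)" by (simp add: lim_subgrad_regular)
  have "var_strongly_convex E (phi_r f G R) (xb, 0) (0, Y)"
  proof (rule var_strongly_convexI[OF subspace_E \<kappa> \<delta> ref])
    fix z v z' assume *: "z \<in> ball (xb, 0) \<delta>" "v \<in> ball (0, Y) \<delta>" "v \<in> lim_subgrad E (phi_r f G R) z"
      "z' \<in> E" "z' \<in> ball (xb, 0) \<delta>"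
    show "phi_r f G R z + ereal (v \<bullet> (z' - z) + \<kappa> * (norm (z' - z))\<^sup>2) \<le> phi_r f G R z'"
      by (rule lim_subgrad_bound[OF open_ball open_ball *(1-3)]) (rule growth[OF _ _ _ *(4,5)])
  qed (use phi_r_minimizer[OF feas] \<delta> in simp)
  then show ?thesis using R unfolding strong_var_suff_def by blast
qed

text \<open>The growth condition is tested at the reference point perturbed by \<open>\<epsilon> E0\<close>, where \<open>E0\<close>
  projects onto the common kernel of \<open>X\<close> and \<open>Y\<close>: there, the critical cone is a subspace
  containing the affine hull of the critical cone at the reference point.\<close>
lemma strong_var_suff_imp_ssosc:
  assumes "strong_var_suff f G xb Y"
  shows ssosc
  unfolding ssosc_def
proof (intro allI impI)
  obtain r where r: "0 < r" and vsc: "var_strongly_convex E (phi_r f G r) (xb, 0) (0, Y)"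
    using assms unfolding strong_var_suff_def by blast
  obtain N Z \<psi> where N: "open N" "(xb, 0) \<in> N" and Z: "open Z" "(0, Y) \<in> Z"
    and proper: "proper_on E \<psi>" and sconv: "strongly_convex_on E \<psi>"
    and \<psi>_le: "\<forall>z\<in>N \<inter> E. \<psi> z \<le> phi_r f G r z"
    and gph: "{(z, v). z \<in> N \<inter> E \<and> v \<in> Z \<and> v \<in> lim_subgrad E \<psi> z} =
        {(z, v). z \<in> N \<inter> E \<and> v \<in> Z \<and> v \<in> lim_subgrad E (phi_r f G r) z}"
    and \<psi>_eq: "\<forall>z v. z \<in> N \<inter> E \<and> v \<in> Z \<and> v \<in> lim_subgrad E (phi_r f G r) z \<longrightarrow> \<psi> z = phi_r f G r z"
    using vsc unfolding var_strongly_convex_def by (elim conjE exE)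
  obtain \<mu> where \<mu>: "0 < \<mu>" and \<psi>_growth: "\<And>z v z'. v \<in> lim_subgrad E \<psi> z \<Longrightarrow> z' \<in> E \<Longrightarrow>
      \<psi> z + ereal (v \<bullet> (z' - z) + \<mu> * (norm (z' - z))\<^sup>2) \<le> \<psi> z'"
    using lim_subgrad_strongly_convex[OF subspace_E proper sconv] by metis
  define e where "e = (\<lambda>i. if l i = 0 \<and> m i = 0 then 1 else 0 :: real)"
  define E0 where "E0 = conj_by P (diag_mat e)"
  have E0: "E0 \<in> psd" by (auto simp: E0_def e_def intro!: conj_by_psd diag_mat_psd)
  have YE0: "Y \<bullet> E0 = 0"
    by (auto simp: Y_def E0_def inner_conj_by[OF P] inner_diag_mat diag_mat_nth e_def intro!: sum.neutral)
  have "((\<lambda>\<epsilon>. (xb, \<epsilon> *\<^sub>R E0)) \<longlongrightarrow> (xb, 0 *\<^sub>R E0)) (at_right 0)"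
    "((\<lambda>\<epsilon>. (0, Y + r *\<^sub>R \<epsilon> *\<^sub>R E0)) \<longlongrightarrow> (0, Y + r *\<^sub>R 0 *\<^sub>R E0)) (at_right 0)"
    by (intro tendsto_intros)+
  then have "eventually (\<lambda>\<epsilon>. (xb, \<epsilon> *\<^sub>R E0) \<in> N) (at_right 0)"
    "eventually (\<lambda>\<epsilon>. (0, Y + r *\<^sub>R \<epsilon> *\<^sub>R E0) \<in> Z) (at_right 0)"
    by (auto intro!: topological_tendstoD[OF _ N(1)] topological_tendstoD[OF _ Z(1)] simp: N Z)
  moreover have "eventually (\<lambda>\<epsilon>::real. 0 < \<epsilon>) (at_right 0)" by (rule eventually_at_right_less)
  ultimately have "eventually (\<lambda>\<epsilon>. 0 < \<epsilon> \<and> (xb, \<epsilon> *\<^sub>R E0) \<in> N \<and> (0, Y + r *\<^sub>R \<epsilon> *\<^sub>R E0) \<in> Z) (at_right 0)"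
    by eventually_elim simp
  then obtain \<epsilon> where \<epsilon>: "0 < \<epsilon>" and zN: "(xb, \<epsilon> *\<^sub>R E0) \<in> N" and vZ: "(0, Y + r *\<^sub>R \<epsilon> *\<^sub>R E0) \<in> Z"
    using eventually_happens'[OF trivial_limit_at_right_real] by blast
  let ?U = "\<epsilon> *\<^sub>R E0" and ?v = "(0, Y + r *\<^sub>R \<epsilon> *\<^sub>R E0)"
  have USym: "?U \<in> Sym" and Upsd: "X + ?U \<in> psd"
    using \<epsilon> by (auto intro!: psd_subset_Sym psd_add psd_scaleR E0 X_psd)
  have vsub: "?v \<in> lim_subgrad E (phi_r f G r) (xb, ?U)"
    using USym Upsd YE0 by (intro lim_subgrad_regular reference_regular_subgrad r) auto
  have "((xb, ?U), ?v) \<in> {(z, v). z \<in> N \<inter> E \<and> v \<in> Z \<and> v \<in> lim_subgrad E (phi_r f G r) z}"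
    using vsub vZ zN USym by simp
  then have vsub\<psi>: "?v \<in> lim_subgrad E \<psi> (xb, ?U)" unfolding gph[symmetric] by simp
  have "\<psi> (xb, ?U) = phi_r f G r (xb, ?U)" using \<psi>_eq vsub vZ zN USym by blast
  then have \<psi>z: "\<psi> (xb, ?U) = ereal (f xb + r / 2 * (norm ?U)\<^sup>2)" using Upsd by (simp add: phi_r_feasible G_xb)
  have growth: "f xb + r / 2 * (norm ?U)\<^sup>2 + ((Y + r *\<^sub>R ?U) \<bullet> (U' - ?U) + \<mu> * (norm (x' - xb))\<^sup>2)
      \<le> f x' + r / 2 * (norm U')\<^sup>2"
    if "(x', U') \<in> N" "U' \<in> Sym" "G x' + U' \<in> psd" for x' U'
  proof -
    have "\<psi> (xb, ?U) + ereal (?v \<bullet> ((x', U') - (xb, ?U)) + \<mu> * (norm ((x', U') - (xb, ?U)))\<^sup>2) \<le> \<psi> (x', U')"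
      using that by (intro \<psi>_growth[OF vsub\<psi>]) simp
    also have "\<dots> \<le> phi_r f G r (x', U')" using \<psi>_le that by simp
    finally have "f xb + r / 2 * (norm ?U)\<^sup>2 + ((Y + r *\<^sub>R ?U) \<bullet> (U' - ?U)
        + \<mu> * ((norm (x' - xb))\<^sup>2 + (norm (U' - ?U))\<^sup>2)) \<le> f x' + r / 2 * (norm U')\<^sup>2"
      using that(3) by (simp add: \<psi>z phi_r_feasible norm_Pair)
    moreover have "0 \<le> \<mu> * (norm (U' - ?U))\<^sup>2" using \<mu> by simp
    ultimately show ?thesis by (simp add: distrib_left)
  qed
  fix d assume d: "d \<noteq> 0 \<and> pen (G1 xb d) = 0"
  define H where "H = G1 xb d"
  have H: "H \<in> Sym" by (simp add: H_def G1_Sym)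
  define h where "h = co H"
  have h: "h \<in> Sym" and Hh: "H = conj_by P h" by (simp_all add: h_def conj_by_Sym H conj_by_inverse'[OF P])
  have z: "h$i$j = 0" if "l i = 0" "m j < 0" for i j using d that by (auto simp: pen_eq_0_iff h_def H_def)
  define a where "a = (\<lambda>i. l i + \<epsilon> * e i)"
  have a: "0 \<le> a i" for i using l[of i] \<epsilon> by (simp add: a_def e_def)
  \<comment> \<open>After the shift the pair is strictly complementary: the zero eigenvalues of
    \<open>X + \<epsilon> E0\<close> are those with negative \<open>m\<close>, so
    \<open>psd_arc\<close> applies to every \<open>H\<close> with \<open>pen H = 0\<close>.\<close>
  have a0: "a i = 0 \<Longrightarrow> l i = 0 \<and> m i < 0" for i
    using l[of i] m[of i] \<epsilon> by (auto simp: a_def e_def split: if_splits)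
  have am: "a i * m i = 0" for i using lm[of i] by (auto simp: a_def e_def)
  have hz: "h$i$j = 0" if "a i = 0" "a j = 0" for i j using a0[OF that(1)] a0[OF that(2)] z by blast
  define Q where "Q = conj_by P (arc_gen a h ** diag_mat a ** transpose (arc_gen a h))"
  have Xa: "X + ?U = conj_by P (diag_mat a)"
  proof -
    have "diag_mat a = diag_mat l + \<epsilon> *\<^sub>R diag_mat e" by (simp add: vec_eq_iff diag_mat_nth a_def)
    then show ?thesis by (simp add: X_def E0_def conj_by_add conj_by_scaleR)
  qed
  have arc: "X + ?U + t *\<^sub>R H + t\<^sup>2 *\<^sub>R Q \<in> psd" for t
  proof -
    have "diag_mat a + t *\<^sub>R h + t\<^sup>2 *\<^sub>R (arc_gen a h ** diag_mat a ** transpose (arc_gen a h)) \<in> psd"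
      by (rule psd_arc[OF a h]) (rule hz)
    from conj_by_psd[OF this, of P] show ?thesis
      by (simp add: Xa Q_def Hh conj_by_add conj_by_scaleR)
  qed
  have YQ: "Y \<bullet> Q = Upsilon X Y H / 2"
  proof -
    \<comment> \<open>Where \<open>m j < 0\<close>, either \<open>l i = 0\<close> and the entry of
      \<open>h\<close> vanishes, or \<open>l i > 0\<close> and the shift leaves
      \<open>a i = l i\<close>; the sigma-term does not see \<open>\<epsilon>\<close>.\<close>
    have *: "m j * (h$i$j)\<^sup>2 / a i = m j * (h$i$j)\<^sup>2 / l i" for i j
      using z[of i j] m[of j] by (cases "l i = 0"; cases "m j = 0") (auto simp: a_def e_def)
    have "Y \<bullet> Q = (\<Sum>i\<in>UNIV. \<Sum>j\<in>UNIV. m j * (h$i$j)\<^sup>2 / l i)"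
      unfolding Y_def Q_def inner_conj_by[OF P] inner_diag_arc[OF am h] * ..
    then show ?thesis by (simp add: Upsilon_XY[OF H] h_def)
  qed
  have YH: "Y \<bullet> H = 0"
  proof -
    have "m i * h$i$i = 0" for i using z[of i i] m[of i] lm[of i] by (cases "m i = 0") auto
    then show ?thesis unfolding Y_def Hh inner_conj_by[OF P] inner_diag_mat by (simp only: sum.neutral_const)
  qed
  have "\<forall>t. \<exists>y. y \<in> closed_segment xb (xb + t *\<^sub>R d) \<and>
    Lag f G (xb + t *\<^sub>R d) Y = Lag f G xb Y + t\<^sup>2 * (q Y y d / 2)"
  proof
    fix t
    obtain y where "y \<in> closed_segment xb (xb + t *\<^sub>R d)" "Lag f G (xb + t *\<^sub>R d) Y =
        Lag f G xb Y + (f1 xb (xb + t *\<^sub>R d - xb) + Y \<bullet> G1 xb (xb + t *\<^sub>R d - xb)) + q Y y (xb + t *\<^sub>R d - xb) / 2"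
      by (rule Lag_taylor)
    then show "\<exists>y. y \<in> closed_segment xb (xb + t *\<^sub>R d) \<and>
        Lag f G (xb + t *\<^sub>R d) Y = Lag f G xb Y + t\<^sup>2 * (q Y y d / 2)"
      by (intro exI[of _ y]) (simp add: stat q_scaleR)
  qed
  then obtain y where y: "\<And>t. y t \<in> closed_segment xb (xb + t *\<^sub>R d)"
    "\<And>t. Lag f G (xb + t *\<^sub>R d) Y = Lag f G xb Y + t\<^sup>2 * (q Y (y t) d / 2)" by metis
  \<comment> \<open>\<open>t * n t\<close> bounds the displacement of \<open>U\<close> along the
    arc; since \<open>n\<close> tends to 0, the penalty \<open>r / 2\<close> contributes only a term
    that is small relative to \<open>t^2\<close>.\<close>
  define n where "n t = norm (G (xb + t *\<^sub>R d) - X - t *\<^sub>R H) / norm t + norm t * norm Q" for t :: real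
  have n_lim: "(n \<longlongrightarrow> 0) (at_right 0)"
  proof -
    have "((\<lambda>t::real. xb + t *\<^sub>R d) has_derivative (\<lambda>h. h *\<^sub>R d)) (at 0)"
      by (auto intro!: derivative_eq_intros)
    from has_derivative_compose[OF this G1[of "xb + 0 *\<^sub>R d"]]
    have "((\<lambda>t. G (xb + t *\<^sub>R d)) has_derivative (\<lambda>t. t *\<^sub>R H)) (at 0)"
      by (simp add: H_def blinfun.scaleR_right)
    then have "((\<lambda>t. norm (G (xb + t *\<^sub>R d) - X - t *\<^sub>R H) / norm t) \<longlongrightarrow> 0) (at 0)"
      unfolding has_derivative_at by (simp add: G_xb)
    then have "(n \<longlongrightarrow> 0 + norm (0::real) * norm Q) (at 0)"
      unfolding n_def[abs_def] by (intro tendsto_intros)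
    then show ?thesis by (simp add: filterlim_at_split)
  qed
  have y_lim: "(y \<longlongrightarrow> xb) (at_right 0)"
  proof (rule tendsto_dist_iff[THEN iffD2], rule tendsto_sandwich[OF _ _ tendsto_const])
    show "eventually (\<lambda>t. 0 \<le> dist (y t) xb) (at_right 0)" by simp
    have "dist (y t) xb \<le> norm (t *\<^sub>R d)" for t
      using segment_bound1[OF y(1)[of t]] by (simp add: dist_norm)
    then show "eventually (\<lambda>t. dist (y t) xb \<le> norm (t *\<^sub>R d)) (at_right 0)" by simp
    have "((\<lambda>t. norm (t *\<^sub>R d)) \<longlongrightarrow> norm (0 *\<^sub>R d)) (at_right (0::real))" by (intro tendsto_intros)
    then show "((\<lambda>t. norm (t *\<^sub>R d)) \<longlongrightarrow> 0) (at_right (0::real))" by simp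
  qed
  have q_lim: "((\<lambda>t. q Y (y t) d) \<longlongrightarrow> q Y xb d) (at_right 0)"
  proof -
    have "isCont (\<lambda>x. q Y x d) xb"
      unfolding q_def
      by (intro continuous_intros bounded_bilinear.continuous[OF bounded_bilinear_blinfun_apply])
        (use f2_cont G2_cont in \<open>auto simp: continuous_on_eq_continuous_at\<close>)
    then show ?thesis using y_lim by (rule isCont_tendsto_compose)
  qed
  \<comment> \<open>Chosen so that \<open>G (xb + t d) + U'\<close> is exactly the feasible
    arc.\<close>
  let ?U' = "\<lambda>t. X + ?U + t *\<^sub>R H + t\<^sup>2 *\<^sub>R Q - G (xb + t *\<^sub>R d)"
  have "isCont G xb" using has_derivative_continuous[OF G1] .
  moreover have "((\<lambda>t. xb + t *\<^sub>R d) \<longlongrightarrow> xb) (at_right (0::real))"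
    using tendsto_add[OF tendsto_const[of xb] tendsto_scaleR[OF tendsto_ident_at[of 0 "{0<..}"] tendsto_const[of d]]] by simp
  ultimately have G_lim: "((\<lambda>t. G (xb + t *\<^sub>R d)) \<longlongrightarrow> G xb) (at_right (0::real))"
    by (rule isCont_tendsto_compose)
  have "((\<lambda>t. (xb + t *\<^sub>R d, ?U' t)) \<longlongrightarrow> (xb + 0 *\<^sub>R d, X + ?U + 0 *\<^sub>R H + 0\<^sup>2 *\<^sub>R Q - G xb)) (at_right (0::real))"
    by (intro tendsto_intros G_lim)
  then have "((\<lambda>t. (xb + t *\<^sub>R d, ?U' t)) \<longlongrightarrow> (xb, ?U)) (at_right (0::real))" by (simp add: G_xb)
  then have "eventually (\<lambda>t. (xb + t *\<^sub>R d, ?U' t) \<in> N) (at_right 0)"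
    using N zN by (auto dest!: topological_tendstoD)
  moreover have "eventually (\<lambda>t::real. 0 < t) (at_right 0)" by (rule eventually_at_right_less)
  ultimately have ev: "eventually (\<lambda>t. \<mu> * (norm d)\<^sup>2 \<le> q Y (y t) d / 2 - Upsilon X Y H / 2 + r / 2 * (n t)\<^sup>2) (at_right 0)"
  proof eventually_elim
    case (elim t)
    define w where "w = ?U' t - ?U"
    have "?U' t \<in> Sym" using psd_subset_Sym[OF arc] G_Sym by (intro subspace_diff subspace_Sym) 
    then have "f xb + r / 2 * (norm ?U)\<^sup>2 + ((Y + r *\<^sub>R ?U) \<bullet> w + \<mu> * (norm (xb + t *\<^sub>R d - xb))\<^sup>2)
      \<le> f (xb + t *\<^sub>R d) + r / 2 * (norm (?U' t))\<^sup>2"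
      unfolding w_def using arc[of t] by (intro growth elim(1)) (auto simp: algebra_simps)
    also have "?U' t = ?U + w" by (simp add: w_def)
    also have "r / 2 * (norm (?U + w))\<^sup>2 = r / 2 * (norm ?U)\<^sup>2 + (r *\<^sub>R ?U) \<bullet> w + r / 2 * (norm w)\<^sup>2"
      unfolding power2_norm_eq_inner by (simp add: inner_add_left inner_add_right inner_commute algebra_simps)
    finally have 1: "\<mu> * (norm (t *\<^sub>R d))\<^sup>2 \<le> f (xb + t *\<^sub>R d) - f xb - Y \<bullet> w + r / 2 * (norm w)\<^sup>2"
      by (simp add: inner_add_left)
    have "Y \<bullet> w = t\<^sup>2 * (Upsilon X Y H / 2) - Y \<bullet> G (xb + t *\<^sub>R d)"
      using XY by (simp add: w_def inner_diff_right inner_add_right YH YQ inner_commute[of X])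
    then have 2: "f (xb + t *\<^sub>R d) - f xb - Y \<bullet> w = t\<^sup>2 * (q Y (y t) d / 2 - Upsilon X Y H / 2)"
      using y(2)[of t] XY by (simp add: Lag_def G_xb inner_commute[of Y X] right_diff_distrib)
    have "w = - (G (xb + t *\<^sub>R d) - X - t *\<^sub>R H) + t\<^sup>2 *\<^sub>R Q" by (simp add: w_def)
    then have "norm w \<le> norm (G (xb + t *\<^sub>R d) - X - t *\<^sub>R H) + t\<^sup>2 * norm Q"
      using norm_triangle_ineq[of "- (G (xb + t *\<^sub>R d) - X - t *\<^sub>R H)" "t\<^sup>2 *\<^sub>R Q"]
      unfolding norm_minus_cancel by simp
    also have "\<dots> = t * n t" using elim(2) by (simp add: n_def power2_eq_square distrib_left)
    finally have "(norm w)\<^sup>2 \<le> (t * n t)\<^sup>2" by (intro power_mono) auto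
    then have "r / 2 * (norm w)\<^sup>2 \<le> r / 2 * (t * n t)\<^sup>2" using r by (intro mult_left_mono) auto
    with 1 2 have "t\<^sup>2 * (\<mu> * (norm d)\<^sup>2) \<le> t\<^sup>2 * (q Y (y t) d / 2 - Upsilon X Y H / 2 + r / 2 * (n t)\<^sup>2)"
      by (simp add: power_mult_distrib algebra_simps)
    then show ?case using elim(2) by simp
  qed
  have "((\<lambda>t. q Y (y t) d / 2 - Upsilon X Y H / 2 + r / 2 * (n t)\<^sup>2) \<longlongrightarrow> q Y xb d / 2 - Upsilon X Y H / 2 + r / 2 * 0\<^sup>2) (at_right 0)"
    by (intro tendsto_intros q_lim n_lim) simp_all
  then have "\<mu> * (norm d)\<^sup>2 \<le> q Y xb d / 2 - Upsilon X Y H / 2 + r / 2 * 0\<^sup>2"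
    by (rule tendsto_lowerbound[OF _ ev]) simp
  moreover have "0 < \<mu> * (norm d)\<^sup>2" using \<mu> d by simp
  ultimately show "0 < q Y xb d - Upsilon X Y (G1 xb d)" by (simp add: H_def)
qed

end

theorem theorem3p3:
  fixes f :: "'a::euclidean_space \<Rightarrow> real"
    and G :: "'a \<Rightarrow> real^'n^'n"
    and xb :: 'a and Yb :: "real^'n^'n"
  assumes "C2 f" and "C2 G" and "\<forall>x. G x \<in> Sym"
    and "stationary f G xb" and "Yb \<in> multipliers f G xb"
  shows "(strong_var_suff f G xb Yb
          \<longleftrightarrow> (\<forall>d. d \<noteq> 0 \<and> frechet_derivative G (at xb) d \<in> affine hull (critical_cone (G xb) Yb) \<longrightarrow>
                 d \<bullet> Lxx f G xb Yb d - Upsilon (G xb) Yb (frechet_derivative G (at xb) d) > 0))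
       \<and> (strong_var_suff f G xb Yb
          \<longleftrightarrow> (\<exists>\<rho>0>0. \<exists>\<eta>>0. \<forall>\<rho>\<ge>\<rho>0. \<forall>W \<in> B_subdiff_proj_nsd (G xb + (1 / \<rho>) *\<^sub>R Yb).
                 \<forall>d. d \<bullet> (Lxx f G xb Yb d + \<rho> *\<^sub>R adjoint (frechet_derivative G (at xb))
                                (W (frechet_derivative G (at xb) d))) \<ge> \<eta> * (norm d)\<^sup>2))"
proof -
  obtain f1 f2 where f: "\<And>x. (f has_derivative blinfun_apply (f1 x)) (at x)"
    "\<And>x. (f1 has_derivative blinfun_apply (f2 x)) (at x)" "continuous_on UNIV f2"
    using assms(1) unfolding C2_def by blast
  obtain G1 G2 where G: "\<And>x. (G has_derivative blinfun_apply (G1 x)) (at x)"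
    "\<And>x. (G1 has_derivative blinfun_apply (G2 x)) (at x)" "continuous_on UNIV G2"
    using assms(2) unfolding C2_def by blast
  interpret c2_problem f f1 f2 G G1 G2 using f G assms(3) by unfold_locales auto
  have Y: "Yb \<in> nsd" "G xb \<in> psd" "G xb \<bullet> Yb = 0"
    and stat: "frechet_derivative (\<lambda>x. Lag f G x Yb) (at xb) = (\<lambda>d. 0)"
    using assms(5) by (auto simp: multipliers_def)
  obtain P l m where P: "orthogonal_matrix P" and Xd: "G xb = conj_by P (diag_mat l)"
    and Yd: "Yb = conj_by P (diag_mat m)" and lm: "\<And>i. 0 \<le> l i" "\<And>i. m i \<le> 0" "\<And>i. l i * m i = 0"
    using simultaneous_diagonalization[OF Y(2,1,3)] by metis
  interpret cp: complementary_pair P l m using P lm by unfold_locales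
  have XY: "cp.X = G xb" "cp.Y = Yb" by (simp_all add: cp.X_def cp.Y_def Xd Yd)
  interpret sdp P l m f f1 f2 G G1 G2 xb
    using stat by unfold_locales (auto simp: XY frechet_Lag fun_eq_iff)
  \<comment> \<open>Both equivalences pass through \<open>ssosc\<close>, which is stated with
    \<open>pen\<close> and thus in the eigenbasis; the affine hull theorem removes that
    dependence.\<close>
  have "strong_var_suff f G xb Yb \<longleftrightarrow> ssosc"
    using ssosc_imp_strong_var_suff strong_var_suff_imp_ssosc by (auto simp: XY)
  moreover have "ssosc \<longleftrightarrow> (\<forall>d. d \<noteq> 0 \<and> frechet_derivative G (at xb) d \<in> affine hull (critical_cone (G xb) Yb) \<longrightarrow>
                 d \<bullet> Lxx f G xb Yb d - Upsilon (G xb) Yb (frechet_derivative G (at xb) d) > 0)"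
    using cp.affine_hull_critical_cone by (simp add: ssosc_def XY frechet_G inner_Lxx G1_Sym)
  ultimately show ?thesis
    using uniform_pd_iff_ssosc unfolding uniform_pd_def XY by blast
qed

end
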